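(* Let $0<\alpha<2$, $0<\nu<1$, let $\{X(t),t\in\mathbb{R}\}$ be Takenaka's process with parameters $(\alpha,\nu)$, put $H=\nu/\alpha$ (its self-similarity index) and $b_n=n^{\frac{\nu-1}{2}}$. Then for every $\beta\in(-\frac12,0)$ and all $-\frac12<\beta_1<\beta_2<0$, the estimators $\widehat H_n$ (built from $\beta$) and $\hat\alpha_n$ (built from $\beta_1,\beta_2$) satisfy, as $n\to+\infty$, $$\widehat H_n\xrightarrow{\mathbb{P}}H,\quad \hat\alpha_n\xrightarrow{\mathbb{P}}\alpha,\quad \widehat H_n-H=O_{\mathbb{P}}(b_n),\quad \hat\alpha_n-\alpha=O_{\mathbb{P}}(b_n).$$
   Context: Takenaka's process: let $M$ be a symmetric $\alpha$-stable random measure on $\mathbb{R}\times\mathbb{R}^+$ with control measure $m(dx,dr)=r^{\nu-2}dx\,dr$ (so for $f\in L^\alpha(m)$, $\mathbb{E}\exp(i\theta\int f\,dM)=\exp(-|\theta|^\alpha\int|f|^\alpha dm)$). For $t\in\mathbb{R}$ let $C_t=\{(x,r)\in\mathbb{R}\times\mathbb{R}^+:|x-t|\le r\}$ and $S_t=C_t\Delta C_0$ (symmetric difference). Then $X(t)=\int_{\mathbb{R}\times\mathbb{R}^+}\mathbf{1}_{S_t}(x,r)\,M(dx,dr)$. It is $\nu/\alpha$-self-similar with stationary increments. Increments: fix integers $L\ge1,K\ge1$ and reals $a_0,\dots,a_K$ with $\sum_{k=0}^K k^q a_k=0$ for all $q\in\{0,\dots,L\}$ and $\sum_{k=0}^K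 k^{L+1}a_k\ne0$ (convention $0^0=1$). Set $\triangle_{p,n}X=\sum_{k=0}^K a_k X\left(\frac{k+p}{n}\right)$. For $\gamma\in(-\frac12,0)$: $V_n(\gamma)=\frac{1}{n-K+1}\sum_{p=0}^{n-K}|\triangle_{p,n}X|^{\gamma}$ and $W_n(\gamma)=n^{\gamma H}V_n(\gamma)$. When $n/2$ appears, $n$ is even (and large enough). Estimator of $H$: $\widehat H_n=\frac1\beta\log_2\frac{V_{n/2}(\beta)}{V_n(\beta)}$. Estimator of $\alpha$: for $u>v>0$ let $\psi_{u,v}(x,y)=-v\ln x+u\ln y+C(u,v)$ ($x,y>0$) with $C(u,v)=\frac{u-v}{2}\ln\pi+u\ln\Gamma(1+\frac v2)+v\ln\Gamma(\frac{1-u}{2})-v\ln\Gamma(1+\frac u2)-u\ln\Gamma(\frac{1-v}{2})$; $h_{u,v}:(0,+\infty)\to(-\infty,0)$, $h_{u,v}(x)=u\ln\Gamma(1+\frac vx)-v\ln\Gamma(1+\frac ux)$, which is a bijection; $\varphi_{u,v}(x)=0$ if $x\ge0$ and $\varphi_{u,v}(x)=h_{u,v}^{-1}(x)$ if $x<0$. Then $\hat\alpha_n=\varphi_{-\beta_1,-\beta_2}\left(\psi_{-\beta_1,-\beta_2}(W_n(\beta_1),W_n(\beta_2))\right)$. $X_n=O_{\mathbb{P}}(1)$ means: for all $\epsilon>0$ there is $M>0$ with $\sup_n\mathbb{P}(|X_n|>M)<\epsilon$; $Y_n=O_{\mathbb{P}}(a_n)$ means $Y_n=a_nX_n$ with $X_n=O_{\mathbb{P}}(1)$.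 *)

theory Defs
  imports "HOL-Probability.Probability"
begin

text \<open>Symmetric stable random measures and the associated stochastic integral.\<close>

definition finite_measure_sets :: "'e measure \<Rightarrow> 'e set set" where
  "finite_measure_sets m = {A \<in> sets m. emeasure m A < \<infinity>}"

text \<open>An independently scattered, almost surely countably additive set function on the sets of
  finite control measure, such that the value at \<open>A\<close> is symmetric \<open>\<alpha>\<close>-stable with scale
  parameter \<open>m(A) powr (1/\<alpha>)\<close>.\<close>

definition sas_random_measure ::
  "'w measure \<Rightarrow> 'e measure \<Rightarrow> real \<Rightarrow> ('e set \<Rightarrow> 'w \<Rightarrow> real) \<Rightarrow> bool" where
  "sas_random_measure P m \<alpha> M \<longleftrightarrow>
     (\<forall>A \<in> finite_measure_sets m. M A \<in> borel_measurable P) \<and>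
     (\<forall>A \<in> finite_measure_sets m. \<forall>\<theta>.
        char (distr P borel (M A)) \<theta> =
          complex_of_real (exp (- (\<bar>\<theta>\<bar> powr \<alpha> * measure m A)))) \<and>
     (\<forall>(A :: nat \<Rightarrow> 'e set) k.
        (\<forall>i<k. A i \<in> finite_measure_sets m) \<and> disjoint_family_on A {..<k} \<longrightarrow>
        prob_space.indep_vars P (\<lambda>_. borel) (\<lambda>i. M (A i)) {..<k}) \<and>
     (\<forall>A :: nat \<Rightarrow> 'e set.
        range A \<subseteq> finite_measure_sets m \<and> disjoint_family A \<and>
        (\<Union>i. A i) \<in> finite_measure_sets m \<longrightarrow>
        (AE \<omega> in P. (\<lambda>i. M (A i) \<omega>) sums M (\<Union>i. A i) \<omega>))"

definition conv_in_prob ::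
  "'w measure \<Rightarrow> nat filter \<Rightarrow> (nat \<Rightarrow> 'w \<Rightarrow> real) \<Rightarrow> ('w \<Rightarrow> real) \<Rightarrow> bool" where
  "conv_in_prob P F Y Z \<longleftrightarrow>
     (\<forall>\<epsilon>>0. ((\<lambda>n. measure P {\<omega> \<in> space P. \<epsilon> < \<bar>Y n \<omega> - Z \<omega>\<bar>}) \<longlongrightarrow> 0) F)"

text \<open>The value \<open>0\<close> contributes nothing, so \<open>M\<close> effectively is only evaluated at sets of finite
  control measure if \<open>s\<close> is a simple function supported on such a set.\<close>

definition simple_stochastic_integral ::
  "'e measure \<Rightarrow> ('e set \<Rightarrow> 'w \<Rightarrow> real) \<Rightarrow> ('e \<Rightarrow> real) \<Rightarrow> 'w \<Rightarrow> real" where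
  "simple_stochastic_integral m M s \<omega> = (\<Sum>y \<in> s ` space m. y * M {x \<in> space m. s x = y} \<omega>)"

text \<open>\<open>Y\<close> is (a version of) the integral of \<open>f \<in> L\<^sup>\<alpha>(m)\<close> with respect to \<open>M\<close>: the limit in
  probability of integrals of simple functions converging to \<open>f\<close> in \<open>L\<^sup>\<alpha>(m)\<close>.\<close>

definition has_stochastic_integral ::
  "'w measure \<Rightarrow> 'e measure \<Rightarrow> real \<Rightarrow> ('e set \<Rightarrow> 'w \<Rightarrow> real) \<Rightarrow> ('e \<Rightarrow> real) \<Rightarrow> ('w \<Rightarrow> real) \<Rightarrow> bool"
  where
  "has_stochastic_integral P m \<alpha> M f Y \<longleftrightarrow>
     f \<in> borel_measurable m \<and> (\<integral>\<^sup>+x. ennreal (\<bar>f x\<bar> powr \<alpha>) \<partial>m) < \<infinity> \<and>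
     Y \<in> borel_measurable P \<and>
     (\<exists>s :: nat \<Rightarrow> 'e \<Rightarrow> real.
        (\<forall>j. simple_function m (s j) \<and> emeasure m {x \<in> space m. s j x \<noteq> 0} < \<infinity>) \<and>
        ((\<lambda>j. \<integral>\<^sup>+x. ennreal (\<bar>s j x - f x\<bar> powr \<alpha>) \<partial>m) \<longlonglongrightarrow> 0) \<and>
        conv_in_prob P sequentially (\<lambda>j. simple_stochastic_integral m M (s j)) Y)"


text \<open>Takenaka's process.\<close>

definition takenaka_control :: "real \<Rightarrow> (real \<times> real) measure" where
  "takenaka_control \<nu> =
     density (restrict_space lborel (UNIV \<times> {0<..})) (\<lambda>(x, r). ennreal (r powr (\<nu> - 2)))"

definition takenaka_cone :: "real \<Rightarrow> (real \<times> real) set" where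
  "takenaka_cone t = {(x, r). r > 0 \<and> \<bar>x - t\<bar> \<le> r}"

definition takenaka_set :: "real \<Rightarrow> (real \<times> real) set" where
  "takenaka_set t = (takenaka_cone t - takenaka_cone 0) \<union> (takenaka_cone 0 - takenaka_cone t)"

definition takenaka_process ::
  "'w measure \<Rightarrow> real \<Rightarrow> real \<Rightarrow> (real \<Rightarrow> 'w \<Rightarrow> real) \<Rightarrow> bool" where
  "takenaka_process P \<alpha> \<nu> X \<longleftrightarrow>
     (\<exists>M. sas_random_measure P (takenaka_control \<nu>) \<alpha> M \<and>
        (\<forall>t. has_stochastic_integral P (takenaka_control \<nu>) \<alpha> M
               (indicator (takenaka_set t)) (X t)))"


text \<open>Increments and power variations of negative order. In \<open>variation\<close> the value \<open>0 powr \<gamma> = 0\<close>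
  stands in for the undefined negative power of a vanishing increment.\<close>

definition increment ::
  "nat \<Rightarrow> (nat \<Rightarrow> real) \<Rightarrow> (real \<Rightarrow> 'w \<Rightarrow> real) \<Rightarrow> nat \<Rightarrow> nat \<Rightarrow> 'w \<Rightarrow> real" where
  "increment K a X p n \<omega> = (\<Sum>k = 0..K. a k * X ((real k + real p) / real n) \<omega>)"

text \<open>Only meaningful for \<open>n \<ge> K\<close>.\<close>

definition variation ::
  "nat \<Rightarrow> (nat \<Rightarrow> real) \<Rightarrow> (real \<Rightarrow> 'w \<Rightarrow> real) \<Rightarrow> real \<Rightarrow> nat \<Rightarrow> 'w \<Rightarrow> real" where
  "variation K a X \<gamma> n \<omega> =
     1 / (real n - real K + 1) * (\<Sum>p = 0..n - K. \<bar>increment K a X p n \<omega>\<bar> powr \<gamma>)"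

definition scaled_variation ::
  "nat \<Rightarrow> (nat \<Rightarrow> real) \<Rightarrow> (real \<Rightarrow> 'w \<Rightarrow> real) \<Rightarrow> real \<Rightarrow> real \<Rightarrow> nat \<Rightarrow> 'w \<Rightarrow> real" where
  "scaled_variation K a X H \<gamma> n \<omega> = real n powr (\<gamma> * H) * variation K a X \<gamma> n \<omega>"


text \<open>The estimators.\<close>

text \<open>Only meaningful for even \<open>n\<close> with \<open>n div 2 \<ge> K\<close>.\<close>

definition H_estimator ::
  "nat \<Rightarrow> (nat \<Rightarrow> real) \<Rightarrow> (real \<Rightarrow> 'w \<Rightarrow> real) \<Rightarrow> real \<Rightarrow> nat \<Rightarrow> 'w \<Rightarrow> real" where
  "H_estimator K a X \<beta> n \<omega> =
     1 / \<beta> * log 2 (variation K a X \<beta> (n div 2) \<omega> / variation K a X \<beta> n \<omega>)"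

definition C_const :: "real \<Rightarrow> real \<Rightarrow> real" where
  "C_const u v =
     (u - v) / 2 * ln pi + u * ln (Gamma (1 + v / 2)) + v * ln (Gamma ((1 - u) / 2))
     - v * ln (Gamma (1 + u / 2)) - u * ln (Gamma ((1 - v) / 2))"

definition psi_fun :: "real \<Rightarrow> real \<Rightarrow> real \<Rightarrow> real \<Rightarrow> real" where
  "psi_fun u v x y = - v * ln x + u * ln y + C_const u v"

definition h_fun :: "real \<Rightarrow> real \<Rightarrow> real \<Rightarrow> real" where
  "h_fun u v x = u * ln (Gamma (1 + v / x)) - v * ln (Gamma (1 + u / x))"

definition phi_fun :: "real \<Rightarrow> real \<Rightarrow> real \<Rightarrow> real" where
  "phi_fun u v x = (if x \<ge> 0 then 0 else the_inv_into {0<..} (h_fun u v) x)"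

definition alpha_estimator ::
  "nat \<Rightarrow> (nat \<Rightarrow> real) \<Rightarrow> (real \<Rightarrow> 'w \<Rightarrow> real) \<Rightarrow> real \<Rightarrow> real \<Rightarrow> real \<Rightarrow> nat \<Rightarrow> 'w \<Rightarrow> real" where
  "alpha_estimator K a X H \<beta>\<^sub>1 \<beta>\<^sub>2 n \<omega> =
     phi_fun (- \<beta>\<^sub>1) (- \<beta>\<^sub>2)
       (psi_fun (- \<beta>\<^sub>1) (- \<beta>\<^sub>2)
         (scaled_variation K a X H \<beta>\<^sub>1 n \<omega>) (scaled_variation K a X H \<beta>\<^sub>2 n \<omega>))"


text \<open>Asymptotics along an infinite index set \<open>N\<close>, namely the indices for which the estimator at
  hand is defined.\<close>

definition at_top_along :: "nat set \<Rightarrow> nat filter" where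
  "at_top_along N = inf sequentially (principal N)"

definition OP1 :: "'w measure \<Rightarrow> nat set \<Rightarrow> (nat \<Rightarrow> 'w \<Rightarrow> real) \<Rightarrow> bool" where
  "OP1 P N Y \<longleftrightarrow>
     (\<forall>n\<in>N. Y n \<in> borel_measurable P) \<and>
     (\<forall>\<epsilon>>0. \<exists>M>0. (SUP n\<in>N. measure P {\<omega> \<in> space P. \<bar>Y n \<omega>\<bar> > M}) < \<epsilon>)"

definition OP ::
  "'w measure \<Rightarrow> nat set \<Rightarrow> (nat \<Rightarrow> real) \<Rightarrow> (nat \<Rightarrow> 'w \<Rightarrow> real) \<Rightarrow> bool" where
  "OP P N b Y \<longleftrightarrow>
     (\<exists>Z. OP1 P N Z \<and> (\<forall>n\<in>N. \<forall>\<omega>\<in>space P. Y n \<omega> = b n * Z n \<omega>))"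

end

theory Submission
  imports Defs
begin

text \<open>
  Everything rests on the identity
  \<open>\<bar>x\<bar> powr \<beta> = c \<integral> s powr (- \<beta> / 2 - 1) * exp (- s x\<^sup>2 / 2) ds\<close> over \<open>s > 0\<close>, valid for \<open>\<beta> < 0\<close>
  and \<open>x \<noteq> 0\<close>, combined with the fact that \<open>exp (- s x\<^sup>2 / 2)\<close> is the expectation of
  \<open>exp (\<i> * sqrt s * x * N)\<close> for a standard normal \<open>N\<close>. Together they express negative moments through
  characteristic functions by nonnegative, hence freely exchangeable, integrals. There are two
  consequences. A variable with characteristic function \<open>exp (- \<kappa> \<bar>y\<bar> powr \<alpha>)\<close> has the explicit moment
  \<open>stable_moment \<alpha> \<beta> \<kappa>\<close> of order \<open>\<beta>\<close> (\<open>stable_abs_moment\<close>). And if the joint characteristic function of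
  \<open>U\<close> and \<open>V\<close> is real and at most \<open>exp (- \<kappa> (\<bar>y\<bar> powr \<alpha> + \<bar>z\<bar> powr \<alpha>))\<close>, then the expectation of
  \<open>\<bar>U\<bar> powr \<beta> * \<bar>V\<bar> powr \<beta>\<close> is at most the square of that moment
  (\<open>stable_abs_moment_product_le\<close>). So covariance bounds reduce to lower bounds for the exponent of a
  joint characteristic function.

  For Takenaka's process this exponent is \<open>\<integral> \<bar>y f + z g\<bar> powr \<alpha>\<close> with respect to the control measure,
  where \<open>f\<close> and \<open>g\<close> are, up to a common sign, combinations of indicators of cones. Since the coefficients
  sum to zero, \<open>f\<close> vanishes at \<open>(x, r)\<close> unless an end point of the interval \<open>[x - r, x + r]\<close> lies within
  the stretch covered by the increment. For two increments \<open>l\<close> steps apart both can be nonzero only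
  if one end point belongs to each stretch, which confines \<open>(x, r)\<close> to a box with \<open>r\<close> of order \<open>l\<close>; the
  box has control measure at most of order \<open>l powr (\<nu> - 2)\<close>. Off this box the integrand splits, so the
  joint exponent falls short of the independent one at most by a fraction of this order, and the
  covariance at lag \<open>l\<close> has at most this order. As \<open>\<nu> < 1\<close> these bounds are summable. Hence the
  normalised variation has mean square error of order \<open>1 / n\<close> around the moment of a single scaled
  increment, and \<open>1 / n\<close> is at most \<open>n powr (\<nu> - 1)\<close>, the square of the rate. The few small lags
  are handled by moments of order \<open>2 \<beta>\<close>; this is where \<open>\<beta> > - 1/2\<close> enters.

  Both estimators are functions of two such variations that are Lipschitz near the limits. For the
  estimator of \<open>H\<close> the function is a difference of logarithms. For the estimator of \<open>\<alpha>\<close> the constant in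
  \<open>psi_fun\<close> cancels all Gamma factors of the moments that do not involve \<open>\<alpha>\<close>, leaving \<open>h_fun u v \<alpha>\<close>,
  and the inverse of \<open>h_fun u v\<close> is Lipschitz near this value because the digamma function is strictly
  increasing. Chebyshev's inequality then gives consistency and the rate
  (\<open>consistency_and_rate_from_mean_square\<close>).
\<close>

section \<open>Gaussian mixtures of negative powers\<close>

text \<open>
  The substitution \<open>w = \<kappa> * s powr p\<close> turns this into Euler's integral for \<open>Gamma (q / p)\<close>.
\<close>

lemma nn_integral_powr_exp_powr:
  fixes q p \<kappa> :: real
  assumes "q > 0" "p > 0" "\<kappa> > 0"
  shows "(\<integral>\<^sup>+s\<in>{0<..}. ennreal (s powr (q - 1) * exp (- (\<kappa> * s powr p))) \<partial>lborel)
    = ennreal (Gamma (q / p) * \<kappa> powr (- (q / p)) / p)"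
proof -
  define f where "f = (\<lambda>w::real. w powr (q / p - 1) / exp w)"
  define g where "g = (\<lambda>s::real. \<kappa> * s powr p)"
  define g' where "g' = (\<lambda>s::real. \<kappa> * (p * s powr (p - 1)))"
  have f0: "(f has_integral Gamma (q / p)) {0<..}"
  proof -
    have "(f has_integral Gamma (q / p)) {0..}"
      unfolding f_def using assms by (intro Gamma_integral_real) simp
    then have "((\<lambda>t. if t \<in> {0<..} then f t else 0) has_integral Gamma (q / p)) {0..}"
      by (rule has_integral_spike [of "{0}", rotated 2]) auto
    then show ?thesis by (subst (asm) has_integral_restrict) auto
  qed
  have fabs: "f absolutely_integrable_on {0<..}"
    using f0 by (intro nonnegative_absolutely_integrable_1) (auto simp: f_def integrable_on_def)
  have img: "g ` {0<..} = {0<..}"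
  proof safe
    fix w :: real assume "w > 0"
    then have "w = g ((w / \<kappa>) powr (1 / p))"
      using assms by (simp add: g_def powr_powr)
    moreover have "(w / \<kappa>) powr (1 / p) > 0" using \<open>w > 0\<close> assms by simp
    ultimately show "w \<in> g ` {0<..}" by blast
  qed (use assms in \<open>auto simp: g_def\<close>)
  have inj: "inj_on g {0<..}"
  proof (rule inj_onI)
    fix x y :: real assume "x \<in> {0<..}" "y \<in> {0<..}" "g x = g y"
    then have "(x powr p) powr (1/p) = (y powr p) powr (1/p)" using assms by (simp add: g_def)
    then show "x = y" using assms \<open>x \<in> {0<..}\<close> \<open>y \<in> {0<..}\<close> by (simp add: powr_powr)
  qed
  have der: "(g has_field_derivative g' x) (at x within {0<..})" if "x \<in> {0<..}" for x
    unfolding g_def g'_def using that by (auto intro!: derivative_eq_intros)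
  have ch: "(\<lambda>x. \<bar>g' x\<bar> * f (g x)) absolutely_integrable_on {0<..} \<and>
      integral {0<..} (\<lambda>x. \<bar>g' x\<bar> * f (g x)) = Gamma (q / p)"
    using has_absolute_integral_change_of_variables_1'[OF _ der inj, of f "Gamma (q/p)"] fabs f0
    by (auto simp: img integral_unique)
  have eq: "\<bar>g' x\<bar> * f (g x) = p * \<kappa> powr (q / p) * (x powr (q - 1) * exp (- (\<kappa> * x powr p)))"
    if "x \<in> {0<..}" for x
  proof -
    have x: "x > 0" using that by simp
    have e1: "(\<kappa> * x powr p) powr (q / p - 1) = \<kappa> powr (q / p - 1) * x powr (q - p)"
      using assms x by (simp add: powr_mult powr_powr algebra_simps)
    have e2: "x powr (p - 1) * x powr (q - p) = x powr (q - 1)"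
      by (simp flip: powr_add)
    have e3: "\<kappa> * \<kappa> powr (q / p - 1) = \<kappa> powr (q / p)"
      using assms by (simp add: powr_diff)
    have "\<bar>g' x\<bar> * f (g x) = (\<kappa> * \<kappa> powr (q / p - 1)) * p * (x powr (p - 1) * x powr (q - p))
        / exp (\<kappa> * x powr p)"
      using assms x by (simp add: g'_def f_def g_def e1 abs_mult)
    then show ?thesis unfolding e2 e3 by (simp add: exp_minus field_simps)
  qed
  have "((\<lambda>x. \<bar>g' x\<bar> * f (g x)) has_integral Gamma (q / p)) {0<..}"
    using ch by (metis has_integral_integrable_integral set_lebesgue_integral_eq_integral(1))
  then have "((\<lambda>x. p * \<kappa> powr (q / p) * (x powr (q - 1) * exp (- (\<kappa> * x powr p))))
      has_integral Gamma (q / p)) {0<..}"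
    using eq by (subst (asm) has_integral_cong) auto
  then have "((\<lambda>x. (1 / (p * \<kappa> powr (q / p))) * (p * \<kappa> powr (q / p) * (x powr (q - 1) * exp (- (\<kappa> * x powr p)))))
      has_integral (1 / (p * \<kappa> powr (q / p))) * Gamma (q / p)) {0<..}"
    by (rule has_integral_mult_right)
  then have "((\<lambda>x. x powr (q - 1) * exp (- (\<kappa> * x powr p)))
      has_integral Gamma (q / p) * \<kappa> powr (- (q / p)) / p) {0<..}"
    using assms by (simp add: powr_minus field_simps)
  then show ?thesis
    by (rule nn_integral_has_integral_lebesgue'[rotated]) auto
qed

text \<open>
  By symmetry this is twice the integral over the positive half-line, where the preceding lemma
  applies with \<open>p = 2\<close>.
\<close>

lemma nn_integral_std_normal_powr:
  assumes "\<beta> > -1"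
  shows "(\<integral>\<^sup>+x. ennreal (\<bar>x\<bar> powr \<beta>) \<partial>std_normal_distribution)
    = ennreal (2 powr (\<beta> / 2) * Gamma ((1 + \<beta>) / 2) / sqrt pi)"
proof -
  define h where "h = (\<lambda>x::real. ennreal (std_normal_density x) * ennreal (\<bar>x\<bar> powr \<beta>))"
  have hm [measurable]: "h \<in> borel_measurable borel" unfolding h_def by measurable
  have pos: "(\<integral>\<^sup>+x\<in>{0<..}. h x \<partial>lborel)
      = ennreal (2 powr (\<beta> / 2) * Gamma ((1 + \<beta>) / 2) / sqrt pi / 2)"
  proof -
    have "(\<integral>\<^sup>+x\<in>{0<..}. h x \<partial>lborel) =
      (\<integral>\<^sup>+x. ennreal (1 / sqrt (2 * pi)) * (ennreal (x powr ((1 + \<beta>) - 1) * exp (- ((1/2) * x powr 2))) * indicator {0<..} x) \<partial>lborel)"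
      by (intro nn_integral_cong)
         (auto simp: h_def std_normal_density_def indicator_def ennreal_mult[symmetric] mult_ac powr_numeral)
    also have "\<dots> = ennreal (1 / sqrt (2 * pi)) * ennreal (Gamma ((1 + \<beta>) / 2) * (1/2) powr (- ((1 + \<beta>) / 2)) / 2)"
      using assms nn_integral_powr_exp_powr[of "1 + \<beta>" 2 "1/2"]
      by (subst nn_integral_cmult) (auto simp: algebra_simps)
    also have "\<dots> = ennreal (1 / sqrt (2 * pi) * (Gamma ((1 + \<beta>) / 2) * (1/2) powr (- ((1 + \<beta>) / 2)) / 2))"
      using assms by (intro ennreal_mult[symmetric]) (auto intro!: divide_nonneg_nonneg mult_nonneg_nonneg less_imp_le[OF Gamma_real_pos])
    also have "1 / sqrt (2 * pi) * (Gamma ((1 + \<beta>) / 2) * (1/2) powr (- ((1 + \<beta>) / 2)) / 2)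
        = 2 powr (\<beta> / 2) * Gamma ((1 + \<beta>) / 2) / sqrt pi / 2"
    proof -
      have "(1/2::real) powr (- ((1 + \<beta>) / 2)) = 2 powr ((1 + \<beta>) / 2)"
        by (simp add: powr_minus powr_divide)
      also have "\<dots> = sqrt 2 * 2 powr (\<beta> / 2)"
        by (simp add: powr_half_sqrt[symmetric] powr_add[symmetric] add_divide_distrib)
      finally show ?thesis by (simp add: real_sqrt_mult field_simps)
    qed
    finally show ?thesis .
  qed
  have neg: "(\<integral>\<^sup>+x\<in>{..<0}. h x \<partial>lborel) = (\<integral>\<^sup>+x\<in>{0<..}. h x \<partial>lborel)"
    by (subst nn_integral_real_affine[where c="-1" and t=0])
       (auto intro!: nn_integral_cong simp: h_def normal_density_def indicator_def)
  have "(\<integral>\<^sup>+x. ennreal (\<bar>x\<bar> powr \<beta>) \<partial>std_normal_distribution) = (\<integral>\<^sup>+x. h x \<partial>lborel)"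
    by (subst nn_integral_density) (auto simp: h_def)
  also have "\<dots> = (\<integral>\<^sup>+x. h x * indicator {..<0} x + h x * indicator {0<..} x \<partial>lborel)"
    by (rule nn_integral_cong_AE, rule AE_I[of _ _ "{0}"]) (auto simp: indicator_def)
  also have "\<dots> = (\<integral>\<^sup>+x\<in>{..<0}. h x \<partial>lborel) + (\<integral>\<^sup>+x\<in>{0<..}. h x \<partial>lborel)"
    by (rule nn_integral_add) auto
  also have "\<dots> = ennreal (2 powr (\<beta> / 2) * Gamma ((1 + \<beta>) / 2) / sqrt pi)"
    unfolding neg pos using assms
    by (subst ennreal_plus[symmetric]) (auto intro!: divide_nonneg_nonneg mult_nonneg_nonneg less_imp_le[OF Gamma_real_pos])
  finally show ?thesis .
qed

text \<open>
  The weight on \<open>s > 0\<close> for which the kernels \<open>exp (- s x\<^sup>2 / 2)\<close> mix to \<open>\<bar>x\<bar> powr \<beta>\<close>.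
\<close>

definition gauss_mixing :: "real \<Rightarrow> real measure" where
  "gauss_mixing \<beta> = density lborel
     (\<lambda>s. ennreal (2 powr (\<beta> / 2) / Gamma (- \<beta> / 2) * s powr (- \<beta> / 2 - 1)) * indicator {0<..} s)"

lemma sets_gauss_mixing [simp, measurable_cong]: "sets (gauss_mixing \<beta>) = sets borel"
  by (simp add: gauss_mixing_def)

lemma AE_gauss_mixing_pos: "AE s in gauss_mixing \<beta>. s > 0"
  unfolding gauss_mixing_def by (subst AE_density) (auto simp: indicator_def)

lemma sigma_finite_gauss_mixing: "sigma_finite_measure (gauss_mixing \<beta>)"
  unfolding gauss_mixing_def
  by (subst lborel.sigma_finite_measure_axioms[THEN sigma_finite_measure.sigma_finite_iff_density_finite])
     (auto simp: indicator_def ennreal_mult_less_top)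

lemma nn_integral_gauss_mixing:
  assumes "\<beta> < 0" and [measurable]: "f \<in> borel_measurable borel"
  shows "(\<integral>\<^sup>+s. f s \<partial>gauss_mixing \<beta>) = ennreal (2 powr (\<beta> / 2) / Gamma (- \<beta> / 2)) *
    (\<integral>\<^sup>+s\<in>{0<..}. ennreal (s powr (- \<beta> / 2 - 1)) * f s \<partial>lborel)"
proof -
  have G: "Gamma (- \<beta> / 2) > 0" using assms by (intro Gamma_real_pos) auto
  have "(\<integral>\<^sup>+s. f s \<partial>gauss_mixing \<beta>) = (\<integral>\<^sup>+s. ennreal (2 powr (\<beta> / 2) / Gamma (- \<beta> / 2)) *
    (ennreal (s powr (- \<beta> / 2 - 1)) * f s * indicator {0<..} s) \<partial>lborel)"
    unfolding gauss_mixing_def ennreal_mult''[OF powr_ge_zero]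
    by (subst nn_integral_density) (simp_all add: mult_ac)
  also have "\<dots> = ennreal (2 powr (\<beta> / 2) / Gamma (- \<beta> / 2)) *
    (\<integral>\<^sup>+s. ennreal (s powr (- \<beta> / 2 - 1)) * f s * indicator {0<..} s \<partial>lborel)"
    by (subst nn_integral_cmult) auto
  finally show ?thesis .
qed

lemma nn_integral_gauss_mixing_exp:
  assumes "\<beta> < 0" "p > 0" "\<kappa> > 0"
  shows "(\<integral>\<^sup>+s. ennreal (exp (- (\<kappa> * s powr p))) \<partial>gauss_mixing \<beta>)
    = ennreal (2 powr (\<beta> / 2) / Gamma (- \<beta> / 2) * (Gamma (- \<beta> / (2 * p)) * \<kappa> powr (\<beta> / (2 * p)) / p))"
proof -
  have G: "Gamma (- \<beta> / 2) > 0" "Gamma (- \<beta> / (2 * p)) > 0"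
    using assms by (auto intro!: Gamma_real_pos divide_neg_pos)
  have "(\<integral>\<^sup>+s\<in>{0<..}. ennreal (s powr (- \<beta> / 2 - 1)) * ennreal (exp (- (\<kappa> * s powr p))) \<partial>lborel)
    = ennreal (Gamma (- \<beta> / (2 * p)) * \<kappa> powr (\<beta> / (2 * p)) / p)"
    using nn_integral_powr_exp_powr[of "- \<beta> / 2" p \<kappa>] assms by (simp add: ennreal_mult')
  then show ?thesis
    using assms G by (subst nn_integral_gauss_mixing) (auto simp flip: ennreal_mult)
qed

lemma abs_powr_eq_gauss_mixture:
  assumes "\<beta> < 0" "x \<noteq> 0"
  shows "(\<integral>\<^sup>+s. ennreal (exp (- s * x\<^sup>2 / 2)) \<partial>gauss_mixing \<beta>) = ennreal (\<bar>x\<bar> powr \<beta>)"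
proof -
  have G: "Gamma (- \<beta> / 2) > 0" using assms by (intro Gamma_real_pos) auto
  have x2: "x\<^sup>2 / 2 > 0" using assms by simp
  have "(\<integral>\<^sup>+s. ennreal (exp (- s * x\<^sup>2 / 2)) \<partial>gauss_mixing \<beta>) =
      (\<integral>\<^sup>+s. ennreal (exp (- (x\<^sup>2 / 2 * s powr 1))) \<partial>gauss_mixing \<beta>)"
    by (intro nn_integral_cong_AE eventually_mono[OF AE_gauss_mixing_pos]) (auto simp: mult_ac)
  also have "\<dots> = ennreal (2 powr (\<beta> / 2) * (x\<^sup>2 / 2) powr (\<beta> / 2))"
    using nn_integral_gauss_mixing_exp[OF assms(1) _ x2, of 1] G by simp
  also have "2 powr (\<beta> / 2) * (x\<^sup>2 / 2) powr (\<beta> / 2) = (x\<^sup>2) powr (\<beta> / 2)"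
    by (simp add: powr_divide)
  also have "\<dots> = \<bar>x\<bar> powr \<beta>"
  proof -
    have "x\<^sup>2 = \<bar>x\<bar> powr 2" by (simp add: powr_numeral assms)
    then show ?thesis by (simp only: powr_powr) simp
  qed
  finally show ?thesis .
qed

text \<open>
  At \<open>x = 0\<close> all kernels equal \<open>1\<close> and the mixture is the total mass. It is infinite, since it dominates
  the unbounded function \<open>\<bar>x\<bar> powr \<beta>\<close>. Therefore a variable whose mixture has finite expectation is
  almost surely nonzero, and the convention \<open>0 powr \<beta> = 0\<close> does not affect its moments.
\<close>

lemma gauss_mixing_infinite:
  assumes "\<beta> < 0"
  shows "emeasure (gauss_mixing \<beta>) UNIV = \<infinity>"
proof (rule ccontr)
  assume "emeasure (gauss_mixing \<beta>) UNIV \<noteq> \<infinity>"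
  then obtain r where r: "emeasure (gauss_mixing \<beta>) UNIV = ennreal r" "r \<ge> 0"
    by (metis ennreal_cases infinity_ennreal_def)
  have le: "\<bar>x\<bar> powr \<beta> \<le> r" if "x \<noteq> 0" for x
  proof -
    have "ennreal (\<bar>x\<bar> powr \<beta>) = (\<integral>\<^sup>+s. ennreal (exp (- s * x\<^sup>2 / 2)) \<partial>gauss_mixing \<beta>)"
      using abs_powr_eq_gauss_mixture[OF assms that] by simp
    also have "\<dots> \<le> (\<integral>\<^sup>+s. 1 \<partial>gauss_mixing \<beta>)"
      by (intro nn_integral_mono_AE eventually_mono[OF AE_gauss_mixing_pos])
         (auto simp flip: ennreal_1 intro!: ennreal_leI)
    also have "\<dots> = ennreal r" using r sets_eq_imp_space_eq[OF sets_gauss_mixing[of \<beta>]] by simp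
    finally show ?thesis using r by simp
  qed
  \<comment> \<open>chosen so that \<open>x powr \<beta>\<close> exceeds the supposed total mass\<close>
  define x where "x = (r + 1) powr (1 / \<beta>)"
  have "x > 0" "x powr \<beta> = r + 1" using assms r by (auto simp: x_def powr_powr)
  with le[of x] show False by simp
qed

text \<open>
  The absolute moment of order \<open>\<beta>\<close> of a symmetric \<open>\<alpha>\<close>-stable variable with characteristic function
  \<open>exp (- \<kappa> \<bar>y\<bar> powr \<alpha>)\<close>.
\<close>

definition stable_moment :: "real \<Rightarrow> real \<Rightarrow> real \<Rightarrow> real" where
  "stable_moment \<alpha> \<beta> \<kappa> =
     2 powr \<beta> * Gamma ((1 + \<beta>) / 2) * Gamma (1 - \<beta> / \<alpha>) / (sqrt pi * Gamma (1 - \<beta> / 2)) * \<kappa> powr (\<beta> / \<alpha>)"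

lemma stable_moment_pos: "-1 < \<beta> \<Longrightarrow> \<beta> < 0 \<Longrightarrow> 0 < \<alpha> \<Longrightarrow> 0 < \<kappa> \<Longrightarrow> stable_moment \<alpha> \<beta> \<kappa> > 0"
  unfolding stable_moment_def
  by (intro mult_pos_pos divide_pos_pos Gamma_real_pos) (auto intro!: add_pos_nonneg simp: divide_neg_pos less_imp_le diff_conv_add_uminus simp del: add_uminus_conv_diff)

text \<open>
  Exchanging the integrals leaves, for fixed \<open>x\<close>, a Gamma integral in \<open>s\<close> with exponent \<open>\<alpha> / 2\<close>, whose value is
  proportional to \<open>\<bar>x\<bar> powr \<beta>\<close>; what remains is a moment of the normal distribution.
\<close>

lemma gauss_mixture_stable_char:
  assumes "-1 < \<beta>" "\<beta> < 0" "0 < \<alpha>" "0 < \<kappa>"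
  shows "(\<integral>\<^sup>+s. (\<integral>\<^sup>+x. ennreal (exp (- (\<kappa> * \<bar>sqrt s * x\<bar> powr \<alpha>))) \<partial>std_normal_distribution) \<partial>gauss_mixing \<beta>)
    = ennreal (stable_moment \<alpha> \<beta> \<kappa>)"
proof -
  interpret N: prob_space std_normal_distribution by (rule prob_space_normal_density) simp
  interpret G: sigma_finite_measure "gauss_mixing \<beta>" by (rule sigma_finite_gauss_mixing)
  interpret NG: pair_sigma_finite std_normal_distribution "gauss_mixing \<beta>" ..
  define c where "c = 2 powr (\<beta> / 2) / Gamma (- \<beta> / 2) * (Gamma (- \<beta> / \<alpha>) * \<kappa> powr (\<beta> / \<alpha>) / (\<alpha> / 2))"
  have G: "Gamma (- \<beta> / 2) > 0" "Gamma (- \<beta> / \<alpha>) > 0" "Gamma ((1 + \<beta>) / 2) > 0"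
    using assms by (auto intro!: Gamma_real_pos divide_neg_pos)
  have c0: "c \<ge> 0" unfolding c_def using assms G by (intro mult_nonneg_nonneg divide_nonneg_nonneg) auto
  have "(\<integral>\<^sup>+s. (\<integral>\<^sup>+x. ennreal (exp (- (\<kappa> * \<bar>sqrt s * x\<bar> powr \<alpha>))) \<partial>std_normal_distribution) \<partial>gauss_mixing \<beta>)
    = (\<integral>\<^sup>+x. (\<integral>\<^sup>+s. ennreal (exp (- (\<kappa> * \<bar>sqrt s * x\<bar> powr \<alpha>))) \<partial>gauss_mixing \<beta>) \<partial>std_normal_distribution)"
    by (rule NG.Fubini') measurable
  also have "\<dots> = (\<integral>\<^sup>+x. ennreal c * ennreal (\<bar>x\<bar> powr \<beta>) \<partial>std_normal_distribution)"
  proof (rule nn_integral_cong_AE)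
    have ae: "AE x in std_normal_distribution. x \<noteq> 0"
      by (subst AE_density) (auto intro!: AE_I[of _ _ "{0}"])
    have *: "(\<integral>\<^sup>+s. ennreal (exp (- (\<kappa> * \<bar>sqrt s * x\<bar> powr \<alpha>))) \<partial>gauss_mixing \<beta>) = ennreal c * ennreal (\<bar>x\<bar> powr \<beta>)"
      if "x \<noteq> 0" for x
    proof -
      have "(\<integral>\<^sup>+s. ennreal (exp (- (\<kappa> * \<bar>sqrt s * x\<bar> powr \<alpha>))) \<partial>gauss_mixing \<beta>)
        = (\<integral>\<^sup>+s. ennreal (exp (- ((\<kappa> * \<bar>x\<bar> powr \<alpha>) * s powr (\<alpha> / 2)))) \<partial>gauss_mixing \<beta>)"
        using AE_gauss_mixing_pos
      proof (intro nn_integral_cong_AE, eventually_elim)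
        case (elim s)
        then have "\<bar>sqrt s * x\<bar> powr \<alpha> = \<bar>x\<bar> powr \<alpha> * s powr (\<alpha> / 2)"
          by (simp add: abs_mult powr_mult powr_half_sqrt[symmetric] powr_powr)
        then show ?case by (simp add: mult_ac)
      qed
      also have "\<dots> = ennreal (2 powr (\<beta> / 2) / Gamma (- \<beta> / 2) * (Gamma (- \<beta> / \<alpha>) * (\<kappa> * \<bar>x\<bar> powr \<alpha>) powr (\<beta> / \<alpha>) / (\<alpha> / 2)))"
        using nn_integral_gauss_mixing_exp[of \<beta> "\<alpha> / 2" "\<kappa> * \<bar>x\<bar> powr \<alpha>"] assms that by simp
      also have "(\<kappa> * \<bar>x\<bar> powr \<alpha>) powr (\<beta> / \<alpha>) = \<kappa> powr (\<beta> / \<alpha>) * \<bar>x\<bar> powr \<beta>"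
        using assms by (simp add: powr_mult powr_powr)
      finally show ?thesis by (simp add: c_def ennreal_mult'[symmetric] c0[unfolded c_def] mult_ac)
    qed
    show "AE x in std_normal_distribution. (\<integral>\<^sup>+s. ennreal (exp (- (\<kappa> * \<bar>sqrt s * x\<bar> powr \<alpha>))) \<partial>gauss_mixing \<beta>) = ennreal c * ennreal (\<bar>x\<bar> powr \<beta>)"
      using ae by eventually_elim (rule *)
  qed
  also have "\<dots> = ennreal c * ennreal (2 powr (\<beta> / 2) * Gamma ((1 + \<beta>) / 2) / sqrt pi)"
    using assms by (subst nn_integral_cmult) (auto simp: nn_integral_std_normal_powr)
  also have "\<dots> = ennreal (c * (2 powr (\<beta> / 2) * Gamma ((1 + \<beta>) / 2) / sqrt pi))"
    using c0 by (rule ennreal_mult'[symmetric])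
  also have "c * (2 powr (\<beta> / 2) * Gamma ((1 + \<beta>) / 2) / sqrt pi) = stable_moment \<alpha> \<beta> \<kappa>"
  proof -
    have nn: "- \<beta> / \<alpha> \<notin> \<int>\<^sub>\<le>\<^sub>0" "- \<beta> / 2 \<notin> \<int>\<^sub>\<le>\<^sub>0"
      using assms by (auto dest!: nonpos_Ints_nonpos simp: zero_le_divide_iff divide_le_0_iff)
    have 1: "Gamma (1 - \<beta> / \<alpha>) = (- \<beta> / \<alpha>) * Gamma (- \<beta> / \<alpha>)"
      using Gamma_plus1[OF nn(1)] by (simp add: add.commute)
    have 2: "Gamma (1 - \<beta> / 2) = (- \<beta> / 2) * Gamma (- \<beta> / 2)"
      using Gamma_plus1[OF nn(2)] by (simp add: add.commute)
    have 3: "(2::real) powr \<beta> = 2 powr (\<beta> / 2) * 2 powr (\<beta> / 2)" by (simp flip: powr_add)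
    show ?thesis unfolding stable_moment_def c_def 1 2 3 using assms G by (simp add: field_simps)
  qed
  finally show ?thesis .
qed

section \<open>Negative moments and characteristic functions\<close>

text \<open>
  The weight \<open>exp (- s u\<^sup>2 / 2)\<close> is the characteristic function of the standard normal distribution
  at \<open>sqrt s * u\<close>. The free factor \<open>Z\<close> allows the lemma to be applied to two weights in turn.
\<close>

lemma (in prob_space) expectation_gaussian_weight:
  fixes U :: "'a \<Rightarrow> real" and Z :: "'a \<Rightarrow> complex"
  assumes [measurable]: "U \<in> borel_measurable M" "Z \<in> borel_measurable M"
    and Z: "\<And>\<omega>. norm (Z \<omega>) \<le> 1" and s: "s \<ge> 0"
  shows "(CLINT \<omega>|M. complex_of_real (exp (- s * (U \<omega>)\<^sup>2 / 2)) * Z \<omega>)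
    = (CLINT x|std_normal_distribution. (CLINT \<omega>|M. iexp (sqrt s * x * U \<omega>) * Z \<omega>))"
proof -
  interpret N: prob_space std_normal_distribution by (rule prob_space_normal_density) simp
  interpret NM: pair_prob_space M std_normal_distribution ..
  have ex: "complex_of_real (exp (- s * (U \<omega>)\<^sup>2 / 2)) * Z \<omega>
      = (CLINT x|std_normal_distribution. iexp (sqrt s * x * U \<omega>) * Z \<omega>)" for \<omega>
  proof -
    have "complex_of_real (exp (- s * (U \<omega>)\<^sup>2 / 2)) = char std_normal_distribution (sqrt s * U \<omega>)"
      using s by (simp add: char_std_normal_distribution power_mult_distrib)
    also have "\<dots> = (CLINT x|std_normal_distribution. iexp (sqrt s * x * U \<omega>))"
      by (simp add: char_def mult_ac)
    finally show ?thesis by simp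
  qed
  have int: "integrable (M \<Otimes>\<^sub>M std_normal_distribution) (\<lambda>(\<omega>, x). iexp (sqrt s * x * U \<omega>) * Z \<omega>)"
    by (rule NM.P.integrable_const_bound[where B=1]) (auto simp: norm_mult Z)
  show ?thesis
    unfolding ex by (rule NM.Fubini_integral[symmetric, OF int])
qed

lemma ennreal_integral_std_normal_exp:
  fixes h :: "real \<Rightarrow> real"
  assumes [measurable]: "h \<in> borel_measurable borel" and "\<And>x. h x \<ge> 0"
  shows "ennreal (LINT x|std_normal_distribution. exp (- h x))
    = (\<integral>\<^sup>+x. ennreal (exp (- h x)) \<partial>std_normal_distribution)"
proof -
  interpret N: prob_space std_normal_distribution by (rule prob_space_normal_density) simp
  have "integrable std_normal_distribution (\<lambda>x. exp (- h x))"
    using assms(2) by (intro N.integrable_const_bound[where B=1]) auto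
  then show ?thesis by (simp add: nn_integral_eq_integral)
qed

text \<open>
  Averaging the Gaussian weight over \<open>U\<close> gives the Gaussian average of the characteristic function of
  \<open>U\<close>, and integrating over \<open>s\<close> is the preceding computation. Finiteness of the result
  excludes \<open>U = 0\<close> on a set of positive probability.
\<close>

lemma (in prob_space) stable_abs_moment:
  fixes U :: "'a \<Rightarrow> real"
  assumes [measurable]: "U \<in> borel_measurable M"
    and \<beta>: "-1 < \<beta>" "\<beta> < 0" and "0 < \<alpha>" "0 < \<kappa>"
    and cf: "\<And>y. (CLINT \<omega>|M. iexp (y * U \<omega>)) = complex_of_real (exp (- (\<kappa> * \<bar>y\<bar> powr \<alpha>)))"
  shows "(\<integral>\<^sup>+\<omega>. ennreal (\<bar>U \<omega>\<bar> powr \<beta>) \<partial>M) = ennreal (stable_moment \<alpha> \<beta> \<kappa>)"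
proof -
  interpret N: prob_space std_normal_distribution by (rule prob_space_normal_density) simp
  interpret G: sigma_finite_measure "gauss_mixing \<beta>" by (rule sigma_finite_gauss_mixing)
  interpret MG: pair_sigma_finite M "gauss_mixing \<beta>" ..
  define I where "I = (\<lambda>\<omega>. \<integral>\<^sup>+s. ennreal (exp (- s * (U \<omega>)\<^sup>2 / 2)) \<partial>gauss_mixing \<beta>)"
  have [measurable]: "I \<in> borel_measurable M" unfolding I_def by measurable
  have laplace: "(\<integral>\<^sup>+\<omega>. ennreal (exp (- s * (U \<omega>)\<^sup>2 / 2)) \<partial>M)
      = (\<integral>\<^sup>+x. ennreal (exp (- (\<kappa> * \<bar>sqrt s * x\<bar> powr \<alpha>))) \<partial>std_normal_distribution)"
    if "s > 0" for s
  proof -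
    have "complex_of_real (LINT \<omega>|M. exp (- s * (U \<omega>)\<^sup>2 / 2))
        = (CLINT \<omega>|M. complex_of_real (exp (- s * (U \<omega>)\<^sup>2 / 2)) * 1)"
      by (simp only: mult_1_right integral_complex_of_real)
    also have "\<dots> = (CLINT x|std_normal_distribution. (CLINT \<omega>|M. iexp (sqrt s * x * U \<omega>) * 1))"
      using that by (intro expectation_gaussian_weight) auto
    also have "\<dots> = (CLINT x|std_normal_distribution. complex_of_real (exp (- (\<kappa> * \<bar>sqrt s * x\<bar> powr \<alpha>))))"
      by (simp only: cf mult_1_right)
    also have "\<dots> = complex_of_real (LINT x|std_normal_distribution. exp (- (\<kappa> * \<bar>sqrt s * x\<bar> powr \<alpha>)))"
      by (rule integral_complex_of_real)
    finally have eq: "(LINT \<omega>|M. exp (- s * (U \<omega>)\<^sup>2 / 2))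
        = (LINT x|std_normal_distribution. exp (- (\<kappa> * \<bar>sqrt s * x\<bar> powr \<alpha>)))"
      by (simp only: of_real_eq_iff)
    have "integrable M (\<lambda>\<omega>. exp (- s * (U \<omega>)\<^sup>2 / 2))"
      using that by (intro integrable_const_bound[where B=1]) auto
    then have "(\<integral>\<^sup>+\<omega>. ennreal (exp (- s * (U \<omega>)\<^sup>2 / 2)) \<partial>M) = ennreal (LINT \<omega>|M. exp (- s * (U \<omega>)\<^sup>2 / 2))"
      by (intro nn_integral_eq_integral) auto
    also have "\<dots> = (\<integral>\<^sup>+x. ennreal (exp (- (\<kappa> * \<bar>sqrt s * x\<bar> powr \<alpha>))) \<partial>std_normal_distribution)"
      unfolding eq using assms by (intro ennreal_integral_std_normal_exp) auto
    finally show ?thesis .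
  qed
  have "(\<integral>\<^sup>+\<omega>. I \<omega> \<partial>M) = (\<integral>\<^sup>+s. (\<integral>\<^sup>+\<omega>. ennreal (exp (- s * (U \<omega>)\<^sup>2 / 2)) \<partial>M) \<partial>gauss_mixing \<beta>)"
    unfolding I_def by (rule MG.Fubini'[symmetric]) measurable
  also have "\<dots> = (\<integral>\<^sup>+s. (\<integral>\<^sup>+x. ennreal (exp (- (\<kappa> * \<bar>sqrt s * x\<bar> powr \<alpha>))) \<partial>std_normal_distribution) \<partial>gauss_mixing \<beta>)"
    by (intro nn_integral_cong_AE eventually_mono[OF AE_gauss_mixing_pos]) (rule laplace)
  also have "\<dots> = ennreal (stable_moment \<alpha> \<beta> \<kappa>)"
    using assms by (intro gauss_mixture_stable_char) auto
  finally have I: "(\<integral>\<^sup>+\<omega>. I \<omega> \<partial>M) = ennreal (stable_moment \<alpha> \<beta> \<kappa>)" .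
  have "AE \<omega> in M. I \<omega> \<noteq> \<infinity>" by (rule nn_integral_noteq_infinite) (auto simp: I)
  then have "AE \<omega> in M. ennreal (\<bar>U \<omega>\<bar> powr \<beta>) = I \<omega>"
  proof eventually_elim
    case (elim \<omega>)
    have "U \<omega> \<noteq> 0"
    proof
      assume "U \<omega> = 0"
      then have "I \<omega> = \<infinity>"
        using gauss_mixing_infinite[OF \<beta>(2)] sets_eq_imp_space_eq[OF sets_gauss_mixing[of \<beta>]] by (simp add: I_def)
      with elim show False by simp
    qed
    then show ?case using abs_powr_eq_gauss_mixture[OF \<beta>(2)] by (simp add: I_def)
  qed
  then show ?thesis unfolding I[symmetric] by (rule nn_integral_cong_AE)
qed

text \<open>
  The Gaussian weights of both variables are averaged at once. The bound on the joint
  characteristic function factorises, and each factor contributes the moment of a single stable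
  variable. An upper bound suffices here, so zeros of \<open>U\<close> and \<open>V\<close> do no harm.
\<close>

lemma (in prob_space) stable_abs_moment_product_le:
  fixes U V :: "'a \<Rightarrow> real" and \<Phi> :: "real \<Rightarrow> real \<Rightarrow> real"
  assumes [measurable]: "U \<in> borel_measurable M" "V \<in> borel_measurable M"
    and \<beta>: "-1 < \<beta>" "\<beta> < 0" and "0 < \<alpha>" "0 < \<kappa>"
    and cf: "\<And>y z. (CLINT \<omega>|M. iexp (y * U \<omega> + z * V \<omega>)) = complex_of_real (\<Phi> y z)"
    and le: "\<And>y z. \<Phi> y z \<le> exp (- (\<kappa> * (\<bar>y\<bar> powr \<alpha> + \<bar>z\<bar> powr \<alpha>)))"
  shows "(\<integral>\<^sup>+\<omega>. ennreal (\<bar>U \<omega>\<bar> powr \<beta> * \<bar>V \<omega>\<bar> powr \<beta>) \<partial>M) \<le> ennreal ((stable_moment \<alpha> \<beta> \<kappa>)\<^sup>2)"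
proof -
  interpret N: prob_space std_normal_distribution by (rule prob_space_normal_density) simp
  interpret G: sigma_finite_measure "gauss_mixing \<beta>" by (rule sigma_finite_gauss_mixing)
  interpret MG: pair_sigma_finite M "gauss_mixing \<beta>" ..
  interpret NN: pair_prob_space std_normal_distribution std_normal_distribution ..
  define e where "e = (\<lambda>s u::real. exp (- s * u\<^sup>2 / 2))"
  have e_meas [measurable]: "case_prod e \<in> borel_measurable (borel \<Otimes>\<^sub>M borel)" unfolding e_def by measurable
  have e1: "e s u \<le> 1" "e s u > 0" if "s > 0" for s u using that by (auto simp: e_def)
  define g where "g = (\<lambda>s. LINT x|std_normal_distribution. exp (- (\<kappa> * \<bar>sqrt s * x\<bar> powr \<alpha>)))"
  have \<Phi>_eq: "\<Phi> = (\<lambda>y z. Re (CLINT \<omega>|M. iexp (y * U \<omega> + z * V \<omega>)))" using cf by simp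
  have [measurable]: "case_prod \<Phi> \<in> borel_measurable (borel \<Otimes>\<^sub>M borel)"
    unfolding \<Phi>_eq by measurable
  have \<Phi>1: "\<bar>\<Phi> y z\<bar> \<le> 1" for y z
  proof -
    have "cmod (CLINT \<omega>|M. iexp (y * U \<omega> + z * V \<omega>)) \<le> (LINT \<omega>|M. cmod (iexp (y * U \<omega> + z * V \<omega>)))"
      by (rule integral_norm_bound)
    also have "\<dots> = 1" by (simp add: prob_space)
    finally show ?thesis by (simp only: cf norm_of_real)
  qed
  have laplace: "(\<integral>\<^sup>+\<omega>. ennreal (e s (U \<omega>) * e t (V \<omega>)) \<partial>M) \<le> ennreal (g s) * ennreal (g t)"
    if st: "s > 0" "t > 0" for s t
  proof -
    have "complex_of_real (LINT \<omega>|M. e s (U \<omega>) * e t (V \<omega>))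
        = (CLINT \<omega>|M. complex_of_real (e s (U \<omega>)) * complex_of_real (e t (V \<omega>)))"
      by (simp only: of_real_mult[symmetric] integral_complex_of_real)
    also have "\<dots> = (CLINT x|std_normal_distribution.
        (CLINT \<omega>|M. iexp (sqrt s * x * U \<omega>) * complex_of_real (e t (V \<omega>))))"
      unfolding e_def using st by (intro expectation_gaussian_weight) auto
    also have "\<dots> = (CLINT x|std_normal_distribution. (CLINT y|std_normal_distribution.
        complex_of_real (\<Phi> (sqrt s * x) (sqrt t * y))))"
    proof (rule Bochner_Integration.integral_cong[OF refl])
      fix x
      have "(CLINT \<omega>|M. iexp (sqrt s * x * U \<omega>) * complex_of_real (e t (V \<omega>)))
        = (CLINT \<omega>|M. complex_of_real (exp (- t * (V \<omega>)\<^sup>2 / 2)) * iexp (sqrt s * x * U \<omega>))"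
        by (simp add: e_def mult.commute)
      also have "\<dots> = (CLINT y|std_normal_distribution. (CLINT \<omega>|M. iexp (sqrt t * y * V \<omega>) * iexp (sqrt s * x * U \<omega>)))"
        using st by (intro expectation_gaussian_weight) auto
      also have "\<dots> = (CLINT y|std_normal_distribution. complex_of_real (\<Phi> (sqrt s * x) (sqrt t * y)))"
        by (intro Bochner_Integration.integral_cong refl) (simp flip: cf add: exp_add[symmetric] algebra_simps)
      finally show "(CLINT \<omega>|M. iexp (sqrt s * x * U \<omega>) * complex_of_real (e t (V \<omega>)))
        = (CLINT y|std_normal_distribution. complex_of_real (\<Phi> (sqrt s * x) (sqrt t * y)))" .
    qed
    also have "\<dots> = complex_of_real (LINT x|std_normal_distribution. (LINT y|std_normal_distribution. \<Phi> (sqrt s * x) (sqrt t * y)))"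
      by (simp only: integral_complex_of_real)
    finally have "(LINT \<omega>|M. e s (U \<omega>) * e t (V \<omega>))
        = (LINT x|std_normal_distribution. (LINT y|std_normal_distribution. \<Phi> (sqrt s * x) (sqrt t * y)))"
      by (simp only: of_real_eq_iff)
    also have "\<dots> \<le> (LINT x|std_normal_distribution. (LINT y|std_normal_distribution.
        exp (- (\<kappa> * \<bar>sqrt s * x\<bar> powr \<alpha>)) * exp (- (\<kappa> * \<bar>sqrt t * y\<bar> powr \<alpha>))))"
    proof (rule integral_mono)
      have i1: "integrable std_normal_distribution (\<lambda>y. \<Phi> (sqrt s * x) (sqrt t * y))" for x
        by (rule N.integrable_const_bound[where B=1]) (use \<Phi>1 in auto)
      have i2: "integrable std_normal_distribution (\<lambda>y. exp (- (\<kappa> * \<bar>sqrt s * x\<bar> powr \<alpha>)) * exp (- (\<kappa> * \<bar>sqrt t * y\<bar> powr \<alpha>)))" for x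
        using assms by (intro N.integrable_const_bound[where B=1]) (auto simp: abs_mult intro!: mult_le_one)
      have "integrable (std_normal_distribution \<Otimes>\<^sub>M std_normal_distribution) (\<lambda>(x, y). \<Phi> (sqrt s * x) (sqrt t * y))"
        by (rule NN.P.integrable_const_bound[where B=1]) (use \<Phi>1 in auto)
      then show "integrable std_normal_distribution (\<lambda>x. LINT y|std_normal_distribution. \<Phi> (sqrt s * x) (sqrt t * y))"
        by (rule NN.integrable_fst)
      have "integrable (std_normal_distribution \<Otimes>\<^sub>M std_normal_distribution)
         (\<lambda>(x, y). exp (- (\<kappa> * \<bar>sqrt s * x\<bar> powr \<alpha>)) * exp (- (\<kappa> * \<bar>sqrt t * y\<bar> powr \<alpha>)))"
        using assms by (intro NN.P.integrable_const_bound[where B=1]) (auto simp: abs_mult case_prod_beta' intro!: AE_I2 mult_le_one)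
      then show "integrable std_normal_distribution (\<lambda>x. LINT y|std_normal_distribution.
          exp (- (\<kappa> * \<bar>sqrt s * x\<bar> powr \<alpha>)) * exp (- (\<kappa> * \<bar>sqrt t * y\<bar> powr \<alpha>)))"
        by (rule NN.integrable_fst)
      show "(LINT y|std_normal_distribution. \<Phi> (sqrt s * x) (sqrt t * y)) \<le> (LINT y|std_normal_distribution.
          exp (- (\<kappa> * \<bar>sqrt s * x\<bar> powr \<alpha>)) * exp (- (\<kappa> * \<bar>sqrt t * y\<bar> powr \<alpha>)))" for x
        using i1 i2 by (rule integral_mono) (rule order_trans[OF le], simp add: exp_add[symmetric] distrib_left)
    qed
    also have "\<dots> = g s * g t" by (simp add: g_def)
    finally have "ennreal (LINT \<omega>|M. e s (U \<omega>) * e t (V \<omega>)) \<le> ennreal (g s) * ennreal (g t)"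
      by (subst ennreal_mult[symmetric]) (auto simp: g_def intro!: ennreal_leI Bochner_Integration.integral_nonneg)
    moreover have "integrable M (\<lambda>\<omega>. e s (U \<omega>) * e t (V \<omega>))"
      using e1[OF st(1)] e1[OF st(2)] by (intro integrable_const_bound[where B=1]) (auto simp: abs_mult less_imp_le intro!: mult_le_one)
    ultimately show ?thesis
      using e1[OF st(1)] e1[OF st(2)] by (subst nn_integral_eq_integral) (auto simp: less_imp_le)
  qed
  have J: "(\<integral>\<^sup>+s. ennreal (g s) \<partial>gauss_mixing \<beta>) = ennreal (stable_moment \<alpha> \<beta> \<kappa>)"
    unfolding g_def using assms
    by (subst ennreal_integral_std_normal_exp) (auto intro!: gauss_mixture_stable_char)
  have pt: "ennreal (\<bar>u\<bar> powr \<beta>) \<le> (\<integral>\<^sup>+s. ennreal (e s u) \<partial>gauss_mixing \<beta>)" for u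
    using abs_powr_eq_gauss_mixture[OF \<beta>(2), of u] by (cases "u = 0") (auto simp: e_def)
  have g_meas [measurable]: "g \<in> borel_measurable borel" unfolding g_def by measurable
  have "(\<integral>\<^sup>+\<omega>. ennreal (\<bar>U \<omega>\<bar> powr \<beta> * \<bar>V \<omega>\<bar> powr \<beta>) \<partial>M)
    \<le> (\<integral>\<^sup>+\<omega>. (\<integral>\<^sup>+s. ennreal (e s (U \<omega>)) \<partial>gauss_mixing \<beta>) * (\<integral>\<^sup>+t. ennreal (e t (V \<omega>)) \<partial>gauss_mixing \<beta>) \<partial>M)"
    by (intro nn_integral_mono) (auto simp: ennreal_mult intro!: mult_mono pt)
  also have "\<dots> = (\<integral>\<^sup>+\<omega>. (\<integral>\<^sup>+s. (\<integral>\<^sup>+t. ennreal (e s (U \<omega>)) * ennreal (e t (V \<omega>)) \<partial>gauss_mixing \<beta>) \<partial>gauss_mixing \<beta>) \<partial>M)"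
    by (simp add: nn_integral_cmult nn_integral_multc)
  also have "\<dots> = (\<integral>\<^sup>+s. (\<integral>\<^sup>+\<omega>. (\<integral>\<^sup>+t. ennreal (e s (U \<omega>)) * ennreal (e t (V \<omega>)) \<partial>gauss_mixing \<beta>) \<partial>M) \<partial>gauss_mixing \<beta>)"
    by (rule MG.Fubini'[symmetric]) measurable
  also have "\<dots> = (\<integral>\<^sup>+s. (\<integral>\<^sup>+t. (\<integral>\<^sup>+\<omega>. ennreal (e s (U \<omega>)) * ennreal (e t (V \<omega>)) \<partial>M) \<partial>gauss_mixing \<beta>) \<partial>gauss_mixing \<beta>)"
    by (intro nn_integral_cong MG.Fubini'[symmetric]) measurable
  also have "\<dots> \<le> (\<integral>\<^sup>+s. (\<integral>\<^sup>+t. ennreal (g s) * ennreal (g t) \<partial>gauss_mixing \<beta>) \<partial>gauss_mixing \<beta>)"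
  proof (intro nn_integral_mono_AE eventually_mono[OF AE_gauss_mixing_pos])
    fix s t :: real assume st: "0 < s" "0 < t"
    then show "(\<integral>\<^sup>+\<omega>. ennreal (e s (U \<omega>)) * ennreal (e t (V \<omega>)) \<partial>M) \<le> ennreal (g s) * ennreal (g t)"
      using laplace[OF st] e1[OF st(1)] e1[OF st(2)] by (simp add: ennreal_mult less_imp_le)
  qed
  also have "\<dots> = ennreal (stable_moment \<alpha> \<beta> \<kappa>) * ennreal (stable_moment \<alpha> \<beta> \<kappa>)"
    by (simp add: nn_integral_cmult nn_integral_multc J)
  also have "\<dots> = ennreal ((stable_moment \<alpha> \<beta> \<kappa>)\<^sup>2)"
    using stable_moment_pos[of \<beta> \<alpha> \<kappa>] assms by (simp add: ennreal_mult power2_eq_square less_imp_le)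
  finally show ?thesis .
qed

section \<open>Linear combinations of values of a stable random measure\<close>

text \<open>
  Markov's inequality for the bounded function \<open>1 - exp (- Z\<^sup>2 / 2)\<close>, whose expectation is
  a Gaussian average of \<open>1\<close> minus the characteristic function. It serves in place of a continuity
  theorem to show that variables whose scale tends to \<open>0\<close> vanish in probability.
\<close>

lemma (in prob_space) prob_abs_gt_le_cf:
  fixes Z :: "'a \<Rightarrow> real"
  assumes [measurable]: "Z \<in> borel_measurable M" and "\<delta> > 0" "\<kappa> \<ge> 0"
    and cf: "\<And>y. (CLINT \<omega>|M. iexp (y * Z \<omega>)) = complex_of_real (exp (- (\<kappa> * \<bar>y\<bar> powr \<alpha>)))"
  shows "prob {\<omega> \<in> space M. \<bar>Z \<omega>\<bar> > \<delta>} * (1 - exp (- (\<delta>\<^sup>2 / 2)))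
    \<le> 1 - (LINT x|std_normal_distribution. exp (- (\<kappa> * \<bar>x\<bar> powr \<alpha>)))"
proof -
  have "complex_of_real (LINT \<omega>|M. exp (- 1 * (Z \<omega>)\<^sup>2 / 2))
      = (CLINT \<omega>|M. complex_of_real (exp (- 1 * (Z \<omega>)\<^sup>2 / 2)) * 1)"
    by (simp only: mult_1_right integral_complex_of_real)
  also have "\<dots> = (CLINT x|std_normal_distribution. (CLINT \<omega>|M. iexp (sqrt 1 * x * Z \<omega>) * 1))"
    by (intro expectation_gaussian_weight) auto
  also have "\<dots> = (CLINT x|std_normal_distribution. complex_of_real (exp (- (\<kappa> * \<bar>sqrt 1 * x\<bar> powr \<alpha>))))"
    by (simp only: cf mult_1_right)
  also have "\<dots> = complex_of_real (LINT x|std_normal_distribution. exp (- (\<kappa> * \<bar>sqrt 1 * x\<bar> powr \<alpha>)))"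
    by (rule integral_complex_of_real)
  finally have eq: "(LINT \<omega>|M. exp (- ((Z \<omega>)\<^sup>2 / 2))) = (LINT x|std_normal_distribution. exp (- (\<kappa> * \<bar>x\<bar> powr \<alpha>)))"
    by (simp only: of_real_eq_iff) simp
  have int: "integrable M (\<lambda>\<omega>. exp (- ((Z \<omega>)\<^sup>2 / 2)))"
    by (intro integrable_const_bound[where B=1]) auto
  have "prob {\<omega> \<in> space M. \<bar>Z \<omega>\<bar> > \<delta>} * (1 - exp (- (\<delta>\<^sup>2 / 2)))
     = (LINT \<omega>|M. indicator {\<omega> \<in> space M. \<bar>Z \<omega>\<bar> > \<delta>} \<omega> * (1 - exp (- (\<delta>\<^sup>2 / 2))))"
    by simp
  also have "\<dots> \<le> (LINT \<omega>|M. 1 - exp (- ((Z \<omega>)\<^sup>2 / 2)))"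
  proof (rule integral_mono)
    fix \<omega> assume "\<omega> \<in> space M"
    have "\<delta>\<^sup>2 \<le> (Z \<omega>)\<^sup>2" if "\<bar>Z \<omega>\<bar> > \<delta>"
      using that \<open>\<delta> > 0\<close> by (metis abs_le_square_iff abs_of_pos less_imp_le)
    then show "indicator {\<omega> \<in> space M. \<bar>Z \<omega>\<bar> > \<delta>} \<omega> * (1 - exp (- (\<delta>\<^sup>2 / 2))) \<le> 1 - exp (- ((Z \<omega>)\<^sup>2 / 2))"
      by (auto simp: indicator_def)
  qed (use int in \<open>auto intro!: integrable_mult_left integrable_real_indicator simp: less_top[symmetric]\<close>)
  also have "\<dots> = 1 - (LINT x|std_normal_distribution. exp (- (\<kappa> * \<bar>x\<bar> powr \<alpha>)))"
    using int by (subst Bochner_Integration.integral_diff) (auto simp: eq prob_space)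
  finally show ?thesis .
qed

lemma integral_std_normal_exp_tendsto_1:
  assumes "\<kappa> \<longlonglongrightarrow> 0" "\<And>j. \<kappa> j \<ge> (0::real)"
  shows "(\<lambda>j. LINT x|std_normal_distribution. exp (- (\<kappa> j * \<bar>x\<bar> powr \<alpha>))) \<longlonglongrightarrow> 1"
proof -
  interpret N: prob_space std_normal_distribution by (rule prob_space_normal_density) simp
  have "(\<lambda>j. LINT x|std_normal_distribution. exp (- (\<kappa> j * \<bar>x\<bar> powr \<alpha>)))
      \<longlonglongrightarrow> (LINT x|std_normal_distribution. exp (- (0 * \<bar>x\<bar> powr \<alpha>)))"
  proof (rule integral_dominated_convergence[where w="\<lambda>_. 1"])
    show "AE x in std_normal_distribution. (\<lambda>j. exp (- (\<kappa> j * \<bar>x\<bar> powr \<alpha>))) \<longlonglongrightarrow> exp (- (0 * \<bar>x\<bar> powr \<alpha>))"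
      by (intro always_eventually allI tendsto_intros assms(1))
  qed (use assms in auto)
  then show ?thesis using N.prob_space by simp
qed

locale stable_random_measure = prob_space P for P :: "'w measure" +
  fixes m :: "'e measure" and \<alpha> :: real and M :: "'e set \<Rightarrow> 'w \<Rightarrow> real"
  assumes sas: "sas_random_measure P m \<alpha> M" and \<alpha>_pos: "0 < \<alpha>"
begin

lemma M_measurable [measurable (raw)]: "A \<in> finite_measure_sets m \<Longrightarrow> M A \<in> borel_measurable P"
  using sas by (simp add: sas_random_measure_def)

lemma M_countably_additive:
  assumes "range A \<subseteq> finite_measure_sets m" "disjoint_family A" "(\<Union>i. A i) \<in> finite_measure_sets m"
  shows "AE \<omega> in P. (\<lambda>i::nat. M (A i) \<omega>) sums M (\<Union>i. A i) \<omega>"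
  using sas assms by (simp add: sas_random_measure_def)

lemma M_cf:
  assumes "A \<in> finite_measure_sets m"
  shows "char (distr P borel (M A)) \<theta> = complex_of_real (exp (- (\<bar>\<theta>\<bar> powr \<alpha> * measure m A)))"
  using sas assms by (simp add: sas_random_measure_def)

lemma empty_finite_measure_sets [simp]: "{} \<in> finite_measure_sets m"
  by (simp add: finite_measure_sets_def)

lemma Un_finite_measure_sets:
  "A \<in> finite_measure_sets m \<Longrightarrow> B \<in> finite_measure_sets m \<Longrightarrow> A \<union> B \<in> finite_measure_sets m"
  unfolding finite_measure_sets_def
  by (auto intro!: le_less_trans[OF emeasure_subadditive])

lemma M_empty: "AE \<omega> in P. M {} \<omega> = 0"
proof -
  have "AE \<omega> in P. (\<lambda>i::nat. M {} \<omega>) sums M {} \<omega>"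
    using M_countably_additive[of "\<lambda>_. {}"] by (simp add: disjoint_family_on_def)
  then show ?thesis
    by eventually_elim (auto dest!: sums_summable simp: summable_const_iff)
qed

text \<open>
  Countable additivity for the sequence \<open>A, B, {}, {}, \<dots>\<close>.
\<close>

lemma M_Un:
  assumes "A \<in> finite_measure_sets m" "B \<in> finite_measure_sets m" "A \<inter> B = {}"
  shows "AE \<omega> in P. M (A \<union> B) \<omega> = M A \<omega> + M B \<omega>"
proof -
  define C where "C = (\<lambda>i::nat. if i = 0 then A else if i = 1 then B else {})"
  have C: "(\<Union>i. C i) = A \<union> B" by (auto simp: C_def split: if_splits intro: exI[of _ 0] exI[of _ 1])
  have "AE \<omega> in P. (\<lambda>i. M (C i) \<omega>) sums M (\<Union>i. C i) \<omega>"
  proof (rule M_countably_additive)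
    show "range C \<subseteq> finite_measure_sets m" using assms by (auto simp: C_def)
    show "disjoint_family C" using assms by (auto simp: disjoint_family_on_def C_def)
    show "(\<Union>i. C i) \<in> finite_measure_sets m" unfolding C using assms by (intro Un_finite_measure_sets)
  qed
  with M_empty show ?thesis
  proof eventually_elim
    case (elim \<omega>)
    have "(\<lambda>i. M (C i) \<omega>) sums (\<Sum>i<2. M (C i) \<omega>)"
      by (rule sums_finite) (use elim(1) in \<open>auto simp: C_def\<close>)
    also have "(\<Sum>i<2. M (C i) \<omega>) = M A \<omega> + M B \<omega>" by (simp add: C_def numeral_2_eq_2)
    finally show ?case using elim(2) unfolding C by (metis sums_unique2)
  qed
qed

lemma UN_finite_measure_sets:
  "finite I \<Longrightarrow> (\<And>i. i \<in> I \<Longrightarrow> B i \<in> finite_measure_sets m) \<Longrightarrow> (\<Union>i\<in>I. B i) \<in> finite_measure_sets m"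
  by (induction I rule: finite_induct) (auto intro: Un_finite_measure_sets)

lemma M_finite_UN:
  assumes "finite I" "disjoint_family_on B I" "\<And>i. i \<in> I \<Longrightarrow> B i \<in> finite_measure_sets m"
  shows "AE \<omega> in P. M (\<Union>i\<in>I. B i) \<omega> = (\<Sum>i\<in>I. M (B i) \<omega>)"
  using assms
proof (induction I rule: finite_induct)
  case empty
  then show ?case using M_empty by simp
next
  case (insert i I)
  have "AE \<omega> in P. M (\<Union>i\<in>I. B i) \<omega> = (\<Sum>i\<in>I. M (B i) \<omega>)"
    using insert by (intro insert.IH) (auto simp: disjoint_family_on_def)
  moreover have "AE \<omega> in P. M (B i \<union> (\<Union>i\<in>I. B i)) \<omega> = M (B i) \<omega> + M (\<Union>i\<in>I. B i) \<omega>"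
  proof (rule M_Un)
    show "B i \<inter> (\<Union>i\<in>I. B i) = {}"
      using insert.prems(1) insert.hyps by (fastforce simp: disjoint_family_on_def)
  qed (use insert in \<open>auto intro!: UN_finite_measure_sets\<close>)
  ultimately show ?case
    by eventually_elim (use insert.hyps in auto)
qed

lemma cf_disjoint_sum:
  assumes "finite I" "disjoint_family_on B I" "\<And>i. i \<in> I \<Longrightarrow> B i \<in> finite_measure_sets m"
  shows "char (distr P borel (\<lambda>\<omega>. \<Sum>i\<in>I. c i * M (B i) \<omega>)) \<theta>
    = complex_of_real (exp (- (\<bar>\<theta>\<bar> powr \<alpha> * (\<Sum>i\<in>I. \<bar>c i\<bar> powr \<alpha> * measure m (B i)))))"
proof -
  obtain h where h: "bij_betw h {..<card I} I"
    using ex_bij_betw_nat_finite[OF assms(1)] by (auto simp: atLeast0LessThan)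
  have hI: "h j \<in> I" if "j < card I" for j using h that by (auto simp: bij_betw_def)
  have "indep_vars (\<lambda>_. borel) (\<lambda>j. M (B (h j))) {..<card I}"
  proof -
    have "disjoint_family_on (\<lambda>j. B (h j)) {..<card I}"
      unfolding disjoint_family_on_def
    proof (intro ballI impI)
      fix i j assume "i \<in> {..<card I}" "j \<in> {..<card I}" "i \<noteq> j"
      then have "h i \<in> I" "h j \<in> I" "h i \<noteq> h j" using h hI by (auto simp: bij_betw_def inj_on_def)
      then show "B (h i) \<inter> B (h j) = {}" using assms(2) by (auto simp: disjoint_family_on_def)
    qed
    then show ?thesis
      using sas assms(3) hI by (auto simp: sas_random_measure_def)
  qed
  then have ind: "indep_vars (\<lambda>_. borel) (\<lambda>j \<omega>. c (h j) * M (B (h j)) \<omega>) {..<card I}"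
    by (rule indep_vars_compose2[where Y="\<lambda>j x. c (h j) * x"]) auto
  have "(\<lambda>\<omega>. \<Sum>i\<in>I. c i * M (B i) \<omega>) = (\<lambda>\<omega>. \<Sum>j<card I. c (h j) * M (B (h j)) \<omega>)"
    by (intro ext sum.reindex_bij_betw[OF h, symmetric])
  then have "char (distr P borel (\<lambda>\<omega>. \<Sum>i\<in>I. c i * M (B i) \<omega>)) \<theta>
    = (\<Prod>j<card I. char (distr P borel (\<lambda>\<omega>. c (h j) * M (B (h j)) \<omega>)) \<theta>)"
    using char_distr_sum[OF ind] by simp
  also have "\<dots> = (\<Prod>j<card I. complex_of_real (exp (- (\<bar>\<theta>\<bar> powr \<alpha> * (\<bar>c (h j)\<bar> powr \<alpha> * measure m (B (h j)))))))"
  proof (intro prod.cong refl)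
    fix j assume "j \<in> {..<card I}"
    then have F: "B (h j) \<in> finite_measure_sets m" using hI assms(3) by auto
    note [measurable] = M_measurable[OF F]
    have "char (distr P borel (\<lambda>\<omega>. c (h j) * M (B (h j)) \<omega>)) \<theta> = char (distr P borel (M (B (h j)))) (\<theta> * c (h j))"
      by (simp add: char_def integral_distr mult_ac)
    also have "\<dots> = complex_of_real (exp (- (\<bar>\<theta>\<bar> powr \<alpha> * (\<bar>c (h j)\<bar> powr \<alpha> * measure m (B (h j))))))"
      by (simp add: M_cf[OF F] abs_mult powr_mult mult_ac)
    finally show "char (distr P borel (\<lambda>\<omega>. c (h j) * M (B (h j)) \<omega>)) \<theta> = complex_of_real (exp (- (\<bar>\<theta>\<bar> powr \<alpha> * (\<bar>c (h j)\<bar> powr \<alpha> * measure m (B (h j))))))" .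
  qed
  also have "\<dots> = complex_of_real (exp (\<Sum>j<card I. - (\<bar>\<theta>\<bar> powr \<alpha> * (\<bar>c (h j)\<bar> powr \<alpha> * measure m (B (h j))))))"
    by (simp only: exp_sum[OF finite_lessThan] of_real_prod)
  also have "(\<Sum>j<card I. - (\<bar>\<theta>\<bar> powr \<alpha> * (\<bar>c (h j)\<bar> powr \<alpha> * measure m (B (h j)))))
     = - (\<bar>\<theta>\<bar> powr \<alpha> * (\<Sum>i\<in>I. \<bar>c i\<bar> powr \<alpha> * measure m (B i)))"
    by (simp add: sum_negf sum_distrib_left sum.reindex_bij_betw[OF h, of "\<lambda>i. \<bar>c i\<bar> powr \<alpha> * measure m (B i)", symmetric])
  finally show ?thesis .
qed

text \<open>
  The sets need not be disjoint. They are cut into the atoms \<open>B S\<close> of points lying in exactly the sets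
  with index in \<open>S\<close>; the combination is then a sum of independent terms, and the function
  \<open>\<Sum>j\<in>J. c j * indicator (A j)\<close> takes the value \<open>d S = (\<Sum>j\<in>S. c j)\<close> on \<open>B S\<close>.
  The atom with \<open>S = {}\<close> may have infinite measure, but there the function is \<open>0\<close>.
\<close>

lemma cf_linear_combination:
  assumes J: "finite J" and A: "\<And>j. j \<in> J \<Longrightarrow> A j \<in> finite_measure_sets m"
  shows "integrable m (\<lambda>x. \<bar>\<Sum>j\<in>J. c j * indicator (A j) x\<bar> powr \<alpha>)"
    and "(CLINT \<omega>|P. iexp (\<theta> * (\<Sum>j\<in>J. c j * M (A j) \<omega>)))
      = complex_of_real (exp (- ((LINT x|m. \<bar>\<Sum>j\<in>J. c j * indicator (A j) x\<bar> powr \<alpha>) * \<bar>\<theta>\<bar> powr \<alpha>)))"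
proof -
  define \<S> where "\<S> = Pow J - {{}}"
  define B where "B = (\<lambda>S. {x \<in> space m. {j \<in> J. x \<in> A j} = S})"
  define d where "d = (\<lambda>S. \<Sum>j\<in>S. c j)"
  have fin: "finite \<S>" using J by (simp add: \<S>_def)
  have disj: "disjoint_family_on B I" for I by (auto simp: disjoint_family_on_def B_def)
  have Aset: "A j \<in> sets m" if "j \<in> J" for j using A[OF that] by (simp add: finite_measure_sets_def)
  have BF: "B S \<in> finite_measure_sets m" if "S \<in> \<S>" for S
  proof -
    have SJ: "S \<subseteq> J" "S \<noteq> {}" using that by (auto simp: \<S>_def)
    then have "B S = {x \<in> space m. \<forall>j\<in>J. x \<in> A j \<longleftrightarrow> j \<in> S}" by (auto simp: B_def)
    also have "\<dots> \<in> sets m" using J Aset by measurable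
    finally have S: "B S \<in> sets m" .
    obtain j where j: "j \<in> S" "j \<in> J" using SJ by blast
    have "B S \<subseteq> A j" using j by (auto simp: B_def)
    then have "emeasure m (B S) \<le> emeasure m (A j)" using Aset[OF j(2)] by (rule emeasure_mono)
    with S A[OF j(2)] show ?thesis by (auto simp: finite_measure_sets_def intro: le_less_trans)
  qed
  have union: "A j = (\<Union>S\<in>{S \<in> \<S>. j \<in> S}. B S)" if "j \<in> J" for j
    using that sets.sets_into_space[OF Aset[OF that]] by (auto simp: B_def \<S>_def)
  have "AE \<omega> in P. \<forall>j\<in>J. M (A j) \<omega> = (\<Sum>S\<in>{S \<in> \<S>. j \<in> S}. M (B S) \<omega>)"
  proof (rule AE_finite_allI[OF J])
    fix j assume j: "j \<in> J"
    have "AE \<omega> in P. M (\<Union>S\<in>{S \<in> \<S>. j \<in> S}. B S) \<omega> = (\<Sum>S\<in>{S \<in> \<S>. j \<in> S}. M (B S) \<omega>)"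
      by (rule M_finite_UN) (use fin disj BF in auto)
    then show "AE \<omega> in P. M (A j) \<omega> = (\<Sum>S\<in>{S \<in> \<S>. j \<in> S}. M (B S) \<omega>)"
      using union[OF j] by simp
  qed
  then have ae: "AE \<omega> in P. (\<Sum>j\<in>J. c j * M (A j) \<omega>) = (\<Sum>S\<in>\<S>. d S * M (B S) \<omega>)"
  proof eventually_elim
    case (elim \<omega>)
    have "(\<Sum>j\<in>J. c j * M (A j) \<omega>) = (\<Sum>j\<in>J. \<Sum>S\<in>{S \<in> \<S>. j \<in> S}. c j * M (B S) \<omega>)"
      using elim by (simp add: sum_distrib_left)
    also have "\<dots> = (\<Sum>S\<in>\<S>. \<Sum>j\<in>{j \<in> J. j \<in> S}. c j * M (B S) \<omega>)"
      by (rule sum.swap_restrict[OF J fin])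
    also have "\<dots> = (\<Sum>S\<in>\<S>. d S * M (B S) \<omega>)"
    proof (intro sum.cong refl)
      fix S assume "S \<in> \<S>"
      then have "{j \<in> J. j \<in> S} = S" by (auto simp: \<S>_def)
      then show "(\<Sum>j\<in>{j \<in> J. j \<in> S}. c j * M (B S) \<omega>) = d S * M (B S) \<omega>"
        by (simp add: d_def sum_distrib_right)
    qed
    finally show ?case .
  qed
  have simple: "\<bar>\<Sum>j\<in>J. c j * indicator (A j) x\<bar> powr \<alpha> = (\<Sum>S\<in>\<S>. \<bar>d S\<bar> powr \<alpha> * indicator (B S) x)"
    if x: "x \<in> space m" for x
  proof -
    define T where "T = {j \<in> J. x \<in> A j}"
    have "(\<Sum>j\<in>J. c j * indicator (A j) x) = (\<Sum>j\<in>T. c j)"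
      unfolding T_def using J by (intro sum.mono_neutral_cong_right) (auto simp: indicator_def)
    then have L: "(\<Sum>j\<in>J. c j * indicator (A j) x) = d T" by (simp add: d_def)
    have xB: "x \<in> B S \<longleftrightarrow> S = T" for S using x by (auto simp: B_def T_def)
    have "(\<Sum>S\<in>\<S>. \<bar>d S\<bar> powr \<alpha> * indicator (B S) x) = (\<Sum>S\<in>\<S>. if S = T then \<bar>d S\<bar> powr \<alpha> else 0)"
      by (intro sum.cong refl) (auto simp: indicator_def xB)
    also have "\<dots> = (if T \<in> \<S> then \<bar>d T\<bar> powr \<alpha> else 0)" using fin by simp
    also have "\<dots> = \<bar>d T\<bar> powr \<alpha>"
    proof (cases "T = {}")
      case True
      then show ?thesis using \<alpha>_pos by (simp add: d_def)
    next
      case False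
      then have "T \<in> \<S>" by (auto simp: \<S>_def T_def)
      then show ?thesis by simp
    qed
    finally show ?thesis using L by simp
  qed
  have BM: "B S \<in> sets m" "emeasure m (B S) < \<infinity>" if "S \<in> \<S>" for S
    using BF[OF that] by (auto simp: finite_measure_sets_def)
  have ib: "integrable m (\<lambda>x. \<bar>d S\<bar> powr \<alpha> * indicator (B S) x :: real)" if "S \<in> \<S>" for S
    using BM[OF that] by (intro integrable_mult_right integrable_real_indicator)
  have int: "integrable m (\<lambda>x. \<Sum>S\<in>\<S>. \<bar>d S\<bar> powr \<alpha> * indicator (B S) x)"
    by (intro Bochner_Integration.integrable_sum ib)
  then show "integrable m (\<lambda>x. \<bar>\<Sum>j\<in>J. c j * indicator (A j) x\<bar> powr \<alpha>)"
    by (subst Bochner_Integration.integrable_cong[OF refl simple])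
  have "(LINT x|m. \<bar>\<Sum>j\<in>J. c j * indicator (A j) x\<bar> powr \<alpha>) = (LINT x|m. (\<Sum>S\<in>\<S>. \<bar>d S\<bar> powr \<alpha> * indicator (B S) x))"
    by (intro Bochner_Integration.integral_cong refl simple)
  also have "\<dots> = (\<Sum>S\<in>\<S>. (LINT x|m. \<bar>d S\<bar> powr \<alpha> * indicator (B S) x))"
    by (rule Bochner_Integration.integral_sum) (rule ib)
  also have "\<dots> = (\<Sum>S\<in>\<S>. \<bar>d S\<bar> powr \<alpha> * measure m (B S))"
    by (intro sum.cong refl) (simp add: Int_absorb2 sets.sets_into_space BM)
  finally have L: "(LINT x|m. \<bar>\<Sum>j\<in>J. c j * indicator (A j) x\<bar> powr \<alpha>) = (\<Sum>S\<in>\<S>. \<bar>d S\<bar> powr \<alpha> * measure m (B S))" .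
  have [measurable]: "(\<lambda>\<omega>. \<Sum>j\<in>J. c j * M (A j) \<omega>) \<in> borel_measurable P" 
    using A by (intro borel_measurable_sum borel_measurable_times) auto
  have [measurable]: "(\<lambda>\<omega>. \<Sum>S\<in>\<S>. d S * M (B S) \<omega>) \<in> borel_measurable P"
    using BF by (intro borel_measurable_sum borel_measurable_times) auto
  have "(CLINT \<omega>|P. iexp (\<theta> * (\<Sum>j\<in>J. c j * M (A j) \<omega>))) = (CLINT \<omega>|P. iexp (\<theta> * (\<Sum>S\<in>\<S>. d S * M (B S) \<omega>)))"
  proof (rule integral_cong_AE)
    show "AE \<omega> in P. iexp (\<theta> * (\<Sum>j\<in>J. c j * M (A j) \<omega>)) = iexp (\<theta> * (\<Sum>S\<in>\<S>. d S * M (B S) \<omega>))"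
      using ae by eventually_elim (simp only:)
  qed measurable
  also have "\<dots> = char (distr P borel (\<lambda>\<omega>. \<Sum>S\<in>\<S>. d S * M (B S) \<omega>)) \<theta>"
    unfolding char_def by (subst integral_distr) auto
  also have "\<dots> = complex_of_real (exp (- (\<bar>\<theta>\<bar> powr \<alpha> * (\<Sum>S\<in>\<S>. \<bar>d S\<bar> powr \<alpha> * measure m (B S)))))"
    by (rule cf_disjoint_sum) (use fin disj BF in auto)
  finally show "(CLINT \<omega>|P. iexp (\<theta> * (\<Sum>j\<in>J. c j * M (A j) \<omega>)))
      = complex_of_real (exp (- ((LINT x|m. \<bar>\<Sum>j\<in>J. c j * indicator (A j) x\<bar> powr \<alpha>) * \<bar>\<theta>\<bar> powr \<alpha>)))"
    unfolding L by (simp add: mult.commute)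
qed

end

section \<open>Stochastic integrals of indicator functions\<close>

context stable_random_measure begin

text \<open>
  The difference is a linear combination of values of \<open>M\<close>: on the nonzero level sets of \<open>s\<close>, indexed by
  \<open>Some y\<close>, and on \<open>S\<close> itself, indexed by \<open>None\<close>.
\<close>

lemma simple_integral_minus_cf:
  assumes S: "S \<in> finite_measure_sets m"
    and s: "simple_function m s" "emeasure m {x \<in> space m. s x \<noteq> 0} < \<infinity>"
  shows "simple_stochastic_integral m M s \<in> borel_measurable P"
    and "integrable m (\<lambda>x. \<bar>s x - indicator S x\<bar> powr \<alpha>)"
    and "(CLINT \<omega>|P. iexp (\<theta> * (simple_stochastic_integral m M s \<omega> - M S \<omega>)))
      = complex_of_real (exp (- ((LINT x|m. \<bar>s x - indicator S x\<bar> powr \<alpha>) * \<bar>\<theta>\<bar> powr \<alpha>)))"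
proof -
  define V where "V = s ` space m - {0}"
  define J where "J = insert None (Some ` V)"
  define A where "A = case_option S (\<lambda>y. {x \<in> space m. s x = y})"
  define c where "c = case_option (-1) (\<lambda>y::real. y)"
  have finV: "finite V" using s(1) by (auto simp: V_def simple_function_def)
  then have finJ: "finite J" by (simp add: J_def)
  have lev: "{x \<in> space m. s x = y} \<in> finite_measure_sets m" if "y \<in> V" for y
  proof -
    note [measurable] = borel_measurable_simple_function[OF s(1)]
    have "{x \<in> space m. s x = y} \<in> sets m" by measurable
    moreover have "emeasure m {x \<in> space m. s x = y} \<le> emeasure m {x \<in> space m. s x \<noteq> 0}"
      using that by (intro emeasure_mono) (auto simp: V_def)
    ultimately show ?thesis using s(2) by (auto simp: finite_measure_sets_def intro: le_less_trans)
  qed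
  have A: "A j \<in> finite_measure_sets m" if "j \<in> J" for j
    using that S lev by (auto simp: A_def J_def)
  have sumJ: "(\<Sum>j\<in>J. f j) = f None + (\<Sum>y\<in>V. f (Some y))" for f :: "real option \<Rightarrow> real"
    using finV by (simp add: J_def sum.reindex)
  have eq: "simple_stochastic_integral m M s = (\<lambda>\<omega>. \<Sum>y\<in>V. y * M {x \<in> space m. s x = y} \<omega>)"
    unfolding simple_stochastic_integral_def V_def using finV
    by (intro ext sum.mono_neutral_right) (use s(1) in \<open>auto simp: simple_function_def\<close>)
  show "simple_stochastic_integral m M s \<in> borel_measurable P"
    unfolding eq using lev by (intro borel_measurable_sum borel_measurable_times) auto
  have fun_eq: "(\<Sum>j\<in>J. c j * indicator (A j) x) = s x - indicator S x" if x: "x \<in> space m" for x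
  proof -
    have "(\<Sum>y\<in>V. y * indicator {x \<in> space m. s x = y} x) = (\<Sum>y\<in>V. if y = s x then y else 0)"
      using x by (intro sum.cong refl) (auto simp: indicator_def)
    also have "\<dots> = s x" using finV x by (auto simp: V_def)
    finally show ?thesis by (simp add: sumJ A_def c_def)
  qed
  have int_eq: "(LINT x|m. \<bar>\<Sum>j\<in>J. c j * indicator (A j) x\<bar> powr \<alpha>) = (LINT x|m. \<bar>s x - indicator S x\<bar> powr \<alpha>)"
    by (intro Bochner_Integration.integral_cong refl) (simp add: fun_eq)
  have M_eq: "(\<Sum>j\<in>J. c j * M (A j) \<omega>) = simple_stochastic_integral m M s \<omega> - M S \<omega>" for \<omega>
    by (simp add: sumJ A_def c_def eq)
  show "integrable m (\<lambda>x. \<bar>s x - indicator S x\<bar> powr \<alpha>)"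
  proof -
    have "integrable m (\<lambda>x. \<bar>\<Sum>j\<in>J. c j * indicator (A j) x\<bar> powr \<alpha>)"
      by (rule cf_linear_combination(1)[OF finJ A])
    then show ?thesis
      by (rule Bochner_Integration.integrable_cong[THEN iffD1, rotated -1]) (auto simp: fun_eq)
  qed
  show "(CLINT \<omega>|P. iexp (\<theta> * (simple_stochastic_integral m M s \<omega> - M S \<omega>)))
      = complex_of_real (exp (- ((LINT x|m. \<bar>s x - indicator S x\<bar> powr \<alpha>) * \<bar>\<theta>\<bar> powr \<alpha>)))"
    unfolding int_eq[symmetric] M_eq[symmetric] by (rule cf_linear_combination(2)[OF finJ A])
qed

text \<open>
  The integrals of the approximating simple functions converge to \<open>Y\<close> in probability by definition,
  and to \<open>M S\<close> because the scale of the difference is the distance of the integrands, which tends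
  to \<open>0\<close>.
\<close>

lemma stochastic_integral_indicator:
  assumes Y: "has_stochastic_integral P m \<alpha> M (indicator S) Y" and S: "S \<subseteq> space m"
  shows "S \<in> finite_measure_sets m" and "AE \<omega> in P. Y \<omega> = M S \<omega>"
proof -
  have [measurable]: "Y \<in> borel_measurable P" using Y by (simp add: has_stochastic_integral_def)
  have "S \<inter> space m \<in> sets m"
    using Y by (simp add: has_stochastic_integral_def borel_measurable_indicator_iff)
  then have Ss: "S \<in> sets m" using S by (simp add: Int_absorb2)
  have "(\<integral>\<^sup>+x. ennreal (\<bar>indicator S x\<bar> powr \<alpha>) \<partial>m) = (\<integral>\<^sup>+x. indicator S x \<partial>m)"
    using \<alpha>_pos by (intro nn_integral_cong) (auto simp: indicator_def)
  with Y Ss show SF: "S \<in> finite_measure_sets m"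
    by (simp add: has_stochastic_integral_def finite_measure_sets_def)
  note [measurable] = M_measurable[OF SF]
  obtain s where s: "\<And>j. simple_function m (s j)" "\<And>j. emeasure m {x \<in> space m. s j x \<noteq> 0} < \<infinity>"
    and lim: "(\<lambda>j. \<integral>\<^sup>+x. ennreal (\<bar>s j x - indicator S x\<bar> powr \<alpha>) \<partial>m) \<longlonglongrightarrow> 0"
    and conv: "conv_in_prob P sequentially (\<lambda>j. simple_stochastic_integral m M (s j)) Y"
    using Y by (auto simp: has_stochastic_integral_def)
  define I where "I = (\<lambda>j. simple_stochastic_integral m M (s j))"
  have [measurable]: "I j \<in> borel_measurable P" for j
    unfolding I_def using s by (intro simple_integral_minus_cf(1)[OF SF]) auto
  define \<epsilon> where "\<epsilon> = (\<lambda>j. LINT x|m. \<bar>s j x - indicator S x\<bar> powr \<alpha>)"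
  have \<epsilon>0: "\<epsilon> j \<ge> 0" for j unfolding \<epsilon>_def by (rule Bochner_Integration.integral_nonneg) simp
  have "(\<integral>\<^sup>+x. ennreal (\<bar>s j x - indicator S x\<bar> powr \<alpha>) \<partial>m) = ennreal (\<epsilon> j)" for j
    unfolding \<epsilon>_def using simple_integral_minus_cf(2)[OF SF s] by (intro nn_integral_eq_integral) auto
  with lim have "(\<lambda>j. ennreal (\<epsilon> j)) \<longlonglongrightarrow> ennreal 0" by simp
  then have \<epsilon>: "\<epsilon> \<longlonglongrightarrow> 0" by (rule tendsto_ennrealD) (use \<epsilon>0 in auto)
  have small: "prob {\<omega> \<in> space P. \<bar>Y \<omega> - M S \<omega>\<bar> > 2 * \<delta>} = 0" if \<delta>: "\<delta> > 0" for \<delta> :: real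
  proof -
    define g where "g = (\<lambda>j. (1 - (LINT x|std_normal_distribution. exp (- (\<epsilon> j * \<bar>x\<bar> powr \<alpha>)))) / (1 - exp (- (\<delta>\<^sup>2 / 2))))"
    have d: "1 - exp (- (\<delta>\<^sup>2 / 2)) > 0" using \<delta> by simp
    have "g \<longlonglongrightarrow> (1 - 1) / (1 - exp (- (\<delta>\<^sup>2 / 2)))"
      unfolding g_def using d by (intro tendsto_intros integral_std_normal_exp_tendsto_1 \<epsilon> \<epsilon>0) auto
    then have g: "g \<longlonglongrightarrow> 0" by simp
    have "prob {\<omega> \<in> space P. \<bar>I j \<omega> - M S \<omega>\<bar> > \<delta>} \<le> g j" for j
    proof -
      have "prob {\<omega> \<in> space P. \<bar>I j \<omega> - M S \<omega>\<bar> > \<delta>} * (1 - exp (- (\<delta>\<^sup>2 / 2)))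
          \<le> 1 - (LINT x|std_normal_distribution. exp (- (\<epsilon> j * \<bar>x\<bar> powr \<alpha>)))"
      proof (rule prob_abs_gt_le_cf[OF _ \<delta> \<epsilon>0])
        show "(CLINT \<omega>|P. iexp (y * (I j \<omega> - M S \<omega>))) = complex_of_real (exp (- (\<epsilon> j * \<bar>y\<bar> powr \<alpha>)))" for y
          unfolding I_def \<epsilon>_def by (rule simple_integral_minus_cf(3)[OF SF s])
      qed measurable
      then show ?thesis unfolding g_def using d by (simp add: pos_le_divide_eq)
    qed
    moreover have "prob {\<omega> \<in> space P. \<bar>Y \<omega> - M S \<omega>\<bar> > 2 * \<delta>} \<le>
        prob {\<omega> \<in> space P. \<delta> < \<bar>I j \<omega> - Y \<omega>\<bar>} + prob {\<omega> \<in> space P. \<bar>I j \<omega> - M S \<omega>\<bar> > \<delta>}" for j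
      by (intro order_trans[OF finite_measure_mono measure_Un_le]) auto
    ultimately have "prob {\<omega> \<in> space P. \<bar>Y \<omega> - M S \<omega>\<bar> > 2 * \<delta>} \<le> prob {\<omega> \<in> space P. \<delta> < \<bar>I j \<omega> - Y \<omega>\<bar>} + g j" for j
      by (meson add_left_mono order_trans)
    moreover have "(\<lambda>j. prob {\<omega> \<in> space P. \<delta> < \<bar>I j \<omega> - Y \<omega>\<bar>} + g j) \<longlonglongrightarrow> 0 + 0"
      using conv \<delta> by (intro tendsto_add g) (auto simp: conv_in_prob_def I_def)
    ultimately have "prob {\<omega> \<in> space P. \<bar>Y \<omega> - M S \<omega>\<bar> > 2 * \<delta>} \<le> 0"
      by (intro LIMSEQ_le_const[of _ 0]) auto
    then show ?thesis by (simp add: measure_le_0_iff)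
  qed
  have "AE \<omega> in P. \<forall>k::nat. \<not> \<bar>Y \<omega> - M S \<omega>\<bar> > 2 * (1 / real (Suc k))"
  proof (subst AE_all_countable, rule allI)
    fix k :: nat
    have "{\<omega> \<in> space P. \<bar>Y \<omega> - M S \<omega>\<bar> > 2 * (1 / real (Suc k))} \<in> null_sets P"
      using small[of "1 / real (Suc k)"] by (auto simp: emeasure_eq_measure)
    then show "AE \<omega> in P. \<not> \<bar>Y \<omega> - M S \<omega>\<bar> > 2 * (1 / real (Suc k))"
      by (rule AE_I') auto
  qed
  then show "AE \<omega> in P. Y \<omega> = M S \<omega>"
  proof eventually_elim
    case (elim \<omega>)
    have "\<bar>Y \<omega> - M S \<omega>\<bar> \<le> 0"
    proof (rule ccontr)
      assume "\<not> \<bar>Y \<omega> - M S \<omega>\<bar> \<le> 0"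
      then obtain k :: nat where "1 / real (Suc k) < \<bar>Y \<omega> - M S \<omega>\<bar> / 2"
        using nat_approx_posE[of "\<bar>Y \<omega> - M S \<omega>\<bar> / 2"] by auto
      with elim[rule_format, of k] show False by simp
    qed
    then show ?case by simp
  qed
qed

lemma cf_integrals_of_indicators:
  fixes Y :: "'i \<Rightarrow> 'w \<Rightarrow> real"
  assumes J: "finite J"
    and Y: "\<And>j. j \<in> J \<Longrightarrow> has_stochastic_integral P m \<alpha> M (indicator (S j)) (Y j)"
    and S: "\<And>j. j \<in> J \<Longrightarrow> S j \<subseteq> space m"
  shows "integrable m (\<lambda>x. \<bar>\<Sum>j\<in>J. c j * indicator (S j) x\<bar> powr \<alpha>)"
    and "(CLINT \<omega>|P. iexp (\<Sum>j\<in>J. c j * Y j \<omega>))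
      = complex_of_real (exp (- (LINT x|m. \<bar>\<Sum>j\<in>J. c j * indicator (S j) x\<bar> powr \<alpha>)))"
proof -
  have SF: "S j \<in> finite_measure_sets m" if "j \<in> J" for j
    using that Y S by (intro stochastic_integral_indicator(1))
  then show "integrable m (\<lambda>x. \<bar>\<Sum>j\<in>J. c j * indicator (S j) x\<bar> powr \<alpha>)"
    by (rule cf_linear_combination(1)[OF J])
  have [measurable]: "(\<lambda>\<omega>. \<Sum>j\<in>J. c j * Y j \<omega>) \<in> borel_measurable P"
    using Y by (intro borel_measurable_sum borel_measurable_times) (auto simp: has_stochastic_integral_def)
  have [measurable]: "(\<lambda>\<omega>. \<Sum>j\<in>J. c j * M (S j) \<omega>) \<in> borel_measurable P"
    using SF by (intro borel_measurable_sum borel_measurable_times) auto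
  have "AE \<omega> in P. \<forall>j\<in>J. Y j \<omega> = M (S j) \<omega>"
    using Y S by (intro AE_finite_allI[OF J] stochastic_integral_indicator(2))
  then have ae: "AE \<omega> in P. (\<Sum>j\<in>J. c j * Y j \<omega>) = (\<Sum>j\<in>J. c j * M (S j) \<omega>)"
    by eventually_elim auto
  have "(CLINT \<omega>|P. iexp (\<Sum>j\<in>J. c j * Y j \<omega>)) = (CLINT \<omega>|P. iexp (1 * (\<Sum>j\<in>J. c j * M (S j) \<omega>)))"
  proof (rule integral_cong_AE)
    show "AE \<omega> in P. iexp (\<Sum>j\<in>J. c j * Y j \<omega>) = iexp (1 * (\<Sum>j\<in>J. c j * M (S j) \<omega>))"
      using ae by eventually_elim (simp only: mult_1)
  qed measurable
  also have "\<dots> = complex_of_real (exp (- (LINT x|m. \<bar>\<Sum>j\<in>J. c j * indicator (S j) x\<bar> powr \<alpha>)))"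
    using cf_linear_combination(2)[OF J SF, where c=c and \<theta>=1] by simp
  finally show "(CLINT \<omega>|P. iexp (\<Sum>j\<in>J. c j * Y j \<omega>))
      = complex_of_real (exp (- (LINT x|m. \<bar>\<Sum>j\<in>J. c j * indicator (S j) x\<bar> powr \<alpha>)))" .
qed

end

section \<open>Cones and the control measure\<close>

lemma borel_measurable_fst_snd [measurable]:
  "(fst :: real \<times> real \<Rightarrow> real) \<in> borel_measurable borel"
  "(snd :: real \<times> real \<Rightarrow> real) \<in> borel_measurable borel"
  by (intro borel_measurable_continuous_onI continuous_intros)+

lemma takenaka_cone_measurable [measurable]: "takenaka_cone t \<in> sets borel"
proof -
  have "takenaka_cone t = {p. snd p > 0 \<and> \<bar>fst p - t\<bar> \<le> snd p}"
    by (auto simp: takenaka_cone_def)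
  also have "\<dots> \<in> sets borel" by measurable
  finally show ?thesis .
qed

lemma space_takenaka_control: "space (takenaka_control \<nu>) = UNIV \<times> {0<..}"
  by (simp add: takenaka_control_def space_restrict_space)

lemma takenaka_set_subset_space: "takenaka_set t \<subseteq> space (takenaka_control \<nu>)"
  by (auto simp: space_takenaka_control takenaka_set_def takenaka_cone_def)

lemma upper_half_plane_borel [measurable]: "UNIV \<times> {0<..} \<in> sets (borel :: (real \<times> real) measure)"
  by (intro borel_open open_Times) auto

lemma borel_measurable_takenaka_control:
  "f \<in> borel_measurable borel \<Longrightarrow> f \<in> borel_measurable (takenaka_control \<nu>)"
  unfolding takenaka_control_def by (auto intro: measurable_restrict_space1)

lemma nn_integral_takenaka_control:
  assumes [measurable]: "g \<in> borel_measurable borel"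
  shows "(\<integral>\<^sup>+z. g z \<partial>takenaka_control \<nu>)
    = (\<integral>\<^sup>+z. ennreal (snd z powr (\<nu> - 2)) * g z * indicator (UNIV \<times> {0<..}) z \<partial>lborel)"
proof -
  have [measurable]: "(\<lambda>z. ennreal (snd z powr (\<nu> - 2))) \<in> borel_measurable (borel :: (real \<times> real) measure)"
    by measurable
  have "(\<integral>\<^sup>+z. g z \<partial>takenaka_control \<nu>)
      = (\<integral>\<^sup>+z. ennreal (snd z powr (\<nu> - 2)) * g z \<partial>restrict_space lborel (UNIV \<times> {0<..}))"
    unfolding takenaka_control_def case_prod_beta'
    by (rule nn_integral_density) (auto intro!: measurable_restrict_space1)
  also have "\<dots> = (\<integral>\<^sup>+z. ennreal (snd z powr (\<nu> - 2)) * g z * indicator (UNIV \<times> {0<..}) z \<partial>lborel)"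
    by (rule nn_integral_restrict_space) auto
  finally show ?thesis .
qed

text \<open>
  Self-similarity and stationarity of the control measure: of the Jacobian \<open>1 / n\<^sup>2\<close> of the dilation the
  density \<open>r powr (\<nu> - 2)\<close> gives back \<open>n powr (2 - \<nu>)\<close>.
\<close>

lemma nn_integral_takenaka_control_affine:
  assumes [measurable]: "g \<in> borel_measurable borel" and n: "n > 0"
  shows "(\<integral>\<^sup>+z. g z \<partial>takenaka_control \<nu>)
    = ennreal (n powr (- \<nu>)) * (\<integral>\<^sup>+z. g ((fst z + q) / n, snd z / n) \<partial>takenaka_control \<nu>)"
proof -
  define T where "T = (\<lambda>z::real \<times> real. (q / n, 0) + (1 / n) *\<^sub>R z)"
  have T: "T z = ((fst z + q) / n, snd z / n)" for z
    by (cases z) (simp add: T_def add_divide_distrib)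
  have Tm [measurable]: "T \<in> borel_measurable borel"
    unfolding T_def by (intro borel_measurable_continuous_onI continuous_intros)
  have [measurable]: "(\<lambda>z. ennreal (snd z powr (\<nu> - 2))) \<in> borel_measurable (borel :: (real \<times> real) measure)"
    by measurable
  define F where "F = (\<lambda>z. ennreal (snd z powr (\<nu> - 2)) * g z * indicator (UNIV \<times> {0<..}) z)"
  have [measurable]: "F \<in> borel_measurable borel" unfolding F_def by measurable
  have "(\<integral>\<^sup>+z. g z \<partial>takenaka_control \<nu>) = (\<integral>\<^sup>+z. F z \<partial>lborel)"
    unfolding F_def by (rule nn_integral_takenaka_control) measurable
  also have "\<dots> = (\<integral>\<^sup>+z. F z \<partial>density (distr lborel borel T) (\<lambda>_. ennreal (\<bar>1 / n\<bar> ^ DIM(real \<times> real))))"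
    unfolding T_def using n by (subst lborel_affine[of "1 / n" "(q / n, 0)"]) (auto simp: ennreal_power)
  also have "\<dots> = (\<integral>\<^sup>+z. ennreal (1 / n ^ 2) * F (T z) \<partial>lborel)"
    using n by (simp add: nn_integral_density nn_integral_distr power_divide numeral_2_eq_2)
  also have "\<dots> = (\<integral>\<^sup>+z. ennreal (n powr (- \<nu>)) *
      (ennreal (snd z powr (\<nu> - 2)) * g ((fst z + q) / n, snd z / n) * indicator (UNIV \<times> {0<..}) z) \<partial>lborel)"
  proof (rule nn_integral_cong)
    fix z :: "real \<times> real"
    show "ennreal (1 / n ^ 2) * F (T z) = ennreal (n powr (- \<nu>)) *
      (ennreal (snd z powr (\<nu> - 2)) * g ((fst z + q) / n, snd z / n) * indicator (UNIV \<times> {0<..}) z)"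
    proof (cases "snd z > 0")
      case True
      have "1 / n ^ 2 * (snd z / n) powr (\<nu> - 2) = n powr (- \<nu>) * snd z powr (\<nu> - 2)"
        using True n by (simp add: powr_divide powr_diff powr_minus powr_numeral field_simps)
      then have "ennreal (1 / n ^ 2) * ennreal ((snd z / n) powr (\<nu> - 2))
          = ennreal (n powr (- \<nu>)) * ennreal (snd z powr (\<nu> - 2))"
        by (simp only: ennreal_mult''[symmetric] powr_ge_zero)
      then show ?thesis
        using True n by (simp add: F_def T indicator_def mem_Times_iff mult.assoc[symmetric])
    next
      case False
      then show ?thesis using n by (simp add: F_def T indicator_def mem_Times_iff zero_less_divide_iff)
    qed
  qed
  also have "\<dots> = ennreal (n powr (- \<nu>)) * (\<integral>\<^sup>+z. g ((fst z + q) / n, snd z / n) \<partial>takenaka_control \<nu>)"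
  proof -
    have [measurable]: "(\<lambda>z. g ((fst z + q) / n, snd z / n)) \<in> borel_measurable borel"
      using measurable_compose[OF Tm assms(1)] by (simp add: T)
    show ?thesis by (simp add: nn_integral_cmult nn_integral_takenaka_control)
  qed
  finally show ?thesis .
qed

definition cone_fun :: "nat \<Rightarrow> (nat \<Rightarrow> real) \<Rightarrow> real \<Rightarrow> real \<Rightarrow> real \<times> real \<Rightarrow> real" where
  "cone_fun K a n q z = (\<Sum>k = 0..K. a k * indicator (takenaka_cone ((real k + q) / n)) z)"

lemma cone_fun_measurable [measurable]: "cone_fun K a n q \<in> borel_measurable borel"
  unfolding cone_fun_def by measurable

lemma abs_cone_fun_le: "\<bar>cone_fun K a n q z\<bar> \<le> (\<Sum>k = 0..K. \<bar>a k\<bar>)"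
  unfolding cone_fun_def
  by (rule order_trans[OF sum_abs]) (auto intro!: sum_mono simp: indicator_def)

lemma cone_fun_affine:
  "n > 0 \<Longrightarrow> cone_fun K a n q ((x + c) / n, r / n) = cone_fun K a 1 (q - c) (x, r)"
proof -
  assume n: "n > 0"
  have "((x + c) / n, r / n) \<in> takenaka_cone ((k + q) / n) \<longleftrightarrow> (x, r) \<in> takenaka_cone (k + (q - c))" for k
  proof -
    have "(x + c) / n - (k + q) / n = (x - (k + (q - c))) / n" by (simp add: diff_divide_distrib[symmetric] algebra_simps)
    then show ?thesis using n by (simp add: takenaka_cone_def abs_divide zero_less_divide_iff divide_le_cancel)
  qed
  then show ?thesis by (simp add: cone_fun_def indicator_def)
qed

text \<open>
  The indicator of a symmetric difference with the cone at \<open>0\<close> is the indicator of the other cone, with its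
  sign reversed inside the cone at \<open>0\<close>, plus a term independent of that other cone. This term cancels as
  the coefficients sum to zero. So up to a sign that is common to all increments the sets may be
  replaced by cones, for which translation and dilation act transparently.
\<close>

lemma takenaka_set_sum_eq_cone_fun:
  assumes "(\<Sum>k = 0..K. a k) = 0"
  shows "(\<Sum>k = 0..K. a k * indicator (takenaka_set ((real k + q) / n)) z)
    = (1 - 2 * indicator (takenaka_cone 0) z) * cone_fun K a n q z"
proof -
  have "(\<Sum>k = 0..K. a k * indicator (takenaka_set ((real k + q) / n)) z) =
    (\<Sum>k = 0..K. a k * indicator (takenaka_cone 0) z + (1 - 2 * indicator (takenaka_cone 0) z) * (a k * indicator (takenaka_cone ((real k + q) / n)) z))"
    by (intro sum.cong refl) (auto simp: takenaka_set_def indicator_def)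
  also have "\<dots> = (\<Sum>k = 0..K. a k) * indicator (takenaka_cone 0) z + (1 - 2 * indicator (takenaka_cone 0) z) * cone_fun K a n q z"
    by (simp only: sum.distrib sum_distrib_left sum_distrib_right cone_fun_def)
  finally show ?thesis using assms by simp
qed

text \<open>
  If \<open>[x - r, x + r]\<close> contains all of \<open>q, \<dots>, q + K\<close> the value is the full sum of the coefficients, and if
  it contains none of these points the value is an empty sum.
\<close>

lemma cone_fun_nonzero_cases:
  assumes "(\<Sum>k = 0..K. a k) = 0" "cone_fun K a 1 q (x, r) \<noteq> 0"
  shows "r > 0" "(q \<le> x - r \<and> x - r \<le> q + real K) \<or> (q \<le> x + r \<and> x + r \<le> q + real K)"
proof -
  show r: "r > 0"
  proof (rule ccontr)
    assume "\<not> r > 0"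
    then have "cone_fun K a 1 q (x, r) = 0" by (auto simp: cone_fun_def takenaka_cone_def intro!: sum.neutral)
    with assms show False by simp
  qed
  show "(q \<le> x - r \<and> x - r \<le> q + real K) \<or> (q \<le> x + r \<and> x + r \<le> q + real K)"
  proof (rule ccontr)
    assume n: "\<not> ?thesis"
    show False
    proof (cases "x - r < q \<and> x + r > q + real K")
      case True
      then have "cone_fun K a 1 q (x, r) = (\<Sum>k = 0..K. a k)"
        unfolding cone_fun_def using r by (intro sum.cong refl) (auto simp: takenaka_cone_def indicator_def abs_le_iff)
      with assms show False by simp
    next
      case False
      with n r have "x - r > q + real K \<or> x + r < q" by auto
      then have "cone_fun K a 1 q (x, r) = 0"
        unfolding cone_fun_def using r by (intro sum.neutral) (auto simp: takenaka_cone_def indicator_def abs_le_iff)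
      with assms show False by simp
    qed
  qed
qed

text \<open>
  For \<open>l > K\<close> a single end point of \<open>[x - r, x + r]\<close> cannot lie in both stretches, so the left one lies in the
  first and the right one in the second. This places \<open>(x, r)\<close> in a square with side \<open>K\<close> in
  which \<open>r \<ge> (l - K) / 2\<close>.
\<close>

lemma nn_integral_takenaka_overlap:
  assumes a: "(\<Sum>k = 0..K. a k) = 0" and l: "real K < l" and \<nu>: "\<nu> < 1" and n: "n > 0"
  shows "(\<integral>\<^sup>+z. indicator {z. cone_fun K a n p z \<noteq> 0 \<and> cone_fun K a n (p + l) z \<noteq> 0} z \<partial>takenaka_control \<nu>)
    \<le> ennreal (n powr (- \<nu>) * ((real K)\<^sup>2 * ((l - real K) / 2) powr (\<nu> - 2)))"
proof -
  define D where "D = {z. cone_fun K a 1 0 z \<noteq> 0 \<and> cone_fun K a 1 l z \<noteq> 0}"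
  define Q where "Q = {l / 2 .. l / 2 + real K} \<times> {(l - real K) / 2 .. (l + real K) / 2}"
  have [measurable]: "D \<in> sets borel" "{z. cone_fun K a n p z \<noteq> 0 \<and> cone_fun K a n (p + l) z \<noteq> 0} \<in> sets borel"
    unfolding D_def by measurable
  have [measurable]: "Q \<in> sets borel" unfolding Q_def by (simp add: borel_prod[symmetric])
  have DQ: "D \<subseteq> Q"
  proof
    fix z assume z: "z \<in> D"
    obtain x r where xr: "z = (x, r)" by (cases z)
    have 1: "r > 0" "(0 \<le> x - r \<and> x - r \<le> real K) \<or> (0 \<le> x + r \<and> x + r \<le> real K)"
      using cone_fun_nonzero_cases[OF a, of 0 x r] z by (auto simp: D_def xr)
    have 2: "(l \<le> x - r \<and> x - r \<le> l + real K) \<or> (l \<le> x + r \<and> x + r \<le> l + real K)"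
      using cone_fun_nonzero_cases[OF a, of l x r] z by (auto simp: D_def xr)
    have "0 \<le> x - r \<and> x - r \<le> real K \<and> l \<le> x + r \<and> x + r \<le> l + real K"
      using 1 2 l by auto
    then show "z \<in> Q" by (auto simp: Q_def xr)
  qed
  have "(\<integral>\<^sup>+z. indicator {z. cone_fun K a n p z \<noteq> 0 \<and> cone_fun K a n (p + l) z \<noteq> 0} z \<partial>takenaka_control \<nu>)
    = ennreal (n powr (- \<nu>)) * (\<integral>\<^sup>+z. indicator {z. cone_fun K a n p z \<noteq> 0 \<and> cone_fun K a n (p + l) z \<noteq> 0} ((fst z + p) / n, snd z / n) \<partial>takenaka_control \<nu>)"
    by (rule nn_integral_takenaka_control_affine) (use n in auto)
  also have "(\<lambda>z. indicator {z. cone_fun K a n p z \<noteq> 0 \<and> cone_fun K a n (p + l) z \<noteq> 0} ((fst z + p) / n, snd z / n) :: ennreal) = indicator D"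
    using n by (intro ext) (simp add: indicator_def D_def cone_fun_affine)
  also have "(\<integral>\<^sup>+z. indicator D z \<partial>takenaka_control \<nu>)
      = (\<integral>\<^sup>+z. ennreal (snd z powr (\<nu> - 2)) * indicator D z * indicator (UNIV \<times> {0<..}) z \<partial>lborel)"
    by (rule nn_integral_takenaka_control) measurable
  also have "\<dots> \<le> (\<integral>\<^sup>+z. ennreal (((l - real K) / 2) powr (\<nu> - 2)) * indicator Q z \<partial>lborel)"
  proof (rule nn_integral_mono)
    fix z :: "real \<times> real"
    have "snd z powr (\<nu> - 2) \<le> ((l - real K) / 2) powr (\<nu> - 2)" if "z \<in> Q"
      using that l \<nu> by (intro powr_mono2') (auto simp: Q_def)
    then show "ennreal (snd z powr (\<nu> - 2)) * indicator D z * indicator (UNIV \<times> {0<..}) z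
        \<le> ennreal (((l - real K) / 2) powr (\<nu> - 2)) * indicator Q z"
      using DQ by (auto simp: indicator_def intro: ennreal_leI)
  qed
  also have "\<dots> = ennreal (((l - real K) / 2) powr (\<nu> - 2)) * emeasure lborel Q"
    by (simp add: nn_integral_cmult_indicator)
  also have "emeasure lborel Q = ennreal ((real K)\<^sup>2)"
  proof -
    have "emeasure lborel Q = emeasure (lborel \<Otimes>\<^sub>M lborel) Q" by (simp add: lborel_prod)
    also have "\<dots> = emeasure lborel {l / 2 .. l / 2 + real K} * emeasure lborel {(l - real K) / 2 .. (l + real K) / 2}"
      unfolding Q_def by (rule lborel.emeasure_pair_measure_Times) auto
    also have "\<dots> = ennreal (real K) * ennreal (real K)" by (simp add: field_simps)
    finally show ?thesis by (simp add: ennreal_mult power2_eq_square)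
  qed
  also have "ennreal (n powr (- \<nu>)) * (ennreal (((l - real K) / 2) powr (\<nu> - 2)) * ennreal ((real K)\<^sup>2))
     = ennreal (n powr (- \<nu>) * ((real K)\<^sup>2 * ((l - real K) / 2) powr (\<nu> - 2)))"
    by (simp add: ennreal_mult mult.commute)
  finally show ?thesis by (simp add: mult_left_mono)
qed

lemma nn_integral_cone_fun_scaling:
  assumes "n > 0"
  shows "(\<integral>\<^sup>+z. ennreal (\<bar>cone_fun K a n q z\<bar> powr \<alpha>) \<partial>takenaka_control \<nu>)
    = ennreal (n powr (- \<nu>)) * (\<integral>\<^sup>+z. ennreal (\<bar>cone_fun K a 1 0 z\<bar> powr \<alpha>) \<partial>takenaka_control \<nu>)"
proof -
  have "(\<integral>\<^sup>+z. ennreal (\<bar>cone_fun K a n q z\<bar> powr \<alpha>) \<partial>takenaka_control \<nu>)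
    = ennreal (n powr (- \<nu>)) * (\<integral>\<^sup>+z. ennreal (\<bar>cone_fun K a n q ((fst z + q) / n, snd z / n)\<bar> powr \<alpha>) \<partial>takenaka_control \<nu>)"
    by (rule nn_integral_takenaka_control_affine) (use assms in auto)
  then show ?thesis using assms by (simp add: cone_fun_affine)
qed

text \<open>
  Close to the boundary \<open>r = 0\<close> the cones with different integer vertices are disjoint, so inside
  the cone with vertex \<open>k0\<close> the function is the single coefficient \<open>a k0\<close> for small \<open>r\<close>.
\<close>

lemma nn_integral_cone_fun_pos:
  assumes k: "k0 \<le> K" "a k0 \<noteq> 0" and \<nu>: "\<nu> < 1"
  shows "(\<integral>\<^sup>+z. ennreal (\<bar>cone_fun K a 1 0 z\<bar> powr \<alpha>) \<partial>takenaka_control \<nu>) > 0"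
proof -
  define Q where "Q = {real k0 - 1/4 .. real k0 + 1/4} \<times> {1/4 .. (1/2::real)}"
  have [measurable]: "Q \<in> sets borel" unfolding Q_def by (simp add: borel_prod[symmetric])
  have val: "cone_fun K a 1 0 z = a k0" if z: "z \<in> Q" for z
  proof -
    obtain x r where xr: "z = (x, r)" by (cases z)
    have ind: "indicator (takenaka_cone (real k)) z = (if k = k0 then 1 else 0 :: real)" for k
    proof (cases "k = k0")
      case False
      then have "\<bar>real k - real k0\<bar> \<ge> 1" by (cases k k0 rule: linorder_cases) auto
      then show ?thesis using z False by (auto simp: Q_def xr takenaka_cone_def indicator_def abs_le_iff abs_if split: if_splits)
    qed (use z in \<open>auto simp: Q_def xr takenaka_cone_def indicator_def abs_le_iff\<close>)
    have "cone_fun K a 1 0 z = (\<Sum>k = 0..K. if k = k0 then a k else 0)"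
      unfolding cone_fun_def by (intro sum.cong refl) (simp add: ind)
    then show ?thesis using k by simp
  qed
  have Q: "emeasure lborel Q = ennreal (1/8)"
  proof -
    have "emeasure lborel Q = emeasure (lborel \<Otimes>\<^sub>M lborel) Q" by (simp add: lborel_prod)
    also have "\<dots> = emeasure lborel {real k0 - 1/4 .. real k0 + 1/4} * emeasure lborel {1/4 .. (1/2::real)}"
      unfolding Q_def by (rule lborel.emeasure_pair_measure_Times) auto
    also have "\<dots> = ennreal (1/2) * ennreal (1/4)" by simp
    also have "\<dots> = ennreal (1/8)" by (subst ennreal_mult[symmetric]) auto
    finally show ?thesis .
  qed
  have "0 < ennreal (\<bar>a k0\<bar> powr \<alpha>) * ennreal (1/8)" using k by (simp add: ennreal_mult[symmetric] del: ennreal_mult)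
  also have "\<dots> = (\<integral>\<^sup>+z. ennreal (\<bar>a k0\<bar> powr \<alpha>) * indicator Q z \<partial>lborel)"
    by (simp add: nn_integral_cmult_indicator Q)
  also have "\<dots> \<le> (\<integral>\<^sup>+z. ennreal (snd z powr (\<nu> - 2)) * ennreal (\<bar>cone_fun K a 1 0 z\<bar> powr \<alpha>) * indicator (UNIV \<times> {0<..}) z \<partial>lborel)"
  proof (rule nn_integral_mono)
    fix z :: "real \<times> real"
    show "ennreal (\<bar>a k0\<bar> powr \<alpha>) * indicator Q z \<le> ennreal (snd z powr (\<nu> - 2)) * ennreal (\<bar>cone_fun K a 1 0 z\<bar> powr \<alpha>) * indicator (UNIV \<times> {0<..}) z"
    proof (cases "z \<in> Q")
      case True
      then have s: "0 < snd z" "snd z \<le> 1" by (auto simp: Q_def)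
      then have "1 powr (\<nu> - 2) \<le> snd z powr (\<nu> - 2)" using \<nu> by (intro powr_mono2') auto
      then have "1 * \<bar>a k0\<bar> powr \<alpha> \<le> snd z powr (\<nu> - 2) * \<bar>a k0\<bar> powr \<alpha>" by (intro mult_right_mono) auto
      then have "ennreal (\<bar>a k0\<bar> powr \<alpha>) \<le> ennreal (snd z powr (\<nu> - 2)) * ennreal (\<bar>a k0\<bar> powr \<alpha>)"
        by (subst ennreal_mult[symmetric]) (auto intro: ennreal_leI)
      then show ?thesis using True s by (simp add: val indicator_def mem_Times_iff)
    qed simp
  qed
  also have "\<dots> = (\<integral>\<^sup>+z. ennreal (\<bar>cone_fun K a 1 0 z\<bar> powr \<alpha>) \<partial>takenaka_control \<nu>)"
    by (rule nn_integral_takenaka_control[symmetric]) measurable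
  finally show ?thesis .
qed

section \<open>Covariances and the mean square error of the variations\<close>

lemma abs_powr_square: "(\<bar>x\<bar> powr \<gamma>)\<^sup>2 = \<bar>x\<bar> powr (2 * \<gamma>)" for x \<gamma> :: real
  by (simp add: power2_eq_square powr_add[symmetric])

text \<open>
  The squared moment is a negative power of the scale, so on \<open>[\<kappa> / 2, \<kappa>]\<close> its derivative is bounded by
  the derivative at \<open>\<kappa> / 2\<close>.
\<close>

lemma stable_moment_sq_perturbation:
  assumes "-1 < \<beta>" "\<beta> < 0" "0 < \<alpha>" "0 < \<kappa>"
  obtains C where "C \<ge> 0" "\<And>\<eta>. 0 \<le> \<eta> \<Longrightarrow> \<eta> \<le> \<kappa> / 2 \<Longrightarrow>
    (stable_moment \<alpha> \<beta> (\<kappa> - \<eta>))\<^sup>2 \<le> (stable_moment \<alpha> \<beta> \<kappa>)\<^sup>2 + C * \<eta>"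
proof -
  define r where "r = (stable_moment \<alpha> \<beta> 1)\<^sup>2"
  define e where "e = 2 * \<beta> / \<alpha>"
  have e: "e < 0" using assms by (simp add: e_def divide_neg_pos)
  have sq: "(stable_moment \<alpha> \<beta> x)\<^sup>2 = r * x powr e" if "x > 0" for x
  proof -
    have "(x powr (\<beta> / \<alpha>))\<^sup>2 = x powr e"
      using that by (simp add: e_def power2_eq_square powr_add[symmetric])
    moreover have "stable_moment \<alpha> \<beta> x = stable_moment \<alpha> \<beta> 1 * x powr (\<beta> / \<alpha>)"
      by (simp add: stable_moment_def)
    ultimately show ?thesis by (simp only: r_def power_mult_distrib)
  qed
  define C where "C = r * (- e * (\<kappa> / 2) powr (e - 1))"
  show thesis
  proof
    show "C \<ge> 0" using e by (auto simp: C_def r_def mult_le_0_iff intro!: mult_nonneg_nonneg)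
    fix \<eta> assume \<eta>: "0 \<le> \<eta>" "\<eta> \<le> \<kappa> / 2"
    have "(\<kappa> - \<eta>) powr e \<le> \<kappa> powr e + (- e * (\<kappa> / 2) powr (e - 1)) * \<eta>"
    proof (cases "\<eta> = 0")
      case False
      then have lt: "\<kappa> - \<eta> < \<kappa>" using \<eta> by simp
      have "\<exists>z. z > \<kappa> - \<eta> \<and> z < \<kappa> \<and> \<kappa> powr e - (\<kappa> - \<eta>) powr e = (\<kappa> - (\<kappa> - \<eta>)) * (e * z powr (e - 1))"
        using \<eta> assms by (intro MVT2[OF lt]) (auto intro!: derivative_eq_intros)
      then obtain z where z: "z > \<kappa> - \<eta>" "\<kappa> powr e - (\<kappa> - \<eta>) powr e = \<eta> * (e * z powr (e - 1))"
        by auto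
      have "z powr (e - 1) \<le> (\<kappa> / 2) powr (e - 1)"
        using z \<eta> assms e by (intro powr_mono2') auto
      then have "- e * \<eta> * z powr (e - 1) \<le> - e * \<eta> * (\<kappa> / 2) powr (e - 1)"
        using e \<eta> by (intro mult_left_mono) (auto simp: mult_nonpos_nonneg)
      with z show ?thesis by (simp add: algebra_simps)
    qed simp
    then have "r * (\<kappa> - \<eta>) powr e \<le> r * (\<kappa> powr e + (- e * (\<kappa> / 2) powr (e - 1)) * \<eta>)"
      by (intro mult_left_mono) (simp_all add: r_def)
    then show "(stable_moment \<alpha> \<beta> (\<kappa> - \<eta>))\<^sup>2 \<le> (stable_moment \<alpha> \<beta> \<kappa>)\<^sup>2 + C * \<eta>"
      using \<eta> assms by (simp add: sq C_def algebra_simps)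
  qed
qed

text \<open>
  In the double sum of covariances each row is bounded by twice the sum of \<open>\<rho>\<close>, once for the indices on either
  side of the diagonal.
\<close>

lemma (in prob_space) average_square_error_le:
  fixes Y :: "nat \<Rightarrow> 'a \<Rightarrow> real" and \<rho> :: "nat \<Rightarrow> real"
  assumes [measurable]: "\<And>p. Y p \<in> borel_measurable M"
    and sq: "\<And>p. integrable M (\<lambda>\<omega>. (Y p \<omega>)\<^sup>2)"
    and mean: "\<And>p. expectation (Y p) = R"
    and cov: "\<And>p l. expectation (\<lambda>\<omega>. Y p \<omega> * Y (p + l) \<omega>) \<le> R\<^sup>2 + \<rho> l"
    and \<rho>: "summable \<rho>" "\<And>l. \<rho> l \<ge> 0"
  shows "integrable M (\<lambda>\<omega>. ((\<Sum>p = 0..k. Y p \<omega>) / real (Suc k) - R)\<^sup>2)"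
    and "expectation (\<lambda>\<omega>. ((\<Sum>p = 0..k. Y p \<omega>) / real (Suc k) - R)\<^sup>2) \<le> 2 * suminf \<rho> / real (Suc k)"
proof -
  have prod: "integrable M (\<lambda>\<omega>. Y p \<omega> * Y q \<omega>)" for p q
  proof (rule Bochner_Integration.integrable_bound)
    show "integrable M (\<lambda>\<omega>. (Y p \<omega>)\<^sup>2 + (Y q \<omega>)\<^sup>2)" by (intro Bochner_Integration.integrable_add sq)
    have "\<bar>u * v\<bar> \<le> u\<^sup>2 + v\<^sup>2" for u v :: real
      using sum_squares_bound[of "\<bar>u\<bar>" "\<bar>v\<bar>"] abs_ge_zero[of "u * v"]
      unfolding abs_mult power2_abs mult.assoc by linarith
    then show "AE \<omega> in M. norm (Y p \<omega> * Y q \<omega>) \<le> norm ((Y p \<omega>)\<^sup>2 + (Y q \<omega>)\<^sup>2)" by simp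
  qed measurable
  have int: "integrable M (Y p)" for p by (rule square_integrable_imp_integrable) (auto intro: sq)
  have prod': "integrable M (\<lambda>\<omega>. (Y p \<omega> - R) * (Y q \<omega> - R))" for p q
    using prod int by (simp add: algebra_simps)
  have sq_eq: "((\<Sum>p = 0..k. Y p \<omega>) / real (Suc k) - R)\<^sup>2
      = (\<Sum>p = 0..k. \<Sum>q = 0..k. (Y p \<omega> - R) * (Y q \<omega> - R)) / (real (Suc k))\<^sup>2" for \<omega>
  proof -
    have "(\<Sum>p = 0..k. Y p \<omega>) / real (Suc k) - R = (\<Sum>p = 0..k. Y p \<omega> - R) / real (Suc k)"
      by (simp add: sum_subtractf field_simps)
    then show ?thesis by (simp add: power_divide power2_eq_square sum_product)
  qed
  show "integrable M (\<lambda>\<omega>. ((\<Sum>p = 0..k. Y p \<omega>) / real (Suc k) - R)\<^sup>2)"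
    unfolding sq_eq by (intro integrable_divide_zero Bochner_Integration.integrable_sum prod')
  have le: "expectation (\<lambda>\<omega>. (Y p \<omega> - R) * (Y q \<omega> - R)) \<le> \<rho> (if p \<le> q then q - p else p - q)" for p q
  proof -
    have "expectation (\<lambda>\<omega>. (Y p \<omega> - R) * (Y q \<omega> - R)) = expectation (\<lambda>\<omega>. Y p \<omega> * Y q \<omega> - R * Y p \<omega> - R * Y q \<omega> + R\<^sup>2)"
      by (simp add: algebra_simps power2_eq_square)
    also have "\<dots> = expectation (\<lambda>\<omega>. Y p \<omega> * Y q \<omega>) - R\<^sup>2"
      using prod int by (simp add: mean prob_space power2_eq_square)
    also have "\<dots> \<le> \<rho> (if p \<le> q then q - p else p - q)"
      using cov[of p "q - p"] cov[of q "p - q"] by (auto simp: mult.commute)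
    finally show ?thesis .
  qed
  have row: "(\<Sum>q = 0..k. \<rho> (if p \<le> q then q - p else p - q)) \<le> 2 * suminf \<rho>" for p
  proof -
    have "(\<Sum>q = 0..k. \<rho> (if p \<le> q then q - p else p - q))
      \<le> (\<Sum>q\<in>{p..p + k}. \<rho> (q - p)) + (\<Sum>q\<in>{..<p}. \<rho> (p - q))"
    proof -
      have "(\<Sum>q = 0..k. \<rho> (if p \<le> q then q - p else p - q)) \<le> (\<Sum>q\<in>{p..p + k} \<union> {..<p}. \<rho> (if p \<le> q then q - p else p - q))"
        by (rule sum_mono2) (auto simp: \<rho>)
      also have "\<dots> = (\<Sum>q\<in>{p..p + k}. \<rho> (if p \<le> q then q - p else p - q)) + (\<Sum>q\<in>{..<p}. \<rho> (if p \<le> q then q - p else p - q))"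
        by (rule sum.union_disjoint) auto
      finally show ?thesis by simp
    qed
    also have "(\<Sum>q\<in>{p..p + k}. \<rho> (q - p)) = (\<Sum>l\<in>{..k}. \<rho> l)"
      by (rule sum.reindex_bij_witness[of _ "\<lambda>l. l + p" "\<lambda>q. q - p"]) auto
    also have "\<dots> \<le> suminf \<rho>" using \<rho> by (intro sum_le_suminf) auto
    also have "(\<Sum>q\<in>{..<p}. \<rho> (p - q)) = (\<Sum>l\<in>{1..p}. \<rho> l)"
      by (rule sum.reindex_bij_witness[of _ "\<lambda>l. p - l" "\<lambda>q. p - q"]) auto
    also have "\<dots> \<le> suminf \<rho>" using \<rho> by (intro sum_le_suminf) auto
    finally show ?thesis by simp
  qed
  have "expectation (\<lambda>\<omega>. ((\<Sum>p = 0..k. Y p \<omega>) / real (Suc k) - R)\<^sup>2)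
      = (\<Sum>p = 0..k. \<Sum>q = 0..k. expectation (\<lambda>\<omega>. (Y p \<omega> - R) * (Y q \<omega> - R))) / (real (Suc k))\<^sup>2"
    unfolding sq_eq using prod' by (simp add: Bochner_Integration.integral_sum)
  also have "\<dots> \<le> (\<Sum>p = 0..k. 2 * suminf \<rho>) / (real (Suc k))\<^sup>2"
    by (intro divide_right_mono sum_mono order_trans[OF sum_mono[OF le] row]) auto
  also have "\<dots> = 2 * suminf \<rho> / real (Suc k)" by (simp add: power2_eq_square)
  finally show "expectation (\<lambda>\<omega>. ((\<Sum>p = 0..k. Y p \<omega>) / real (Suc k) - R)\<^sup>2) \<le> 2 * suminf \<rho> / real (Suc k)" .
qed

locale takenaka_increments = stable_random_measure P "takenaka_control \<nu>" \<alpha> M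
  for P :: "'w measure" and \<nu> \<alpha> :: real and M +
  fixes X :: "real \<Rightarrow> 'w \<Rightarrow> real" and K :: nat and a :: "nat \<Rightarrow> real"
  assumes X: "\<And>t. has_stochastic_integral P (takenaka_control \<nu>) \<alpha> M (indicator (takenaka_set t)) (X t)"
    and \<nu>: "0 < \<nu>" "\<nu> < 1"
    and sum_a: "(\<Sum>k = 0..K. a k) = 0" and a_nonzero: "\<exists>k\<le>K. a k \<noteq> 0"
begin

abbreviation "m \<equiv> takenaka_control \<nu>"
abbreviation "F n p \<equiv> cone_fun K a (real n) (real p)"

text \<open>
  The scale parameter shared by all normalised increments.
\<close>

definition "\<kappa> = (LINT z|m. \<bar>cone_fun K a 1 0 z\<bar> powr \<alpha>)"

lemma X_measurable [measurable]: "X t \<in> borel_measurable P"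
  using X[of t] by (simp add: has_stochastic_integral_def)

lemma increment_measurable [measurable]: "increment K a X p n \<in> borel_measurable P"
  unfolding increment_def by measurable

text \<open>
  The two increments together are a linear combination of values of \<open>X\<close> indexed by a disjoint union; the sign from
  \<open>takenaka_set_sum_eq_cone_fun\<close> is the same for both and disappears in the absolute value.
\<close>

lemma increment_pair_cf:
  shows "integrable m (\<lambda>w. \<bar>y * F n p w + z * F n p' w\<bar> powr \<alpha>)"
    and "(CLINT \<omega>|P. iexp (y * increment K a X p n \<omega> + z * increment K a X p' n \<omega>))
      = complex_of_real (exp (- (LINT w|m. \<bar>y * F n p w + z * F n p' w\<bar> powr \<alpha>)))"
proof -
  define J where "J = {0..K} <+> {0..K}"
  define T where "T = case_sum (\<lambda>k. (real k + real p) / real n) (\<lambda>k. (real k + real p') / real n)"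
  define c where "c = case_sum (\<lambda>k. y * a k) (\<lambda>k. z * a k)"
  have J: "finite J" by (simp add: J_def)
  have sumJ: "(\<Sum>j\<in>J. c j * h (T j)) = y * (\<Sum>k = 0..K. a k * h ((real k + real p) / real n))
      + z * (\<Sum>k = 0..K. a k * h ((real k + real p') / real n))" for h
    unfolding J_def by (subst sum.Plus) (auto simp: T_def c_def sum_distrib_left mult.assoc)
  have fun_eq: "\<bar>\<Sum>j\<in>J. c j * indicator (takenaka_set (T j)) w\<bar> = \<bar>y * F n p w + z * F n p' w\<bar>" for w
  proof -
    have "(\<Sum>j\<in>J. c j * indicator (takenaka_set (T j)) w)
      = (1 - 2 * indicator (takenaka_cone 0) w) * (y * F n p w + z * F n p' w)"
      unfolding sumJ[of "\<lambda>t. indicator (takenaka_set t) w"] takenaka_set_sum_eq_cone_fun[OF sum_a]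
      by (simp add: algebra_simps)
    then show ?thesis by (auto simp: abs_mult indicator_def)
  qed
  show "integrable m (\<lambda>w. \<bar>y * F n p w + z * F n p' w\<bar> powr \<alpha>)"
    unfolding fun_eq[symmetric]
    by (rule cf_integrals_of_indicators(1)[OF J, where Y="\<lambda>j. X (T j)"]) (rule X takenaka_set_subset_space)+
  have "(CLINT \<omega>|P. iexp (\<Sum>j\<in>J. c j * X (T j) \<omega>))
      = complex_of_real (exp (- (LINT w|m. \<bar>\<Sum>j\<in>J. c j * indicator (takenaka_set (T j)) w\<bar> powr \<alpha>)))"
    by (rule cf_integrals_of_indicators(2)[OF J]) (rule X takenaka_set_subset_space)+
  then show "(CLINT \<omega>|P. iexp (y * increment K a X p n \<omega> + z * increment K a X p' n \<omega>))
      = complex_of_real (exp (- (LINT w|m. \<bar>y * F n p w + z * F n p' w\<bar> powr \<alpha>)))"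
    unfolding fun_eq sumJ[of "\<lambda>t. X t \<omega>" for \<omega>] increment_def .
qed

lemma F_integrable: "integrable m (\<lambda>w. \<bar>F n p w\<bar> powr \<alpha>)"
  using increment_pair_cf(1)[of 1 n p 0 0] by simp

lemma F_integral:
  assumes "n > 0"
  shows "(LINT w|m. \<bar>F n p w\<bar> powr \<alpha>) = real n powr (- \<nu>) * \<kappa>"
proof -
  have "ennreal (LINT w|m. \<bar>F n p w\<bar> powr \<alpha>) = (\<integral>\<^sup>+w. ennreal (\<bar>F n p w\<bar> powr \<alpha>) \<partial>m)"
    by (rule nn_integral_eq_integral[symmetric]) (auto intro: F_integrable)
  also have "\<dots> = ennreal (real n powr (- \<nu>)) * (\<integral>\<^sup>+w. ennreal (\<bar>F 1 0 w\<bar> powr \<alpha>) \<partial>m)"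
    using assms by (subst nn_integral_cone_fun_scaling) auto
  also have "(\<integral>\<^sup>+w. ennreal (\<bar>F 1 0 w\<bar> powr \<alpha>) \<partial>m) = ennreal \<kappa>"
    using F_integrable[of 1 0] by (subst nn_integral_eq_integral) (auto simp: \<kappa>_def)
  finally show ?thesis
    by (simp add: ennreal_mult[symmetric] \<kappa>_def Bochner_Integration.integral_nonneg)
qed

lemma \<kappa>_pos: "\<kappa> > 0"
proof -
  obtain k where "k \<le> K" "a k \<noteq> 0" using a_nonzero by blast
  then have "0 < (\<integral>\<^sup>+w. ennreal (\<bar>F 1 0 w\<bar> powr \<alpha>) \<partial>m)" using nn_integral_cone_fun_pos \<nu> by auto
  also have "(\<integral>\<^sup>+w. ennreal (\<bar>F 1 0 w\<bar> powr \<alpha>) \<partial>m) = ennreal \<kappa>"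
    using F_integrable[of 1 0] by (subst nn_integral_eq_integral) (auto simp: \<kappa>_def)
  finally show ?thesis by simp
qed

definition "scaled_increment n p \<omega> = real n powr (\<nu> / \<alpha>) * increment K a X p n \<omega>"

lemma scaled_increment_measurable [measurable]: "scaled_increment n p \<in> borel_measurable P"
  unfolding scaled_increment_def by measurable

lemma scaled_increment_pair_cf:
  assumes "n > 0"
  shows "(CLINT \<omega>|P. iexp (y * scaled_increment n p \<omega> + z * scaled_increment n p' \<omega>))
      = complex_of_real (exp (- (real n powr \<nu> * (LINT w|m. \<bar>y * F n p w + z * F n p' w\<bar> powr \<alpha>))))"
proof -
  define s where "s = real n powr (\<nu> / \<alpha>)"
  have s: "s > 0" "s powr \<alpha> = real n powr \<nu>" using assms \<alpha>_pos by (auto simp: s_def powr_powr)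
  have "\<bar>(y * s) * F n p w + (z * s) * F n p' w\<bar> powr \<alpha> = real n powr \<nu> * \<bar>y * F n p w + z * F n p' w\<bar> powr \<alpha>" for w
  proof -
    have "(y * s) * F n p w + (z * s) * F n p' w = s * (y * F n p w + z * F n p' w)" by (simp add: algebra_simps)
    then show ?thesis using s by (simp add: abs_mult powr_mult)
  qed
  then show ?thesis
    using increment_pair_cf(2)[of "y * s" p n "z * s" p'] by (simp add: scaled_increment_def s_def[symmetric] mult.assoc)
qed

lemma scaled_increment_cf:
  assumes "n > 0"
  shows "(CLINT \<omega>|P. iexp (y * scaled_increment n p \<omega>)) = complex_of_real (exp (- (\<kappa> * \<bar>y\<bar> powr \<alpha>)))"
proof -
  have "real n powr \<nu> * (LINT w|m. \<bar>y * F n p w\<bar> powr \<alpha>) = (real n powr \<nu> * real n powr (- \<nu>)) * \<kappa> * \<bar>y\<bar> powr \<alpha>"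
    by (simp add: abs_mult powr_mult F_integral[OF assms])
  then have "real n powr \<nu> * (LINT w|m. \<bar>y * F n p w\<bar> powr \<alpha>) = \<kappa> * \<bar>y\<bar> powr \<alpha>"
    using assms by (simp flip: powr_add)
  then show ?thesis using scaled_increment_pair_cf[OF assms, of y p 0 0] by simp
qed

text \<open>
  Where at most one of the two functions is nonzero, \<open>\<bar>y f + z g\<bar> powr \<alpha>\<close> is the sum of the separate powers;
  on the overlap it is only bounded below by \<open>0\<close>, which costs at most the maximal value of the separate
  powers times the measure of the overlap.
\<close>

lemma scaled_increment_pair_cf_le:
  assumes n: "n > 0" and l: "l > K"
  shows "exp (- (real n powr \<nu> * (LINT w|m. \<bar>y * F n p w + z * F n (p + l) w\<bar> powr \<alpha>)))
    \<le> exp (- ((\<kappa> - (\<Sum>k = 0..K. \<bar>a k\<bar>) powr \<alpha> * (real K)\<^sup>2 * ((real l - real K) / 2) powr (\<nu> - 2))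
        * (\<bar>y\<bar> powr \<alpha> + \<bar>z\<bar> powr \<alpha>)))"
proof -
  define A where "A = (\<Sum>k = 0..K. \<bar>a k\<bar>) powr \<alpha>"
  define D where "D = {w. F n p w \<noteq> 0 \<and> F n (p + l) w \<noteq> 0}"
  define \<delta> where "\<delta> = real n powr (- \<nu>) * ((real K)\<^sup>2 * ((real l - real K) / 2) powr (\<nu> - 2))"
  define t where "t = \<bar>y\<bar> powr \<alpha> + \<bar>z\<bar> powr \<alpha>"
  have D_borel: "D \<in> sets borel" unfolding D_def by measurable
  have Dm: "(indicator D :: _ \<Rightarrow> real) \<in> borel_measurable m"
    using D_borel by (intro borel_measurable_takenaka_control) auto
  have D_le: "(\<integral>\<^sup>+w. ennreal (indicator D w) \<partial>m) \<le> ennreal \<delta>"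
    using nn_integral_takenaka_overlap[OF sum_a, of "real l" \<nu> "real n" "real p"] n l \<nu>
    by (simp add: D_def \<delta>_def ennreal_indicator add.commute)
  have D_int: "integrable m (indicator D :: _ \<Rightarrow> real)"
    using D_le by (intro integrableI_bounded Dm) (auto intro: le_less_trans)
  have D_meas: "(LINT w|m. indicator D w) \<le> \<delta>"
  proof -
    have "ennreal (LINT w|m. indicator D w) \<le> ennreal \<delta>"
      using D_le by (subst (asm) nn_integral_eq_integral[OF D_int]) auto
    moreover have "\<delta> \<ge> 0" by (simp add: \<delta>_def)
    ultimately show ?thesis by simp
  qed
  have pt: "\<bar>y\<bar> powr \<alpha> * \<bar>F n p w\<bar> powr \<alpha> + \<bar>z\<bar> powr \<alpha> * \<bar>F n (p + l) w\<bar> powr \<alpha> - t * A * indicator D w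
      \<le> \<bar>y * F n p w + z * F n (p + l) w\<bar> powr \<alpha>" for w
  proof (cases "w \<in> D")
    case True
    have "\<bar>cone_fun K a n q w\<bar> powr \<alpha> \<le> A" for q
      unfolding A_def using \<alpha>_pos by (intro powr_mono2 abs_cone_fun_le) auto
    then have "\<bar>y\<bar> powr \<alpha> * \<bar>F n p w\<bar> powr \<alpha> + \<bar>z\<bar> powr \<alpha> * \<bar>F n (p + l) w\<bar> powr \<alpha>
        \<le> \<bar>y\<bar> powr \<alpha> * A + \<bar>z\<bar> powr \<alpha> * A"
      by (intro add_mono mult_left_mono) auto
    then have "\<bar>y\<bar> powr \<alpha> * \<bar>F n p w\<bar> powr \<alpha> + \<bar>z\<bar> powr \<alpha> * \<bar>F n (p + l) w\<bar> powr \<alpha> - t * A * indicator D w \<le> 0"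
      using True by (simp add: t_def algebra_simps)
    then show ?thesis by (rule order_trans) simp
  next
    case False
    then have "F n p w = 0 \<or> F n (p + l) w = 0" by (auto simp: D_def)
    then show ?thesis using False \<alpha>_pos by (auto simp: abs_mult powr_mult)
  qed
  have i1: "integrable m (\<lambda>w. \<bar>y\<bar> powr \<alpha> * \<bar>F n p w\<bar> powr \<alpha>)"
    by (intro integrable_mult_right F_integrable)
  have i2: "integrable m (\<lambda>w. \<bar>z\<bar> powr \<alpha> * \<bar>F n (p + l) w\<bar> powr \<alpha>)"
    by (intro integrable_mult_right F_integrable)
  have i3: "integrable m (\<lambda>w. t * A * indicator D w)"
    by (intro integrable_mult_right D_int)
  have "t * (real n powr (- \<nu>) * \<kappa>) - t * A * \<delta> \<le> t * (real n powr (- \<nu>) * \<kappa>) - t * A * (LINT w|m. indicator D w)"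
    using D_meas by (intro diff_left_mono mult_left_mono) (auto simp: t_def A_def)
  also have "\<dots> = (LINT w|m. \<bar>y\<bar> powr \<alpha> * \<bar>F n p w\<bar> powr \<alpha> + \<bar>z\<bar> powr \<alpha> * \<bar>F n (p + l) w\<bar> powr \<alpha> - t * A * indicator D w)"
    unfolding Bochner_Integration.integral_diff[OF Bochner_Integration.integrable_add[OF i1 i2] i3]
      Bochner_Integration.integral_add[OF i1 i2] integral_mult_right_zero F_integral[OF n]
    by (simp add: t_def algebra_simps)
  also have "\<dots> \<le> (LINT w|m. \<bar>y * F n p w + z * F n (p + l) w\<bar> powr \<alpha>)"
    by (rule integral_mono[OF Bochner_Integration.integrable_diff[OF Bochner_Integration.integrable_add[OF i1 i2] i3]
        increment_pair_cf(1) pt])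
  finally have "real n powr \<nu> * (t * (real n powr (- \<nu>) * \<kappa>) - t * A * \<delta>)
      \<le> real n powr \<nu> * (LINT w|m. \<bar>y * F n p w + z * F n (p + l) w\<bar> powr \<alpha>)"
    by (intro mult_left_mono) auto
  moreover have "real n powr \<nu> * (t * (real n powr (- \<nu>) * \<kappa>) - t * A * \<delta>)
      = (real n powr \<nu> * real n powr (- \<nu>)) * ((\<kappa> - A * (real K)\<^sup>2 * ((real l - real K) / 2) powr (\<nu> - 2)) * t)"
    by (simp add: \<delta>_def algebra_simps)
  moreover have "real n powr \<nu> * real n powr (- \<nu>) = 1" using n by (simp flip: powr_add)
  ultimately show ?thesis by (simp add: A_def t_def)
qed

lemma abs_increment_powr_moment:
  assumes "-1 < \<gamma>" "\<gamma> < 0" "n > 0"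
  shows "integrable P (\<lambda>\<omega>. \<bar>scaled_increment n p \<omega>\<bar> powr \<gamma>)"
    and "expectation (\<lambda>\<omega>. \<bar>scaled_increment n p \<omega>\<bar> powr \<gamma>) = stable_moment \<alpha> \<gamma> \<kappa>"
proof -
  have nn: "(\<integral>\<^sup>+\<omega>. ennreal (\<bar>scaled_increment n p \<omega>\<bar> powr \<gamma>) \<partial>P) = ennreal (stable_moment \<alpha> \<gamma> \<kappa>)"
    using assms \<alpha>_pos \<kappa>_pos scaled_increment_cf by (intro stable_abs_moment) auto
  then show int: "integrable P (\<lambda>\<omega>. \<bar>scaled_increment n p \<omega>\<bar> powr \<gamma>)"
    by (intro integrableI_bounded) auto
  have "ennreal (expectation (\<lambda>\<omega>. \<bar>scaled_increment n p \<omega>\<bar> powr \<gamma>)) = ennreal (stable_moment \<alpha> \<gamma> \<kappa>)"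
    using nn by (subst (asm) nn_integral_eq_integral[OF int]) auto
  then show "expectation (\<lambda>\<omega>. \<bar>scaled_increment n p \<omega>\<bar> powr \<gamma>) = stable_moment \<alpha> \<gamma> \<kappa>"
    using stable_moment_pos[OF assms(1,2) \<alpha>_pos \<kappa>_pos]
    by (subst (asm) ennreal_inj) (auto intro!: Bochner_Integration.integral_nonneg)
qed

text \<open>
  For large lags the joint characteristic function is compared with that of two independent
  variables of slightly smaller scale \<open>\<kappa> - \<eta> l\<close>. For the finitely many remaining lags the
  product is bounded by the mean of the squares, that is, by moments of order \<open>2 * \<gamma> > -1\<close>.
\<close>

lemma abs_increment_powr_product_le:
  assumes "-1/2 < \<gamma>" "\<gamma> < 0"
  obtains \<rho> :: "nat \<Rightarrow> real" where "summable \<rho>" "\<And>l. \<rho> l \<ge> 0"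
    "\<And>n p l. n > 0 \<Longrightarrow> expectation (\<lambda>\<omega>. \<bar>scaled_increment n p \<omega>\<bar> powr \<gamma> * \<bar>scaled_increment n (p + l) \<omega>\<bar> powr \<gamma>)
      \<le> (stable_moment \<alpha> \<gamma> \<kappa>)\<^sup>2 + \<rho> l"
proof -
  obtain C where C: "C \<ge> 0" "\<And>\<eta>. 0 \<le> \<eta> \<Longrightarrow> \<eta> \<le> \<kappa> / 2 \<Longrightarrow>
    (stable_moment \<alpha> \<gamma> (\<kappa> - \<eta>))\<^sup>2 \<le> (stable_moment \<alpha> \<gamma> \<kappa>)\<^sup>2 + C * \<eta>"
    using stable_moment_sq_perturbation[of \<gamma> \<alpha> \<kappa>] assms \<alpha>_pos \<kappa>_pos by auto
  define \<eta> where "\<eta> = (\<lambda>l. (\<Sum>k = 0..K. \<bar>a k\<bar>) powr \<alpha> * (real K)\<^sup>2 * ((real l - real K) / 2) powr (\<nu> - 2))"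
  have \<eta>0: "\<eta> l \<ge> 0" for l by (simp add: \<eta>_def)
  have \<eta>: "summable \<eta>"
  proof -
    have "summable (\<lambda>l. (1/2) powr (\<nu> - 2) * real l powr (\<nu> - 2))"
      using \<nu> by (intro summable_mult) (simp add: summable_real_powr_iff)
    then have "summable (\<lambda>l. ((real (l + K) - real K) / 2) powr (\<nu> - 2))"
      by (simp add: powr_divide)
    then have "summable (\<lambda>l. ((real l - real K) / 2) powr (\<nu> - 2))"
      by (subst (asm) summable_iff_shift)
    then show ?thesis unfolding \<eta>_def by (rule summable_mult)
  qed
  have "\<forall>\<^sub>F l in sequentially. \<eta> l < \<kappa> / 2"
    using summable_LIMSEQ_zero[OF \<eta>] \<kappa>_pos by (intro order_tendstoD(2)) auto
  then obtain l0 where l0: "\<And>l. l \<ge> l0 \<Longrightarrow> \<eta> l < \<kappa> / 2" by (auto simp: eventually_sequentially)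
  \<comment> \<open>beyond \<open>l1\<close> the overlap estimate applies and the loss of scale is at most one half\<close>
  define l1 where "l1 = max l0 (Suc K)"
  define R2 where "R2 = stable_moment \<alpha> (2 * \<gamma>) \<kappa>"
  have R2: "R2 > 0" unfolding R2_def using assms \<alpha>_pos \<kappa>_pos by (intro stable_moment_pos) auto
  define \<rho> where "\<rho> = (\<lambda>l. if l < l1 then R2 else C * \<eta> l)"
  show thesis
  proof
    have "summable (\<lambda>l. C * \<eta> l)" by (intro summable_mult \<eta>)
    moreover have "\<forall>\<^sub>F l in sequentially. \<rho> l = C * \<eta> l"
      using eventually_ge_at_top[of l1] by eventually_elim (simp add: \<rho>_def)
    ultimately show "summable \<rho>" by (subst summable_cong)
    show "\<rho> l \<ge> 0" for l using R2 C \<eta>0 by (simp add: \<rho>_def)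
    fix n p l :: nat assume n: "n > 0"
    show "expectation (\<lambda>\<omega>. \<bar>scaled_increment n p \<omega>\<bar> powr \<gamma> * \<bar>scaled_increment n (p + l) \<omega>\<bar> powr \<gamma>) \<le> (stable_moment \<alpha> \<gamma> \<kappa>)\<^sup>2 + \<rho> l"
    proof (cases "l < l1")
      case True
      have m: "integrable P (\<lambda>\<omega>. \<bar>scaled_increment n q \<omega>\<bar> powr (2 * \<gamma>))"
        "expectation (\<lambda>\<omega>. \<bar>scaled_increment n q \<omega>\<bar> powr (2 * \<gamma>)) = R2" for q
        using abs_increment_powr_moment[of "2 * \<gamma>" n q] assms n by (auto simp: R2_def)
      have "expectation (\<lambda>\<omega>. \<bar>scaled_increment n p \<omega>\<bar> powr \<gamma> * \<bar>scaled_increment n (p + l) \<omega>\<bar> powr \<gamma>)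
        \<le> expectation (\<lambda>\<omega>. (\<bar>scaled_increment n p \<omega>\<bar> powr (2 * \<gamma>) + \<bar>scaled_increment n (p + l) \<omega>\<bar> powr (2 * \<gamma>)) / 2)"
      proof (rule Bochner_Integration.integral_mono')
        show "integrable P (\<lambda>\<omega>. (\<bar>scaled_increment n p \<omega>\<bar> powr (2 * \<gamma>) + \<bar>scaled_increment n (p + l) \<omega>\<bar> powr (2 * \<gamma>)) / 2)"
          by (intro integrable_divide_zero Bochner_Integration.integrable_add m)
        fix \<omega>
        show "\<bar>scaled_increment n p \<omega>\<bar> powr \<gamma> * \<bar>scaled_increment n (p + l) \<omega>\<bar> powr \<gamma> \<le> (\<bar>scaled_increment n p \<omega>\<bar> powr (2 * \<gamma>) + \<bar>scaled_increment n (p + l) \<omega>\<bar> powr (2 * \<gamma>)) / 2"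
          using sum_squares_bound[of "\<bar>scaled_increment n p \<omega>\<bar> powr \<gamma>" "\<bar>scaled_increment n (p + l) \<omega>\<bar> powr \<gamma>"]
          unfolding abs_powr_square by simp
      qed simp
      also have "\<dots> = R2" using m by simp
      finally show ?thesis using True by (simp add: \<rho>_def add_increasing)
    next
      case False
      then have l: "l \<ge> l0" "l > K" by (auto simp: l1_def)
      define \<kappa>' where "\<kappa>' = \<kappa> - \<eta> l"
      have \<kappa>': "\<kappa>' > 0" using l0[OF l(1)] \<kappa>_pos by (simp add: \<kappa>'_def)
      have "(\<integral>\<^sup>+\<omega>. ennreal (\<bar>scaled_increment n p \<omega>\<bar> powr \<gamma> * \<bar>scaled_increment n (p + l) \<omega>\<bar> powr \<gamma>) \<partial>P) \<le> ennreal ((stable_moment \<alpha> \<gamma> \<kappa>')\<^sup>2)"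
      proof (rule stable_abs_moment_product_le[OF _ _ _ assms(2) \<alpha>_pos \<kappa>' scaled_increment_pair_cf[OF n]])
        show "exp (- (real n powr \<nu> * (LINT w|m. \<bar>y * F n p w + z * F n (p + l) w\<bar> powr \<alpha>)))
            \<le> exp (- (\<kappa>' * (\<bar>y\<bar> powr \<alpha> + \<bar>z\<bar> powr \<alpha>)))" for y z
          unfolding \<kappa>'_def \<eta>_def by (rule scaled_increment_pair_cf_le[OF n l(2)])
      qed (use assms in auto)
      then have "expectation (\<lambda>\<omega>. \<bar>scaled_increment n p \<omega>\<bar> powr \<gamma> * \<bar>scaled_increment n (p + l) \<omega>\<bar> powr \<gamma>) \<le> (stable_moment \<alpha> \<gamma> \<kappa>')\<^sup>2"
        by (rule integral_real_bounded[rotated]) simp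
      also have "\<dots> \<le> (stable_moment \<alpha> \<gamma> \<kappa>)\<^sup>2 + C * \<eta> l"
        unfolding \<kappa>'_def using l0[OF l(1)] \<eta>0 by (intro C) auto
      finally show ?thesis using False by (simp add: \<rho>_def)
    qed
  qed
qed

lemma scaled_variation_eq_average:
  assumes "n \<ge> K"
  shows "scaled_variation K a X (\<nu> / \<alpha>) \<gamma> n \<omega> = (\<Sum>p = 0..n - K. \<bar>scaled_increment n p \<omega>\<bar> powr \<gamma>) / real (Suc (n - K))"
proof -
  have "real n powr (\<gamma> * (\<nu> / \<alpha>)) * \<bar>increment K a X p n \<omega>\<bar> powr \<gamma> = \<bar>scaled_increment n p \<omega>\<bar> powr \<gamma>" for p
    by (simp add: scaled_increment_def abs_mult powr_mult powr_powr mult.commute)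
  then have "(\<Sum>p = 0..n - K. \<bar>scaled_increment n p \<omega>\<bar> powr \<gamma>)
      = real n powr (\<gamma> * (\<nu> / \<alpha>)) * (\<Sum>p = 0..n - K. \<bar>increment K a X p n \<omega>\<bar> powr \<gamma>)"
    by (simp only: sum_distrib_left)
  moreover have "real (Suc (n - K)) = real n - real K + 1" using assms by (simp add: of_nat_diff)
  ultimately show ?thesis
    unfolding scaled_variation_def variation_def by (simp only: times_divide_eq_right mult_1 times_divide_eq_left)
qed

lemma scaled_variation_measurable [measurable]: "scaled_variation K a X H \<gamma> n \<in> borel_measurable P"
proof -
  have "(\<lambda>\<omega>. scaled_variation K a X H \<gamma> n \<omega>) \<in> borel_measurable P"
    unfolding scaled_variation_def variation_def by measurable
  then show ?thesis by simp
qed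

text \<open>
  The average is over \<open>n - K + 1\<close> terms, and \<open>n \<le> K * (n - K + 1)\<close> for \<open>n \<ge> K \<ge> 1\<close>.
\<close>

lemma scaled_variation_mean_square:
  assumes "-1/2 < \<gamma>" "\<gamma> < 0" "K \<ge> 1"
  obtains B where "B \<ge> 0"
    "\<And>n. n \<ge> K \<Longrightarrow> integrable P (\<lambda>\<omega>. (scaled_variation K a X (\<nu> / \<alpha>) \<gamma> n \<omega> - stable_moment \<alpha> \<gamma> \<kappa>)\<^sup>2)"
    "\<And>n. n \<ge> K \<Longrightarrow> expectation (\<lambda>\<omega>. (scaled_variation K a X (\<nu> / \<alpha>) \<gamma> n \<omega> - stable_moment \<alpha> \<gamma> \<kappa>)\<^sup>2) \<le> B / real n"
proof -
  obtain \<rho> where \<rho>: "summable \<rho>" "\<And>l. \<rho> l \<ge> 0"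
    "\<And>n p l. n > 0 \<Longrightarrow> expectation (\<lambda>\<omega>. \<bar>scaled_increment n p \<omega>\<bar> powr \<gamma> * \<bar>scaled_increment n (p + l) \<omega>\<bar> powr \<gamma>)
      \<le> (stable_moment \<alpha> \<gamma> \<kappa>)\<^sup>2 + \<rho> l"
    using abs_increment_powr_product_le[OF assms(1,2)] by blast
  have S: "suminf \<rho> \<ge> 0" using \<rho> by (intro suminf_nonneg) auto
  show thesis
  proof
    show "2 * suminf \<rho> * real K \<ge> 0" using S by simp
    fix n assume n: "n \<ge> K"
    then have n0: "n > 0" using assms by simp
    have sq: "integrable P (\<lambda>\<omega>. (\<bar>scaled_increment n p \<omega>\<bar> powr \<gamma>)\<^sup>2)" for p
      unfolding abs_powr_square using assms n0 by (intro abs_increment_powr_moment) auto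
    have mean: "expectation (\<lambda>\<omega>. \<bar>scaled_increment n p \<omega>\<bar> powr \<gamma>) = stable_moment \<alpha> \<gamma> \<kappa>" for p
      using assms n0 by (intro abs_increment_powr_moment) auto
    note avg = average_square_error_le[where Y="\<lambda>p \<omega>. \<bar>scaled_increment n p \<omega>\<bar> powr \<gamma>" and k="n - K", OF _ sq mean \<rho>(3)[OF n0] \<rho>(1,2)]
    show "integrable P (\<lambda>\<omega>. (scaled_variation K a X (\<nu> / \<alpha>) \<gamma> n \<omega> - stable_moment \<alpha> \<gamma> \<kappa>)\<^sup>2)"
      unfolding scaled_variation_eq_average[OF n] by (rule avg(1)) measurable
    have "expectation (\<lambda>\<omega>. (scaled_variation K a X (\<nu> / \<alpha>) \<gamma> n \<omega> - stable_moment \<alpha> \<gamma> \<kappa>)\<^sup>2)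
      \<le> 2 * suminf \<rho> / real (Suc (n - K))"
      unfolding scaled_variation_eq_average[OF n] by (rule avg(2)) measurable
    also have "\<dots> \<le> 2 * suminf \<rho> * real K / real n"
    proof -
      obtain j where j: "n = K + j" using n le_Suc_ex by blast
      have "K + j \<le> K * Suc j" using assms(3) by simp
      then have "real (K + j) \<le> real (K * Suc j)" by (simp only: of_nat_le_iff)
      then have "real n \<le> real K * real (Suc (n - K))" unfolding j by (simp only: of_nat_mult diff_add_inverse)
      then have "2 * suminf \<rho> * real n \<le> 2 * suminf \<rho> * (real K * real (Suc (n - K)))"
        using S by (intro mult_left_mono) auto
      then have "2 * suminf \<rho> * real n \<le> 2 * suminf \<rho> * real K * real (Suc (n - K))"
        by (simp only: mult.assoc)
      then show ?thesis using n0 by (simp only: pos_divide_le_eq pos_le_divide_eq times_divide_eq_left of_nat_0_less_iff zero_less_Suc)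
    qed
    finally show "expectation (\<lambda>\<omega>. (scaled_variation K a X (\<nu> / \<alpha>) \<gamma> n \<omega> - stable_moment \<alpha> \<gamma> \<kappa>)\<^sup>2) \<le> 2 * suminf \<rho> * real K / real n" .
  qed
qed

end

section \<open>The function h and its inverse\<close>

lemma h_fun_has_derivative:
  assumes "0 < u" "0 < v" "0 < x"
  shows "(h_fun u v has_field_derivative
    u * v / x\<^sup>2 * (Digamma (1 + u / x) - Digamma (1 + v / x))) (at x)"
proof -
  have pos: "1 + u / y > 0" "1 + v / y > 0" if "y > 0" for y
    using assms that by (auto intro!: add_pos_pos)
  have "((\<lambda>y. u * ln_Gamma (1 + v / y) - v * ln_Gamma (1 + u / y)) has_field_derivative
    u * (Digamma (1 + v / x) * (- v / x\<^sup>2)) - v * (Digamma (1 + u / x) * (- u / x\<^sup>2))) (at x)"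
    using pos[OF assms(3)] assms
    by (auto intro!: derivative_eq_intros simp: power2_eq_square mult_ac)
  then have "(h_fun u v has_field_derivative
    u * (Digamma (1 + v / x) * (- v / x\<^sup>2)) - v * (Digamma (1 + u / x) * (- u / x\<^sup>2))) (at x)"
    by (rule has_field_derivative_transform_within_open[where S="{0<..}"])
       (use assms pos in \<open>auto simp: h_fun_def ln_Gamma_real_pos\<close>)
  then show ?thesis by (simp add: algebra_simps)
qed

lemma h_fun_continuous_on:
  assumes "0 < u" "0 < v" "S \<subseteq> {0<..}"
  shows "continuous_on S (h_fun u v)"
  using assms by (intro continuous_at_imp_continuous_on ballI DERIV_isCont[OF h_fun_has_derivative]) auto

lemma h_fun_derivative_pos:
  fixes u v x :: real
  assumes "0 < v" "v < u" "0 < x"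
  shows "u * v / x\<^sup>2 * (Digamma (1 + u / x) - Digamma (1 + v / x)) > 0"
proof -
  have "Digamma (1 + v / x) < Digamma (1 + u / x)"
    using assms by (intro Digamma_real_strict_mono) (auto intro!: add_pos_pos divide_strict_right_mono)
  then show ?thesis using assms by simp
qed

lemma h_fun_strict_mono:
  assumes "0 < v" "v < u" "0 < x" "x < y"
  shows "h_fun u v x < h_fun u v y"
proof (rule DERIV_pos_imp_increasing[OF assms(4)])
  fix z assume z: "x \<le> z" "z \<le> y"
  then show "\<exists>d. (h_fun u v has_real_derivative d) (at z) \<and> d > 0"
    using h_fun_has_derivative[of u v z] h_fun_derivative_pos[of v u z] assms by (intro exI conjI) auto
qed

text \<open>
  The function increases strictly and tends to \<open>0\<close> at infinity.
\<close>

lemma h_fun_neg: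
  assumes "0 < v" "v < u" "0 < x"
  shows "h_fun u v x < 0"
proof -
  have lim: "(h_fun u v \<longlongrightarrow> 0) at_top"
  proof -
    have G: "isCont (Gamma :: real \<Rightarrow> real) 1" by (intro continuous_intros) auto
    have t: "((\<lambda>x. 1 + c / x) \<longlongrightarrow> 1) at_top" for c :: real
      by (rule tendsto_eq_intros tendsto_divide_0 tendsto_const filterlim_at_top_imp_at_infinity filterlim_ident | simp)+
    have "((\<lambda>x. ln (Gamma (1 + c / x))) \<longlongrightarrow> ln (Gamma 1)) at_top" for c :: real
      by (intro tendsto_ln isCont_tendsto_compose[OF G t]) auto
    then have "((\<lambda>x. u * ln (Gamma (1 + v / x)) - v * ln (Gamma (1 + u / x))) \<longlongrightarrow> u * ln (Gamma 1) - v * ln (Gamma 1)) at_top"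
      by (intro tendsto_diff tendsto_mult tendsto_const)
    then show ?thesis by (simp add: h_fun_def[abs_def])
  qed
  have "h_fun u v x < h_fun u v (x + 1)" using assms by (intro h_fun_strict_mono) auto
  also have "h_fun u v (x + 1) \<le> 0"
  proof (rule tendsto_lowerbound[OF lim])
    show "\<forall>\<^sub>F y in at_top. h_fun u v (x + 1) \<le> h_fun u v y"
      using eventually_gt_at_top[of "x + 1"]
      by eventually_elim (use h_fun_strict_mono[OF assms(1,2), of "x + 1"] assms in \<open>auto intro!: less_imp_le\<close>)
  qed simp
  finally show ?thesis .
qed

lemma h_fun_inj: "0 < v \<Longrightarrow> v < u \<Longrightarrow> inj_on (h_fun u v) {0<..}"
  by (rule linorder_inj_onI') (use h_fun_strict_mono in fastforce)

lemma phi_fun_h_fun: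
  assumes "0 < v" "v < u" "0 < x"
  shows "phi_fun u v (h_fun u v x) = x"
  using h_fun_neg[OF assms] the_inv_into_f_f[OF h_fun_inj[OF assms(1,2)], of x] assms
  by (simp add: phi_fun_def)

text \<open>
  On the range of \<open>h_fun u v\<close>, an interval, the inverse is monotone. At negative numbers outside the range
  \<open>the_inv_into\<close> takes one and the same default value.
\<close>

lemma phi_fun_borel_measurable:
  assumes "0 < v" "v < u"
  shows "phi_fun u v \<in> borel_measurable borel"
proof -
  define R where "R = h_fun u v ` {0<..}"
  have cont: "continuous_on {0<..} (h_fun u v)"
    using assms by (intro h_fun_continuous_on) auto
  then have "connected R" unfolding R_def by (intro connected_continuous_image) auto
  then have R: "R \<in> sets borel" by (simp add: is_interval_connected_1[symmetric] real_interval_borel_measurable)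
  have inR: "the_inv_into {0<..} (h_fun u v) w > 0" "h_fun u v (the_inv_into {0<..} (h_fun u v) w) = w" if "w \<in> R" for w
    using that the_inv_into_into[OF h_fun_inj[OF assms], of w "{0<..}"] f_the_inv_into_f[OF h_fun_inj[OF assms], of w]
    by (auto simp: R_def)
  have mono: "mono_on R (the_inv_into {0<..} (h_fun u v))"
  proof (rule mono_onI)
    fix w w' assume w: "w \<in> R" "w' \<in> R" "w \<le> w'"
    show "the_inv_into {0<..} (h_fun u v) w \<le> the_inv_into {0<..} (h_fun u v) w'"
    proof (rule ccontr)
      assume "\<not> ?thesis"
      then have "h_fun u v (the_inv_into {0<..} (h_fun u v) w') < h_fun u v (the_inv_into {0<..} (h_fun u v) w)"
        using inR w by (intro h_fun_strict_mono assms) auto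
      with w inR show False by auto
    qed
  qed
  have "the_inv_into {0<..} (h_fun u v) \<in> borel_measurable (restrict_space borel R)"
    by (rule borel_measurable_mono_on_fnc[OF mono])
  moreover have outside: "the_inv_into {0<..} (h_fun u v) w = (THE x::real. False)" if "w \<notin> R" for w
  proof -
    have "(\<lambda>x. x \<in> {0<..} \<and> h_fun u v x = w) = (\<lambda>x. False)" using that by (auto simp: R_def)
    then show ?thesis unfolding the_inv_into_def by simp
  qed
  then have "the_inv_into {0<..} (h_fun u v) \<in> borel_measurable (restrict_space borel (- R))"
    by (subst measurable_cong[where g="\<lambda>_. THE x::real. False"]) (auto simp: space_restrict_space)
  ultimately have [measurable]: "the_inv_into {0<..} (h_fun u v) \<in> borel_measurable borel"
    by (subst measurable_piecewise_restrict_iff[of "{R, - R}"]) (auto simp: R intro: borel_comp)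
  show ?thesis unfolding phi_fun_def by measurable
qed

text \<open>
  On the compact interval \<open>[\<alpha> / 2, 2 \<alpha>]\<close> the continuous positive derivative of \<open>h_fun u v\<close> has a positive minimum
  \<open>c\<close>, and \<open>1 / c\<close> is a Lipschitz constant of the inverse.
\<close>

lemma phi_fun_locally_Lipschitz:
  assumes "0 < v" "v < u" "0 < \<alpha>"
  obtains \<delta> C where "\<delta> > 0" "C > 0"
    "\<And>w. \<bar>w - h_fun u v \<alpha>\<bar> \<le> \<delta> \<Longrightarrow> \<bar>phi_fun u v w - \<alpha>\<bar> \<le> C * \<bar>w - h_fun u v \<alpha>\<bar>"
proof -
  define d where "d = (\<lambda>x. u * v / x\<^sup>2 * (Digamma (1 + u / x) - Digamma (1 + v / x)))"
  define S where "S = {\<alpha> / 2 .. 2 * \<alpha>}"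
  have pos: "1 + u / x > 0" "1 + v / x > 0" if "x \<in> S" for x
    using assms that by (auto intro!: add_pos_pos simp: S_def)
  have "continuous_on S (\<lambda>x. Digamma (1 + w / x))" if "w \<in> {u, v}" for w
  proof (rule continuous_on_compose2[OF continuous_on_Polygamma[of "{0<..}"]])
    show "continuous_on S (\<lambda>x. 1 + w / x)" using assms by (intro continuous_intros) (auto simp: S_def)
  qed (use that pos in \<open>auto dest: nonpos_Ints_nonpos\<close>)
  then have "continuous_on S d"
    unfolding d_def using assms by (intro continuous_intros) (auto simp: S_def)
  then obtain x0 where x0: "x0 \<in> S" "\<And>x. x \<in> S \<Longrightarrow> d x0 \<le> d x"
    using continuous_attains_inf[of S d] assms by (auto simp: S_def)
  define c where "c = d x0"
  have c: "c > 0" using h_fun_derivative_pos[of v u x0] x0 assms by (auto simp: c_def d_def S_def)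
  have expand: "c * \<bar>x - \<alpha>\<bar> \<le> \<bar>h_fun u v x - h_fun u v \<alpha>\<bar>" if x: "x \<in> S" for x
  proof -
    have lem: "c * (y - x) \<le> h_fun u v y - h_fun u v x" if xy: "x < y" "x \<in> S" "y \<in> S" for x y
    proof -
      have "\<exists>z. z > x \<and> z < y \<and> h_fun u v y - h_fun u v x = (y - x) * d z"
        using xy assms unfolding d_def by (intro MVT2 h_fun_has_derivative) (auto simp: S_def)
      then obtain z where z: "z > x" "z < y" "h_fun u v y - h_fun u v x = (y - x) * d z" by blast
      then have "c \<le> d z" unfolding c_def using xy by (intro x0) (auto simp: S_def)
      then show ?thesis using z xy by (simp add: mult.commute)
    qed
    have aS: "\<alpha> \<in> S" using assms by (auto simp: S_def)
    show ?thesis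
      using lem[of x \<alpha>] lem[of \<alpha> x] x aS by (cases x \<alpha> rule: linorder_cases) (auto simp: abs_if algebra_simps)
  qed
  define \<delta> where "\<delta> = min (h_fun u v \<alpha> - h_fun u v (\<alpha> / 2)) (h_fun u v (2 * \<alpha>) - h_fun u v \<alpha>)"
  show thesis
  proof
    show "\<delta> > 0" using assms by (auto simp: \<delta>_def intro!: h_fun_strict_mono)
    show "1 / c > 0" using c by simp
    fix w assume w: "\<bar>w - h_fun u v \<alpha>\<bar> \<le> \<delta>"
    have "\<exists>x\<ge>\<alpha> / 2. x \<le> 2 * \<alpha> \<and> h_fun u v x = w"
    proof (rule IVT')
      show "h_fun u v (\<alpha> / 2) \<le> w" "w \<le> h_fun u v (2 * \<alpha>)" using w by (auto simp: \<delta>_def abs_le_iff)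
      show "continuous_on {\<alpha> / 2..2 * \<alpha>} (h_fun u v)"
        using assms by (intro h_fun_continuous_on) auto
    qed (use assms in auto)
    then obtain x where x: "x \<in> S" "h_fun u v x = w" by (auto simp: S_def)
    then have "phi_fun u v w = x" using phi_fun_h_fun[of v u x] assms by (auto simp: S_def)
    with expand[OF x(1)] x c show "\<bar>phi_fun u v w - \<alpha>\<bar> \<le> 1 / c * \<bar>w - h_fun u v \<alpha>\<bar>"
      by (simp add: field_simps)
  qed
qed

section \<open>From mean square bounds to rates in probability\<close>

lemma (in prob_space) real_rv_tight:
  fixes Z :: "'a \<Rightarrow> real"
  assumes [measurable]: "Z \<in> borel_measurable M" and "\<epsilon> > 0"
  obtains m where "m > 0" "prob {\<omega> \<in> space M. \<bar>Z \<omega>\<bar> > m} < \<epsilon>"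
proof -
  define A where "A = (\<lambda>i::nat. {\<omega> \<in> space M. \<bar>Z \<omega>\<bar> > real i})"
  have "(\<lambda>i. prob (A i)) \<longlonglongrightarrow> prob (\<Inter>i. A i)"
    by (rule finite_Lim_measure_decseq) (auto simp: A_def decseq_def)
  moreover have "(\<Inter>i. A i) = {}"
  proof -
    have "\<exists>i::nat. \<not> \<bar>Z \<omega>\<bar> > real i" for \<omega> using reals_Archimedean2[of "\<bar>Z \<omega>\<bar>"] by (metis less_asym)
    then show ?thesis by (auto simp: A_def)
  qed
  ultimately have "(\<lambda>i. prob (A i)) \<longlonglongrightarrow> 0" by simp
  then have "\<forall>\<^sub>F i in sequentially. prob (A i) < \<epsilon>" using assms(2) by (rule order_tendstoD)
  then obtain i where i: "\<And>j. j \<ge> i \<Longrightarrow> prob (A j) < \<epsilon>" by (auto simp: eventually_sequentially)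
  show thesis
    by (rule that[of "real (Suc i)"]) (use i[of "Suc i"] in \<open>auto simp: A_def\<close>)
qed

text \<open>
  The error of \<open>Y\<close> is controlled by \<open>T\<close> only on the event \<open>\<bar>T\<bar> \<le> \<rho>\<close>. Its complement has probability of order
  \<open>(b n)\<^sup>2\<close>, which is small only for large \<open>n\<close>. Since boundedness in probability is required uniformly over
  all of \<open>N\<close>, the finitely many other indices are treated by tightness of single random variables.
\<close>

lemma (in prob_space) consistency_and_rate_from_mean_square:
  fixes Y T :: "nat \<Rightarrow> 'a \<Rightarrow> real" and b :: "nat \<Rightarrow> real"
  assumes N: "N \<noteq> {}"
    and Y: "\<And>n. n \<in> N \<Longrightarrow> Y n \<in> borel_measurable M"
    and T: "\<And>n. n \<in> N \<Longrightarrow> T n \<in> borel_measurable M"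
    and T2: "\<And>n. n \<in> N \<Longrightarrow> integrable M (\<lambda>\<omega>. (T n \<omega>)\<^sup>2)"
      "\<And>n. n \<in> N \<Longrightarrow> expectation (\<lambda>\<omega>. (T n \<omega>)\<^sup>2) \<le> B * (b n)\<^sup>2"
    and b: "\<And>n. n \<in> N \<Longrightarrow> b n > 0" "b \<longlonglongrightarrow> 0"
    and \<rho>: "\<rho> > 0" "C > 0"
    and lip: "\<And>n \<omega>. n \<in> N \<Longrightarrow> \<omega> \<in> space M \<Longrightarrow> \<bar>T n \<omega>\<bar> \<le> \<rho> \<Longrightarrow> \<bar>Y n \<omega> - y\<bar> \<le> C * \<bar>T n \<omega>\<bar>"
  shows "conv_in_prob M (at_top_along N) Y (\<lambda>_. y)"
    and "OP M N b (\<lambda>n \<omega>. Y n \<omega> - y)"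
proof -
  have dev: "prob {\<omega> \<in> space M. \<bar>Y n \<omega> - y\<bar> > s} \<le> B * (b n)\<^sup>2 / (min \<rho> (s / C))\<^sup>2"
    if n: "n \<in> N" and s: "s > 0" for n s
  proof -
    note [measurable] = Y[OF n] T[OF n]
    define \<tau> where "\<tau> = min \<rho> (s / C)"
    have \<tau>: "\<tau> > 0" using \<rho> s by (simp add: \<tau>_def)
    have "{\<omega> \<in> space M. \<bar>Y n \<omega> - y\<bar> > s} \<subseteq> {\<omega> \<in> space M. (T n \<omega>)\<^sup>2 \<ge> \<tau>\<^sup>2}"
    proof safe
      fix \<omega> assume \<omega>: "\<omega> \<in> space M" "\<bar>Y n \<omega> - y\<bar> > s"
      have "\<bar>T n \<omega>\<bar> \<ge> \<tau>"
      proof (rule ccontr)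
        assume "\<not> \<bar>T n \<omega>\<bar> \<ge> \<tau>"
        then have t: "\<bar>T n \<omega>\<bar> < \<rho>" "\<bar>T n \<omega>\<bar> < s / C" by (auto simp: \<tau>_def)
        then have "\<bar>Y n \<omega> - y\<bar> \<le> C * \<bar>T n \<omega>\<bar>" using n \<omega> by (intro lip) auto
        also have "\<dots> < s" using t(2) \<rho> by (simp add: field_simps)
        finally show False using \<omega> by simp
      qed
      then show "(T n \<omega>)\<^sup>2 \<ge> \<tau>\<^sup>2" using \<tau> by (metis abs_le_square_iff abs_of_pos)
    qed
    then have "prob {\<omega> \<in> space M. \<bar>Y n \<omega> - y\<bar> > s} \<le> prob {\<omega> \<in> space M. (T n \<omega>)\<^sup>2 \<ge> \<tau>\<^sup>2}"
      by (rule finite_measure_mono) measurable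
    also have "\<dots> \<le> expectation (\<lambda>\<omega>. (T n \<omega>)\<^sup>2) / \<tau>\<^sup>2"
      using \<tau> by (intro integral_Markov_inequality_measure[OF T2(1)[OF n] sets.top]) auto
    also have "\<dots> \<le> B * (b n)\<^sup>2 / \<tau>\<^sup>2" using T2(2)[OF n] by (rule divide_right_mono) simp
    finally show ?thesis by (simp add: \<tau>_def)
  qed
  show "conv_in_prob M (at_top_along N) Y (\<lambda>_. y)"
    unfolding conv_in_prob_def
  proof (intro allI impI)
    fix s :: real assume s: "s > 0"
    have "(\<lambda>n. B * (b n)\<^sup>2 / (min \<rho> (s / C))\<^sup>2) \<longlonglongrightarrow> B * 0\<^sup>2 / (min \<rho> (s / C))\<^sup>2"
      using b(2) \<rho> s by (intro tendsto_intros) (auto simp: min_def)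
    then have lim: "((\<lambda>n. B * (b n)\<^sup>2 / (min \<rho> (s / C))\<^sup>2) \<longlongrightarrow> 0) (at_top_along N)"
      unfolding at_top_along_def by (intro tendsto_mono[OF inf_le1]) simp
    have ev: "\<forall>\<^sub>F n in at_top_along N. prob {\<omega> \<in> space M. s < \<bar>Y n \<omega> - y\<bar>} \<le> B * (b n)\<^sup>2 / (min \<rho> (s / C))\<^sup>2"
      unfolding at_top_along_def eventually_inf_principal using dev s by (intro always_eventually) auto
    show "((\<lambda>n. prob {\<omega> \<in> space M. s < \<bar>Y n \<omega> - y\<bar>}) \<longlongrightarrow> 0) (at_top_along N)"
      by (rule tendsto_sandwich[where f="\<lambda>_. 0", OF always_eventually ev tendsto_const lim]) simp
  qed
  define Z where "Z = (\<lambda>n \<omega>. (Y n \<omega> - y) / b n)"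
  have Zm: "Z n \<in> borel_measurable M" if "n \<in> N" for n
    using Y[OF that] unfolding Z_def by measurable
  have "OP1 M N Z"
    unfolding OP1_def
  proof (intro conjI ballI allI impI)
    fix \<epsilon> :: real assume \<epsilon>: "\<epsilon> > 0"
    have "(\<lambda>n. B * (b n)\<^sup>2 / \<rho>\<^sup>2) \<longlonglongrightarrow> B * 0\<^sup>2 / \<rho>\<^sup>2"
      using b(2) \<rho> by (intro tendsto_intros) auto
    then have "\<forall>\<^sub>F n in sequentially. B * (b n)\<^sup>2 / \<rho>\<^sup>2 < \<epsilon> / 2"
      using \<epsilon> by (intro order_tendstoD(2)[where y=0]) auto
    then obtain n0 where n0: "\<And>n. n \<ge> n0 \<Longrightarrow> B * (b n)\<^sup>2 / \<rho>\<^sup>2 < \<epsilon> / 2"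
      by (auto simp: eventually_sequentially)
    \<comment> \<open>the bound \<open>B * C\<^sup>2 / m0\<^sup>2\<close> on the probability at level \<open>m0\<close> is then below \<open>\<epsilon> / 2\<close>\<close>
    define m0 where "m0 = sqrt (2 * (\<bar>B\<bar> + 1) * C\<^sup>2 / \<epsilon>)"
    have m0: "m0 > 0" "B * C\<^sup>2 / m0\<^sup>2 < \<epsilon> / 2"
    proof -
      show "m0 > 0" unfolding m0_def using \<epsilon> \<rho> by (intro real_sqrt_gt_zero divide_pos_pos mult_pos_pos) auto
      have "m0\<^sup>2 = 2 * (\<bar>B\<bar> + 1) * C\<^sup>2 / \<epsilon>" unfolding m0_def using \<epsilon> by (intro real_sqrt_pow2) auto
      then have "B * C\<^sup>2 / m0\<^sup>2 = (B / (\<bar>B\<bar> + 1)) * (\<epsilon> / 2)" using \<rho> by simp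
      also have "\<dots> < 1 * (\<epsilon> / 2)"
        using \<epsilon> by (intro mult_strict_right_mono) (auto simp: divide_less_eq)
      finally show "B * C\<^sup>2 / m0\<^sup>2 < \<epsilon> / 2" by simp
    qed
    have "\<forall>n\<in>N. \<exists>m>0. prob {\<omega> \<in> space M. \<bar>Z n \<omega>\<bar> > m} < \<epsilon> / 2"
      using real_rv_tight[OF Zm, of _ "\<epsilon> / 2"] \<epsilon> by (metis half_gt_zero)
    then obtain k where k: "\<And>n. n \<in> N \<Longrightarrow> k n > 0 \<and> prob {\<omega> \<in> space M. \<bar>Z n \<omega>\<bar> > k n} < \<epsilon> / 2"
      by metis
    define m where "m = Max (insert m0 (k ` (N \<inter> {..<n0})))"
    have m: "m \<ge> m0" "\<And>n. n \<in> N \<Longrightarrow> n < n0 \<Longrightarrow> m \<ge> k n" by (auto simp: m_def)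
    have "prob {\<omega> \<in> space M. \<bar>Z n \<omega>\<bar> > m} \<le> \<epsilon> / 2" if n: "n \<in> N" for n
    proof (cases "n < n0")
      case True
      note [measurable] = Zm[OF n]
      have "prob {\<omega> \<in> space M. \<bar>Z n \<omega>\<bar> > m} \<le> prob {\<omega> \<in> space M. \<bar>Z n \<omega>\<bar> > k n}"
        using m(2)[OF n True] by (intro finite_measure_mono) auto
      with k[OF n] show ?thesis by simp
    next
      case False
      have "prob {\<omega> \<in> space M. \<bar>Z n \<omega>\<bar> > m} \<le> prob {\<omega> \<in> space M. \<bar>Y n \<omega> - y\<bar> > m0 * b n}"
      proof (rule finite_measure_mono)
        show "{\<omega> \<in> space M. \<bar>Y n \<omega> - y\<bar> > m0 * b n} \<in> sets M" using Y[OF n] by measurable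
        show "{\<omega> \<in> space M. \<bar>Z n \<omega>\<bar> > m} \<subseteq> {\<omega> \<in> space M. \<bar>Y n \<omega> - y\<bar> > m0 * b n}"
          using m(1) b(1)[OF n] by (auto simp: Z_def abs_divide pos_less_divide_eq intro: le_less_trans[OF mult_right_mono])
      qed
      also have "\<dots> \<le> B * (b n)\<^sup>2 / (min \<rho> (m0 * b n / C))\<^sup>2"
        using m0 b(1)[OF n] by (intro dev n) simp
      also have "\<dots> \<le> \<epsilon> / 2"
      proof (cases "\<rho> \<le> m0 * b n / C")
        case True
        then show ?thesis using n0[of n] False by (simp add: min_def)
      next
        case c: False
        then have "B * (b n)\<^sup>2 / (min \<rho> (m0 * b n / C))\<^sup>2 = B * C\<^sup>2 / m0\<^sup>2"
          using b(1)[OF n] \<rho> m0(1) by (simp add: min_def power_mult_distrib power_divide)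
        with m0 show ?thesis by simp
      qed
      finally show ?thesis .
    qed
    then have "(SUP n\<in>N. prob {\<omega> \<in> space M. \<bar>Z n \<omega>\<bar> > m}) \<le> \<epsilon> / 2"
      by (intro cSUP_least N)
    moreover have "m > 0" using m0(1) m(1) by simp
    ultimately show "\<exists>m>0. (SUP n\<in>N. prob {\<omega> \<in> space M. \<bar>Z n \<omega>\<bar> > m}) < \<epsilon>"
      using \<epsilon> by (intro exI[of _ m]) auto
  qed (rule Zm)
  then show "OP M N b (\<lambda>n \<omega>. Y n \<omega> - y)"
    unfolding OP_def by (intro exI[of _ Z]) (use b(1) in \<open>force simp: Z_def\<close>)
qed

lemma abs_ln_diff_le:
  fixes w r :: real
  assumes "r > 0" "\<bar>w - r\<bar> \<le> r / 2"
  shows "w > 0" "\<bar>ln w - ln r\<bar> \<le> 2 / r * \<bar>w - r\<bar>"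
proof -
  have w2: "w \<ge> r / 2" using assms(2) abs_ge_minus_self[of "w - r"] by linarith
  then show w: "w > 0" using assms(1) by linarith
  have "ln w - ln r \<le> (w - r) / r" using ln_diff_le[of w r] w assms by simp
  also have "\<dots> \<le> 2 / r * \<bar>w - r\<bar>" using assms by (auto simp: field_simps abs_if)
  finally have 1: "ln w - ln r \<le> 2 / r * \<bar>w - r\<bar>" .
  have "ln r - ln w \<le> (r - w) / w" using ln_diff_le[of r w] w assms by simp
  also have "\<dots> \<le> \<bar>w - r\<bar> / w" using w by (intro divide_right_mono) auto
  also have "\<dots> \<le> \<bar>w - r\<bar> / (r / 2)" using w w2 assms by (intro divide_left_mono) auto
  finally have 2: "ln r - ln w \<le> 2 / r * \<bar>w - r\<bar>" by (simp add: mult.commute)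
  show "\<bar>ln w - ln r\<bar> \<le> 2 / r * \<bar>w - r\<bar>" using 1 2 by linarith
qed

section \<open>The estimators\<close>

lemma ln_stable_moment:
  assumes "0 < u" "u < 1" "0 < \<alpha>" "0 < \<kappa>"
  shows "ln (stable_moment \<alpha> (- u) \<kappa>) = - u * ln 2 + ln (Gamma ((1 - u) / 2)) + ln (Gamma (1 + u / \<alpha>))
    - ln pi / 2 - ln (Gamma (1 + u / 2)) - u / \<alpha> * ln \<kappa>"
proof -
  define g\<^sub>1 g\<^sub>2 g\<^sub>3 where "g\<^sub>1 = Gamma ((1 - u) / 2)" and "g\<^sub>2 = Gamma (1 + u / \<alpha>)" and "g\<^sub>3 = Gamma (1 + u / 2)"
  have "g\<^sub>1 > 0" "g\<^sub>2 > 0" "g\<^sub>3 > 0"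
    unfolding g\<^sub>1_def g\<^sub>2_def g\<^sub>3_def using assms by (auto intro!: Gamma_real_pos add_pos_pos)
  moreover have "stable_moment \<alpha> (- u) \<kappa> = 2 powr (- u) * g\<^sub>1 * g\<^sub>2 / (sqrt pi * g\<^sub>3) * \<kappa> powr (- u / \<alpha>)"
    by (simp add: stable_moment_def g\<^sub>1_def g\<^sub>2_def g\<^sub>3_def)
  ultimately show ?thesis
    unfolding g\<^sub>1_def[symmetric] g\<^sub>2_def[symmetric] g\<^sub>3_def[symmetric]
    using assms by (simp add: ln_mult ln_div ln_powr ln_sqrt)
qed

text \<open>
  The terms in \<open>ln 2\<close> and \<open>ln \<kappa>\<close> cancel because the scale enters the moment of order \<open>- u\<close> as a power
  proportional to \<open>u\<close>; the other terms not involving \<open>\<alpha>\<close> are removed by \<open>C_const\<close>.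
\<close>

lemma psi_fun_stable_moments:
  assumes "0 < u" "u < 1" "0 < v" "v < 1" "0 < \<alpha>" "0 < \<kappa>"
  shows "psi_fun u v (stable_moment \<alpha> (- u) \<kappa>) (stable_moment \<alpha> (- v) \<kappa>) = h_fun u v \<alpha>"
proof -
  have "u * (v / \<alpha>) = v * (u / \<alpha>)" by simp
  then show ?thesis
    unfolding psi_fun_def C_const_def h_fun_def
      ln_stable_moment[OF assms(1,2,5,6)] ln_stable_moment[OF assms(3,4,5,6)]
    by (simp add: algebra_simps diff_divide_distrib)
qed

lemma abs_sum_square_le: "(\<bar>x\<bar> + \<bar>y\<bar>)\<^sup>2 \<le> 2 * x\<^sup>2 + 2 * (y\<^sup>2 :: real)"
  using sum_squares_bound[of "\<bar>x\<bar>" "\<bar>y\<bar>"] by (simp add: power2_sum)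

lemma (in prob_space) sum_of_abs_mean_square:
  fixes S T :: "'a \<Rightarrow> real"
  assumes [measurable]: "S \<in> borel_measurable M" "T \<in> borel_measurable M"
    and int: "integrable M (\<lambda>\<omega>. (S \<omega>)\<^sup>2)" "integrable M (\<lambda>\<omega>. (T \<omega>)\<^sup>2)"
    and le: "expectation (\<lambda>\<omega>. (S \<omega>)\<^sup>2) \<le> s" "expectation (\<lambda>\<omega>. (T \<omega>)\<^sup>2) \<le> t"
  shows "integrable M (\<lambda>\<omega>. (\<bar>S \<omega>\<bar> + \<bar>T \<omega>\<bar>)\<^sup>2)"
    and "expectation (\<lambda>\<omega>. (\<bar>S \<omega>\<bar> + \<bar>T \<omega>\<bar>)\<^sup>2) \<le> 2 * s + 2 * t"
proof -
  have i: "integrable M (\<lambda>\<omega>. 2 * (S \<omega>)\<^sup>2 + 2 * (T \<omega>)\<^sup>2)"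
    by (intro Bochner_Integration.integrable_add integrable_mult_right int)
  show i2: "integrable M (\<lambda>\<omega>. (\<bar>S \<omega>\<bar> + \<bar>T \<omega>\<bar>)\<^sup>2)"
    by (rule Bochner_Integration.integrable_bound[OF i]) (use abs_sum_square_le in auto)
  have "expectation (\<lambda>\<omega>. (\<bar>S \<omega>\<bar> + \<bar>T \<omega>\<bar>)\<^sup>2) \<le> expectation (\<lambda>\<omega>. 2 * (S \<omega>)\<^sup>2 + 2 * (T \<omega>)\<^sup>2)"
    using i2 i by (rule integral_mono) (rule abs_sum_square_le)
  also have "\<dots> = 2 * expectation (\<lambda>\<omega>. (S \<omega>)\<^sup>2) + 2 * expectation (\<lambda>\<omega>. (T \<omega>)\<^sup>2)"
    using int by simp
  also have "\<dots> \<le> 2 * s + 2 * t" using le by simp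
  finally show "expectation (\<lambda>\<omega>. (\<bar>S \<omega>\<bar> + \<bar>T \<omega>\<bar>)\<^sup>2) \<le> 2 * s + 2 * t" .
qed

context takenaka_increments begin

definition "rate n = real n powr ((\<nu> - 1) / 2)"

lemma rate_pos: "n > 0 \<Longrightarrow> rate n > 0"
  by (simp add: rate_def)

lemma rate_tendsto_0: "rate \<longlonglongrightarrow> 0"
  unfolding rate_def[abs_def] using \<nu>
  by (intro tendsto_neg_powr filterlim_real_sequentially) auto

lemma inverse_le_rate_square:
  assumes "n > 0"
  shows "1 / real n \<le> (rate n)\<^sup>2"
proof -
  have "1 / real n = real n powr (-1)" using assms by (simp add: powr_minus_divide)
  also have "\<dots> \<le> real n powr (\<nu> - 1)" using assms \<nu> by (intro powr_mono) auto
  also have "\<dots> = (rate n)\<^sup>2" by (simp add: rate_def power2_eq_square flip: powr_add)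
  finally show ?thesis .
qed

lemma variation_measurable [measurable]: "variation K a X \<gamma> n \<in> borel_measurable P"
proof -
  have "(\<lambda>\<omega>. variation K a X \<gamma> n \<omega>) \<in> borel_measurable P"
    unfolding variation_def by measurable
  then show ?thesis by simp
qed

lemma H_estimator_eq:
  assumes n: "even n" "n > 0" and \<beta>: "\<beta> \<noteq> 0"
    and pos: "scaled_variation K a X (\<nu> / \<alpha>) \<beta> (n div 2) \<omega> > 0" "scaled_variation K a X (\<nu> / \<alpha>) \<beta> n \<omega> > 0"
  shows "H_estimator K a X \<beta> n \<omega> - \<nu> / \<alpha> =
    (ln (scaled_variation K a X (\<nu> / \<alpha>) \<beta> (n div 2) \<omega>) - ln (scaled_variation K a X (\<nu> / \<alpha>) \<beta> n \<omega>)) / (\<beta> * ln 2)"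
proof -
  define H where "H = \<nu> / \<alpha>"
  define V where "V = (\<lambda>n. variation K a X \<beta> n \<omega>)"
  have n2: "real (n div 2) = real n / 2" "n div 2 > 0" using n by (auto elim!: evenE)
  have W: "scaled_variation K a X (\<nu> / \<alpha>) \<beta> k \<omega> = real k powr (\<beta> * H) * V k" for k
    by (simp add: scaled_variation_def H_def V_def)
  have Vpos: "V (n div 2) > 0" "V n > 0"
    using pos by (auto simp: W zero_less_mult_iff)
  have "ln (scaled_variation K a X (\<nu> / \<alpha>) \<beta> (n div 2) \<omega>) - ln (scaled_variation K a X (\<nu> / \<alpha>) \<beta> n \<omega>)
      = \<beta> * H * (ln (real n / 2) - ln (real n)) + (ln (V (n div 2)) - ln (V n))"
    unfolding W using Vpos n n2 by (simp add: ln_mult ln_powr algebra_simps)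
  also have "ln (real n / 2) - ln (real n) = - ln 2" using n by (simp add: ln_div)
  also have "ln (V (n div 2)) - ln (V n) = ln 2 * log 2 (V (n div 2) / V n)"
    using Vpos by (simp add: log_def ln_div)
  finally have eq: "ln (scaled_variation K a X (\<nu> / \<alpha>) \<beta> (n div 2) \<omega>) - ln (scaled_variation K a X (\<nu> / \<alpha>) \<beta> n \<omega>)
      = \<beta> * H * - ln 2 + ln 2 * log 2 (V (n div 2) / V n)" .
  show ?thesis
    unfolding eq using \<beta> by (simp add: H_estimator_def V_def H_def field_simps)
qed

text \<open>
  On the event that both variations are within a factor of two of their common limit the logarithms in
  \<open>H_estimator_eq\<close> are Lipschitz.
\<close>

lemma H_estimator_rate:
  assumes \<beta>: "-1/2 < \<beta>" "\<beta> < 0" and K: "K \<ge> 1"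
  defines "N \<equiv> {n. even n \<and> n div 2 \<ge> K}"
  shows "conv_in_prob P (at_top_along N) (H_estimator K a X \<beta>) (\<lambda>_. \<nu> / \<alpha>)"
    and "OP P N rate (\<lambda>n \<omega>. H_estimator K a X \<beta> n \<omega> - \<nu> / \<alpha>)"
proof -
  define R where "R = stable_moment \<alpha> \<beta> \<kappa>"
  have R: "R > 0" unfolding R_def using \<beta> \<alpha>_pos \<kappa>_pos by (intro stable_moment_pos) auto
  define W where "W = scaled_variation K a X (\<nu> / \<alpha>) \<beta>"
  have [measurable]: "W n \<in> borel_measurable P" for n unfolding W_def by measurable
  obtain B where B: "B \<ge> 0" "\<And>n. n \<ge> K \<Longrightarrow> integrable P (\<lambda>\<omega>. (W n \<omega> - R)\<^sup>2)"
    "\<And>n. n \<ge> K \<Longrightarrow> expectation (\<lambda>\<omega>. (W n \<omega> - R)\<^sup>2) \<le> B / real n"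
    using scaled_variation_mean_square[OF \<beta> K] unfolding R_def W_def by blast
  define T where "T = (\<lambda>n \<omega>. \<bar>W (n div 2) \<omega> - R\<bar> + \<bar>W n \<omega> - R\<bar>)"
  have N: "n div 2 \<ge> K" "n \<ge> K" "n > 0" "even n" "real (n div 2) = real n / 2" if "n \<in> N" for n
    using that K by (auto simp: N_def elim!: evenE)
  have "2 * K \<in> N" by (simp add: N_def)
  then have N_ne: "N \<noteq> {}" by blast
  have T2: "integrable P (\<lambda>\<omega>. (T n \<omega>)\<^sup>2)" "expectation (\<lambda>\<omega>. (T n \<omega>)\<^sup>2) \<le> (6 * B) * (rate n)\<^sup>2" if n: "n \<in> N" for n
  proof -
    note sq = sum_of_abs_mean_square[where S="\<lambda>\<omega>. W (n div 2) \<omega> - R" and T="\<lambda>\<omega>. W n \<omega> - R",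
      OF _ _ B(2)[OF N(1)[OF n]] B(2)[OF N(2)[OF n]] B(3)[OF N(1)[OF n]] B(3)[OF N(2)[OF n]]]
    show "integrable P (\<lambda>\<omega>. (T n \<omega>)\<^sup>2)" unfolding T_def by (rule sq(1)) measurable
    have "expectation (\<lambda>\<omega>. (T n \<omega>)\<^sup>2) \<le> 2 * (B / real (n div 2)) + 2 * (B / real n)"
      unfolding T_def by (rule sq(2)) measurable
    also have "\<dots> = 6 * B * (1 / real n)" using N[OF n] by (simp add: field_simps)
    also have "\<dots> \<le> 6 * B * (rate n)\<^sup>2" using inverse_le_rate_square[OF N(3)[OF n]] B(1) by (intro mult_left_mono) auto
    finally show "expectation (\<lambda>\<omega>. (T n \<omega>)\<^sup>2) \<le> (6 * B) * (rate n)\<^sup>2" .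
  qed
  have lip: "\<bar>H_estimator K a X \<beta> n \<omega> - \<nu> / \<alpha>\<bar> \<le> (2 / R / (- \<beta> * ln 2)) * \<bar>T n \<omega>\<bar>"
    if n: "n \<in> N" and T: "\<bar>T n \<omega>\<bar> \<le> R / 2" for n \<omega>
  proof -
    have d: "\<bar>W (n div 2) \<omega> - R\<bar> \<le> R / 2" "\<bar>W n \<omega> - R\<bar> \<le> R / 2"
      using order_trans[OF abs_ge_self T[unfolded T_def]]
        abs_ge_zero[of "W (n div 2) \<omega> - R"] abs_ge_zero[of "W n \<omega> - R"] by linarith+
    note l1 = abs_ln_diff_le[OF R d(1)] and l2 = abs_ln_diff_le[OF R d(2)]
    have "\<bar>ln (W (n div 2) \<omega>) - ln (W n \<omega>)\<bar> \<le> 2 / R * \<bar>W (n div 2) \<omega> - R\<bar> + 2 / R * \<bar>W n \<omega> - R\<bar>"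
      using l1(2) l2(2) by linarith
    also have "\<dots> = 2 / R * \<bar>T n \<omega>\<bar>" by (simp add: T_def distrib_left)
    finally have le: "\<bar>ln (W (n div 2) \<omega>) - ln (W n \<omega>)\<bar> \<le> 2 / R * \<bar>T n \<omega>\<bar>" .
    have "\<bar>H_estimator K a X \<beta> n \<omega> - \<nu> / \<alpha>\<bar> = \<bar>ln (W (n div 2) \<omega>) - ln (W n \<omega>)\<bar> / (- \<beta> * ln 2)"
      using H_estimator_eq[of n \<beta> \<omega>] N[OF n] l1(1) l2(1) \<beta> by (simp add: W_def abs_divide abs_mult)
    also have "\<dots> \<le> 2 / R * \<bar>T n \<omega>\<bar> / (- \<beta> * ln 2)"
      using le \<beta> by (intro divide_right_mono) (auto simp: mult_nonpos_nonneg)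
    finally show ?thesis by simp
  qed
  have Ym: "H_estimator K a X \<beta> n \<in> borel_measurable P" for n
  proof -
    have "(\<lambda>\<omega>. H_estimator K a X \<beta> n \<omega>) \<in> borel_measurable P"
      unfolding H_estimator_def by measurable
    then show ?thesis by simp
  qed
  have Tm: "T n \<in> borel_measurable P" for n unfolding T_def by measurable
  have C: "2 / R / (- \<beta> * ln 2) > 0"
    using R \<beta> by (intro divide_pos_pos) (auto simp: mult_neg_pos)
  show "conv_in_prob P (at_top_along N) (H_estimator K a X \<beta>) (\<lambda>_. \<nu> / \<alpha>)"
    by (rule consistency_and_rate_from_mean_square(1)[where Y="H_estimator K a X \<beta>" and T=T and b=rate and B="6 * B" and \<rho>="R / 2",
          OF N_ne Ym Tm T2 rate_pos[OF N(3)] rate_tendsto_0 half_gt_zero[OF R] C lip])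
  show "OP P N rate (\<lambda>n \<omega>. H_estimator K a X \<beta> n \<omega> - \<nu> / \<alpha>)"
    by (rule consistency_and_rate_from_mean_square(2)[where Y="H_estimator K a X \<beta>" and T=T and b=rate and B="6 * B" and \<rho>="R / 2",
          OF N_ne Ym Tm T2 rate_pos[OF N(3)] rate_tendsto_0 half_gt_zero[OF R] C lip])
qed

text \<open>
  The composition of three maps that are Lipschitz near the limit: the logarithms in \<open>psi_fun\<close>, their
  linear combination, and \<open>phi_fun\<close>. The radius \<open>\<rho>\<close> keeps the arguments of the first and the last within
  their regions of validity.
\<close>

lemma alpha_estimator_rate:
  assumes \<beta>: "-1/2 < \<beta>\<^sub>1" "\<beta>\<^sub>1 < \<beta>\<^sub>2" "\<beta>\<^sub>2 < 0" and K: "K \<ge> 1"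
  defines "N \<equiv> {n. n \<ge> K}"
  shows "conv_in_prob P (at_top_along N) (alpha_estimator K a X (\<nu> / \<alpha>) \<beta>\<^sub>1 \<beta>\<^sub>2) (\<lambda>_. \<alpha>)"
    and "OP P N rate (\<lambda>n \<omega>. alpha_estimator K a X (\<nu> / \<alpha>) \<beta>\<^sub>1 \<beta>\<^sub>2 n \<omega> - \<alpha>)"
proof -
  define u v where "u = - \<beta>\<^sub>1" and "v = - \<beta>\<^sub>2"
  have uv: "0 < v" "v < u" "u < 1/2" using \<beta> by (auto simp: u_def v_def)
  define R1 R2 where "R1 = stable_moment \<alpha> \<beta>\<^sub>1 \<kappa>" and "R2 = stable_moment \<alpha> \<beta>\<^sub>2 \<kappa>"
  have R: "R1 > 0" "R2 > 0" unfolding R1_def R2_def using \<beta> \<alpha>_pos \<kappa>_pos by (auto intro!: stable_moment_pos)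
  define W1 W2 where "W1 = scaled_variation K a X (\<nu> / \<alpha>) \<beta>\<^sub>1" and "W2 = scaled_variation K a X (\<nu> / \<alpha>) \<beta>\<^sub>2"
  have [measurable]: "W1 n \<in> borel_measurable P" "W2 n \<in> borel_measurable P" for n
    unfolding W1_def W2_def by measurable
  have \<beta>1: "\<beta>\<^sub>1 < 0" and \<beta>2: "-1/2 < \<beta>\<^sub>2" using \<beta> by auto
  obtain B1 where B1: "B1 \<ge> 0" "\<And>n. n \<ge> K \<Longrightarrow> integrable P (\<lambda>\<omega>. (W1 n \<omega> - R1)\<^sup>2)"
    "\<And>n. n \<ge> K \<Longrightarrow> expectation (\<lambda>\<omega>. (W1 n \<omega> - R1)\<^sup>2) \<le> B1 / real n"
    using scaled_variation_mean_square[OF \<beta>(1) \<beta>1 K] unfolding R1_def W1_def by blast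
  obtain B2 where B2: "B2 \<ge> 0" "\<And>n. n \<ge> K \<Longrightarrow> integrable P (\<lambda>\<omega>. (W2 n \<omega> - R2)\<^sup>2)"
    "\<And>n. n \<ge> K \<Longrightarrow> expectation (\<lambda>\<omega>. (W2 n \<omega> - R2)\<^sup>2) \<le> B2 / real n"
    using scaled_variation_mean_square[OF \<beta>2 \<beta>(3) K] unfolding R2_def W2_def by blast
  define T where "T = (\<lambda>n \<omega>. \<bar>W1 n \<omega> - R1\<bar> + \<bar>W2 n \<omega> - R2\<bar>)"
  have N: "n \<ge> K" "n > 0" if "n \<in> N" for n using that K by (auto simp: N_def)
  have N_ne: "N \<noteq> {}" by (auto simp: N_def)
  have T2: "integrable P (\<lambda>\<omega>. (T n \<omega>)\<^sup>2)" "expectation (\<lambda>\<omega>. (T n \<omega>)\<^sup>2) \<le> (2 * B1 + 2 * B2) * (rate n)\<^sup>2" if n: "n \<in> N" for n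
  proof -
    note sq = sum_of_abs_mean_square[where S="\<lambda>\<omega>. W1 n \<omega> - R1" and T="\<lambda>\<omega>. W2 n \<omega> - R2",
      OF _ _ B1(2)[OF N(1)[OF n]] B2(2)[OF N(1)[OF n]] B1(3)[OF N(1)[OF n]] B2(3)[OF N(1)[OF n]]]
    show "integrable P (\<lambda>\<omega>. (T n \<omega>)\<^sup>2)" unfolding T_def by (rule sq(1)) measurable
    have "expectation (\<lambda>\<omega>. (T n \<omega>)\<^sup>2) \<le> 2 * (B1 / real n) + 2 * (B2 / real n)"
      unfolding T_def by (rule sq(2)) measurable
    also have "\<dots> = (2 * B1 + 2 * B2) * (1 / real n)" by (simp add: add_divide_distrib)
    also have "\<dots> \<le> (2 * B1 + 2 * B2) * (rate n)\<^sup>2"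
      using inverse_le_rate_square[OF N(2)[OF n]] B1(1) B2(1) by (intro mult_left_mono) auto
    finally show "expectation (\<lambda>\<omega>. (T n \<omega>)\<^sup>2) \<le> (2 * B1 + 2 * B2) * (rate n)\<^sup>2" .
  qed
  obtain \<delta> C where \<phi>: "\<delta> > 0" "C > 0"
    "\<And>w. \<bar>w - h_fun u v \<alpha>\<bar> \<le> \<delta> \<Longrightarrow> \<bar>phi_fun u v w - \<alpha>\<bar> \<le> C * \<bar>w - h_fun u v \<alpha>\<bar>"
    using phi_fun_locally_Lipschitz[OF uv(1,2) \<alpha>_pos] by blast
  define C1 where "C1 = v * (2 / R1) + u * (2 / R2)"
  have C1: "C1 > 0" unfolding C1_def using uv R by (intro add_pos_pos mult_pos_pos divide_pos_pos) auto
  define \<rho> where "\<rho> = Min {R1 / 2, R2 / 2, \<delta> / C1}"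
  have \<rho>: "\<rho> > 0" using R \<phi> C1 by (simp add: \<rho>_def)
  have h: "psi_fun u v R1 R2 = h_fun u v \<alpha>"
    using psi_fun_stable_moments[of u v \<alpha> \<kappa>] uv \<alpha>_pos \<kappa>_pos by (simp add: R1_def R2_def u_def v_def)
  have lip: "\<bar>alpha_estimator K a X (\<nu> / \<alpha>) \<beta>\<^sub>1 \<beta>\<^sub>2 n \<omega> - \<alpha>\<bar> \<le> (C * C1) * \<bar>T n \<omega>\<bar>"
    if T: "\<bar>T n \<omega>\<bar> \<le> \<rho>" for n \<omega>
  proof -
    have T\<rho>: "\<bar>T n \<omega>\<bar> \<le> R1 / 2" "\<bar>T n \<omega>\<bar> \<le> R2 / 2" and T\<delta>: "\<bar>T n \<omega>\<bar> \<le> \<delta> / C1"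
      using T by (auto simp: \<rho>_def)
    have Tnn: "\<bar>W1 n \<omega> - R1\<bar> \<le> \<bar>T n \<omega>\<bar>" "\<bar>W2 n \<omega> - R2\<bar> \<le> \<bar>T n \<omega>\<bar>" by (auto simp: T_def)
    note d = order_trans[OF Tnn(1) T\<rho>(1)] order_trans[OF Tnn(2) T\<rho>(2)]
    note l1 = abs_ln_diff_le[OF R(1) d(1)] and l2 = abs_ln_diff_le[OF R(2) d(2)]
    have "\<bar>psi_fun u v (W1 n \<omega>) (W2 n \<omega>) - h_fun u v \<alpha>\<bar>
        = \<bar>u * (ln (W2 n \<omega>) - ln R2) - v * (ln (W1 n \<omega>) - ln R1)\<bar>"
      unfolding h[symmetric] by (simp add: psi_fun_def algebra_simps)
    also have "\<dots> \<le> \<bar>u * (ln (W2 n \<omega>) - ln R2)\<bar> + \<bar>v * (ln (W1 n \<omega>) - ln R1)\<bar>" by (rule abs_triangle_ineq4)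
    also have "\<dots> \<le> u * (2 / R2 * \<bar>T n \<omega>\<bar>) + v * (2 / R1 * \<bar>T n \<omega>\<bar>)"
    proof (rule add_mono)
      show "\<bar>u * (ln (W2 n \<omega>) - ln R2)\<bar> \<le> u * (2 / R2 * \<bar>T n \<omega>\<bar>)"
        using uv R unfolding abs_mult
        by (intro mult_mono order_trans[OF l2(2)] mult_left_mono Tnn) auto
      show "\<bar>v * (ln (W1 n \<omega>) - ln R1)\<bar> \<le> v * (2 / R1 * \<bar>T n \<omega>\<bar>)"
        using uv R unfolding abs_mult
        by (intro mult_mono order_trans[OF l1(2)] mult_left_mono Tnn) auto
    qed
    also have "\<dots> = C1 * \<bar>T n \<omega>\<bar>" by (simp add: C1_def algebra_simps)
    finally have psi: "\<bar>psi_fun u v (W1 n \<omega>) (W2 n \<omega>) - h_fun u v \<alpha>\<bar> \<le> C1 * \<bar>T n \<omega>\<bar>" .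
    also have "\<dots> \<le> \<delta>" using T\<delta> C1 by (simp add: pos_le_divide_eq mult.commute)
    finally have "\<bar>phi_fun u v (psi_fun u v (W1 n \<omega>) (W2 n \<omega>)) - \<alpha>\<bar> \<le> C * \<bar>psi_fun u v (W1 n \<omega>) (W2 n \<omega>) - h_fun u v \<alpha>\<bar>"
      by (rule \<phi>(3))
    also have "\<dots> \<le> C * (C1 * \<bar>T n \<omega>\<bar>)" using psi \<phi>(2) by (intro mult_left_mono) auto
    finally show ?thesis by (simp add: alpha_estimator_def u_def v_def W1_def W2_def mult.assoc)
  qed
  have Ym: "alpha_estimator K a X (\<nu> / \<alpha>) \<beta>\<^sub>1 \<beta>\<^sub>2 n \<in> borel_measurable P" for n
  proof -
    have [measurable]: "phi_fun u v \<in> borel_measurable borel" by (rule phi_fun_borel_measurable[OF uv(1,2)])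
    have "(\<lambda>\<omega>. phi_fun u v (psi_fun u v (W1 n \<omega>) (W2 n \<omega>))) \<in> borel_measurable P"
      unfolding psi_fun_def by measurable
    then show ?thesis by (simp add: alpha_estimator_def[abs_def] u_def v_def W1_def W2_def)
  qed
  have Tm: "T n \<in> borel_measurable P" for n unfolding T_def by measurable
  have CC: "C * C1 > 0" using \<phi> C1 by simp
  show "conv_in_prob P (at_top_along N) (alpha_estimator K a X (\<nu> / \<alpha>) \<beta>\<^sub>1 \<beta>\<^sub>2) (\<lambda>_. \<alpha>)"
    by (rule consistency_and_rate_from_mean_square(1)[where Y="alpha_estimator K a X (\<nu> / \<alpha>) \<beta>\<^sub>1 \<beta>\<^sub>2" and T=T and b=rate and B="2 * B1 + 2 * B2" and \<rho>=\<rho>,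
          OF N_ne Ym Tm T2 rate_pos[OF N(2)] rate_tendsto_0 \<rho> CC lip])
  show "OP P N rate (\<lambda>n \<omega>. alpha_estimator K a X (\<nu> / \<alpha>) \<beta>\<^sub>1 \<beta>\<^sub>2 n \<omega> - \<alpha>)"
    by (rule consistency_and_rate_from_mean_square(2)[where Y="alpha_estimator K a X (\<nu> / \<alpha>) \<beta>\<^sub>1 \<beta>\<^sub>2" and T=T and b=rate and B="2 * B1 + 2 * B2" and \<rho>=\<rho>,
          OF N_ne Ym Tm T2 rate_pos[OF N(2)] rate_tendsto_0 \<rho> CC lip])
qed

end

theorem theorem3p4:
  fixes P :: "'w measure"
    and X :: "real \<Rightarrow> 'w \<Rightarrow> real"
    and \<alpha> \<nu> H \<beta> \<beta>\<^sub>1 \<beta>\<^sub>2 :: real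
    and L K :: nat
    and a b :: "nat \<Rightarrow> real"
    and N\<^sub>H N\<^sub>\<alpha> :: "nat set"
  assumes "prob_space P"
    and "0 < \<alpha>" "\<alpha> < 2" "0 < \<nu>" "\<nu> < 1"
    and "takenaka_process P \<alpha> \<nu> X"
    and "L \<ge> 1" "K \<ge> 1"
    and "\<forall>q\<le>L. (\<Sum>k = 0..K. real k ^ q * a k) = 0"
    and "(\<Sum>k = 0..K. real k ^ (L + 1) * a k) \<noteq> 0"
    and "-1/2 < \<beta>" "\<beta> < 0"
    and "-1/2 < \<beta>\<^sub>1" "\<beta>\<^sub>1 < \<beta>\<^sub>2" "\<beta>\<^sub>2 < 0"
  defines "H \<equiv> \<nu> / \<alpha>"
    and "b \<equiv> (\<lambda>n. real n powr ((\<nu> - 1) / 2))"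
    and "N\<^sub>H \<equiv> {n. even n \<and> n div 2 \<ge> K}"
    and "N\<^sub>\<alpha> \<equiv> {n. n \<ge> K}"
  shows "conv_in_prob P (at_top_along N\<^sub>H) (H_estimator K a X \<beta>) (\<lambda>_. H) \<and>
         conv_in_prob P (at_top_along N\<^sub>\<alpha>) (alpha_estimator K a X H \<beta>\<^sub>1 \<beta>\<^sub>2) (\<lambda>_. \<alpha>) \<and>
         OP P N\<^sub>H b (\<lambda>n \<omega>. H_estimator K a X \<beta> n \<omega> - H) \<and>
         OP P N\<^sub>\<alpha> b (\<lambda>n \<omega>. alpha_estimator K a X H \<beta>\<^sub>1 \<beta>\<^sub>2 n \<omega> - \<alpha>)"
proof -
  interpret prob_space P by fact
  obtain M where M: "sas_random_measure P (takenaka_control \<nu>) \<alpha> M"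
    and X: "\<And>t. has_stochastic_integral P (takenaka_control \<nu>) \<alpha> M (indicator (takenaka_set t)) (X t)"
    using \<open>takenaka_process P \<alpha> \<nu> X\<close> by (auto simp: takenaka_process_def)
  have sum0: "(\<Sum>k = 0..K. a k) = 0"
    using \<open>\<forall>q\<le>L. (\<Sum>k = 0..K. real k ^ q * a k) = 0\<close>[rule_format, of 0] by simp
  have nz: "\<exists>k\<le>K. a k \<noteq> 0"
  proof (rule ccontr)
    assume "\<not> (\<exists>k\<le>K. a k \<noteq> 0)"
    then have "(\<Sum>k = 0..K. real k ^ (L + 1) * a k) = 0" by (intro sum.neutral) auto
    with \<open>(\<Sum>k = 0..K. real k ^ (L + 1) * a k) \<noteq> 0\<close> show False by simp
  qed
  interpret T: takenaka_increments P \<nu> \<alpha> M X K a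
    by unfold_locales (use M X sum0 nz assms(2,4,5) in auto)
  have b: "b = T.rate" by (intro ext) (simp add: b_def T.rate_def)
  show ?thesis
    unfolding H_def N\<^sub>H_def N\<^sub>\<alpha>_def b
    using T.H_estimator_rate[OF \<open>-1/2 < \<beta>\<close> \<open>\<beta> < 0\<close> \<open>K \<ge> 1\<close>]
      T.alpha_estimator_rate[OF \<open>-1/2 < \<beta>\<^sub>1\<close> \<open>\<beta>\<^sub>1 < \<beta>\<^sub>2\<close> \<open>\<beta>\<^sub>2 < 0\<close> \<open>K \<ge> 1\<close>]
    by blast
qed

end
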